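(* Let $M$ be a connected closed (i.e. compact, without boundary) surface embedded in $(\mathbb{R}^3,\|\cdot\|)$, with Minkowski mean curvature $H$ and area element $\omega$. Then $$\int_M H^2\,\omega\ \ge\ \lambda(\partial B),$$ where $\lambda(\partial B)$ is the area of the unit sphere $\partial B$, and equality holds if and only if $M$ is a Minkowski sphere.
   Context: $\|\cdot\|$ is a smooth and strictly convex norm on $\mathbb{R}^3$ with unit sphere $\partial B=\{x:\|x\|=1\}$; the usual (Euclidean) Gaussian curvature of the surface $\partial B$ is assumed to vanish nowhere. A vector $v$ is Birkhoff orthogonal to a plane $P\subseteq\mathbb{R}^3$ (through the origin) if $\|v\|\le\|v+tw\|$ for all $w\in P$, $t\in\mathbb{R}$. For a smooth orientable surface $M$ in $\mathbb{R}^3$, the Birkhoff-Gauss map $\eta:M\to\partial B$ is a smooth map such that $\eta(p)$ is Birkhoff orthogonal to $T_pM$ for each $p$. Since $T_{\eta(p)}\partial B=T_pM$ as linear planes, $d\eta_p$ is an endomorphism of $T_pM$; it is diagonalizable over $\mathbb{R}$. The Minkowski mean curvature is $H(p)=\tfrac12\mathrm{tr}(d\eta_p)$. The area element on $M$ is $\omega(X,Y)=\det(X,Y,\eta)$ ($M$ oriented so that $\omega$ is positive). For $\partial B$ the Birkhoff-Gauss map is the identity, and $\lambda(\partial B)=\int_{\partial B}\omega$ with $\omega(X,Y)=\det(X,Y,q)$ at $q\in\partial B$. A Minkowski sphere is a set $\{x:\|x-a\|=r\}$ with $a\in\mathbb{R}^3$, $r>0$. *)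

theory Defs
  imports "HOL-Analysis.Analysis"
begin

section \<open>Smooth maps and embedded surfaces\<close>

text \<open>The predicates \<open>Ck_on\<close> and \<open>smooth_on\<close> are meant for open sets \<open>S\<close> only.\<close>

primrec Ck_on :: "nat \<Rightarrow> ('a::real_normed_vector \<Rightarrow> 'b::real_normed_vector) \<Rightarrow> 'a set \<Rightarrow> bool" where
  "Ck_on 0 f S \<longleftrightarrow> continuous_on S f"
| "Ck_on (Suc k) f S \<longleftrightarrow>
     (\<forall>x\<in>S. f differentiable (at x)) \<and> (\<forall>v. Ck_on k (\<lambda>x. frechet_derivative f (at x) v) S)"

definition smooth_on :: "('a::real_normed_vector \<Rightarrow> 'b::real_normed_vector) \<Rightarrow> 'a set \<Rightarrow> bool" where
  "smooth_on f S \<longleftrightarrow> (\<forall>k. Ck_on k f S)"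

text \<open>Smoothness of a map on an arbitrary subset of the ambient space (for us, a surface):
  it extends, locally around each point, to a smooth map on an open set.\<close>

definition smooth_map_on :: "(real^3) set \<Rightarrow> (real^3 \<Rightarrow> real^3) \<Rightarrow> bool" where
  "smooth_map_on M f \<longleftrightarrow>
     (\<forall>p\<in>M. \<exists>W F. open W \<and> p \<in> W \<and> smooth_on F W \<and> (\<forall>x\<in>M \<inter> W. F x = f x))"

text \<open>Regular local parametrizations of \<open>M\<close>.\<close>

definition local_param :: "(real^3) set \<Rightarrow> (real^2) set \<Rightarrow> (real^2 \<Rightarrow> real^3) \<Rightarrow> bool" where
  "local_param M U \<phi> \<longleftrightarrow>
     open U \<and> smooth_on \<phi> U \<and>
     openin (top_of_set M) (\<phi> ` U) \<and> (\<exists>g. homeomorphism U (\<phi> ` U) \<phi> g) \<and>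
     (\<forall>x\<in>U. inj (frechet_derivative \<phi> (at x)))"

definition smooth_surface :: "(real^3) set \<Rightarrow> bool" where
  "smooth_surface M \<longleftrightarrow> (\<forall>p\<in>M. \<exists>U \<phi>. local_param M U \<phi> \<and> p \<in> \<phi> ` U)"

definition connected_closed_surface :: "(real^3) set \<Rightarrow> bool" where
  "connected_closed_surface M \<longleftrightarrow> smooth_surface M \<and> compact M \<and> connected M \<and> M \<noteq> {}"

definition tangent_space :: "(real^3) set \<Rightarrow> real^3 \<Rightarrow> (real^3) set" where
  "tangent_space M p =
     {v. \<exists>\<gamma> e. e > 0 \<and> smooth_on \<gamma> {-e<..<e} \<and> \<gamma> ` {-e<..<e} \<subseteq> M \<and> \<gamma> 0 = p \<and>
              (\<gamma> has_vector_derivative v) (at (0::real))}"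

text \<open>If \<open>f\<close> is smooth on the surface \<open>M\<close>, every derivative of \<open>f\<close> at \<open>p\<close> within \<open>M\<close> restricts to
  the differential of \<open>f\<close> on the tangent plane at \<open>p\<close>.  In directions transversal to the tangent
  plane its values are arbitrary, so \<open>surface_diff M f p\<close> may only be applied to tangent vectors.\<close>

definition surface_diff :: "(real^3) set \<Rightarrow> (real^3 \<Rightarrow> real^3) \<Rightarrow> real^3 \<Rightarrow> real^3 \<Rightarrow> real^3" where
  "surface_diff M f p = frechet_derivative f (at p within M)"


section \<open>Trace and determinant of an endomorphism of a plane\<close>

definition plane_basis :: "(real^3) set \<Rightarrow> (2 \<Rightarrow> real^3) \<Rightarrow> bool" where
  "plane_basis P b \<longleftrightarrow> inj b \<and> independent (range b) \<and> span (range b) = P"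

definition basis_matrix :: "(2 \<Rightarrow> real^3) \<Rightarrow> (real^3 \<Rightarrow> real^3) \<Rightarrow> real^2^2" where
  "basis_matrix b L = (\<chi> i j. representation (range b) (L (b j)) (b i))"

text \<open>For a linear map \<open>L\<close> sending the plane \<open>P\<close> into itself, neither of the following depends
  on the choice of the basis.\<close>

definition plane_trace :: "(real^3) set \<Rightarrow> (real^3 \<Rightarrow> real^3) \<Rightarrow> real" where
  "plane_trace P L = trace (basis_matrix (SOME b. plane_basis P b) L)"

definition plane_det :: "(real^3) set \<Rightarrow> (real^3 \<Rightarrow> real^3) \<Rightarrow> real" where
  "plane_det P L = det (basis_matrix (SOME b. plane_basis P b) L)"


section \<open>Euclidean Gaussian curvature\<close>

definition euclidean_gauss_map :: "(real^3) set \<Rightarrow> (real^3 \<Rightarrow> real^3) \<Rightarrow> bool" where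
  "euclidean_gauss_map S n \<longleftrightarrow>
     smooth_map_on S n \<and> (\<forall>p\<in>S. norm (n p) = 1 \<and> (\<forall>v\<in>tangent_space S p. n p \<bullet> v = 0))"

text \<open>For orientable \<open>S\<close>.  The choice of the Gauss map is immaterial: the determinant on a plane
  does not change when the unit normal is replaced by its negative.\<close>

definition gaussian_curvature :: "(real^3) set \<Rightarrow> real^3 \<Rightarrow> real" where
  "gaussian_curvature S p =
     plane_det (tangent_space S p) (surface_diff S (SOME n. euclidean_gauss_map S n) p)"


section \<open>Norms\<close>

definition is_norm :: "(real^3 \<Rightarrow> real) \<Rightarrow> bool" where
  "is_norm N \<longleftrightarrow>
     (\<forall>x. N x \<ge> 0) \<and> (\<forall>x. N x = 0 \<longleftrightarrow> x = 0) \<and>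
     (\<forall>c x. N (c *\<^sub>R x) = \<bar>c\<bar> * N x) \<and> (\<forall>x y. N (x + y) \<le> N x + N y)"

definition smooth_norm :: "(real^3 \<Rightarrow> real) \<Rightarrow> bool" where
  "smooth_norm N \<longleftrightarrow> is_norm N \<and> smooth_on N (- {0})"

definition strictly_convex_norm :: "(real^3 \<Rightarrow> real) \<Rightarrow> bool" where
  "strictly_convex_norm N \<longleftrightarrow> is_norm N \<and>
     (\<forall>x y t. N x = 1 \<and> N y = 1 \<and> x \<noteq> y \<and> 0 < t \<and> t < 1 \<longrightarrow> N ((1 - t) *\<^sub>R x + t *\<^sub>R y) < 1)"

definition unit_sphere :: "(real^3 \<Rightarrow> real) \<Rightarrow> (real^3) set" where
  "unit_sphere N = {x. N x = 1}"

definition minkowski_sphere :: "(real^3 \<Rightarrow> real) \<Rightarrow> (real^3) set \<Rightarrow> bool" where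
  "minkowski_sphere N M \<longleftrightarrow> (\<exists>a r. r > 0 \<and> M = {x. N (x - a) = r})"


section \<open>Birkhoff-Gauss map and Minkowski mean curvature\<close>

definition birkhoff_orthogonal :: "(real^3 \<Rightarrow> real) \<Rightarrow> real^3 \<Rightarrow> (real^3) set \<Rightarrow> bool" where
  "birkhoff_orthogonal N v P \<longleftrightarrow> (\<forall>w\<in>P. \<forall>t. N v \<le> N (v + t *\<^sub>R w))"

definition birkhoff_gauss_map :: "(real^3 \<Rightarrow> real) \<Rightarrow> (real^3) set \<Rightarrow> (real^3 \<Rightarrow> real^3) \<Rightarrow> bool" where
  "birkhoff_gauss_map N M \<eta> \<longleftrightarrow>
     smooth_map_on M \<eta> \<and>
     (\<forall>p\<in>M. \<eta> p \<in> unit_sphere N \<and> birkhoff_orthogonal N (\<eta> p) (tangent_space M p))"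

definition mean_curvature :: "(real^3) set \<Rightarrow> (real^3 \<Rightarrow> real^3) \<Rightarrow> real^3 \<Rightarrow> real" where
  "mean_curvature M \<eta> p = 1/2 * plane_trace (tangent_space M p) (surface_diff M \<eta> p)"


section \<open>Area element and integration\<close>

definition area_form :: "(real^3 \<Rightarrow> real^3) \<Rightarrow> real^3 \<Rightarrow> real^3 \<Rightarrow> real^3 \<Rightarrow> real" where
  "area_form \<eta> p X Y = det (vector [X, Y, \<eta> p] :: real^3^3)"

definition area_density :: "(real^3 \<Rightarrow> real^3) \<Rightarrow> (real^2 \<Rightarrow> real^3) \<Rightarrow> real^2 \<Rightarrow> real" where
  "area_density \<eta> \<phi> x =
     area_form \<eta> (\<phi> x) (frechet_derivative \<phi> (at x) (axis 1 1)) (frechet_derivative \<phi> (at x) (axis 2 1))"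

definition positive_param ::
    "(real^3) set \<Rightarrow> (real^3 \<Rightarrow> real^3) \<Rightarrow> (real^2) set \<Rightarrow> (real^2 \<Rightarrow> real^3) \<Rightarrow> bool" where
  "positive_param M \<eta> U \<phi> \<longleftrightarrow> local_param M U \<phi> \<and> (\<forall>x\<in>U. area_density \<eta> \<phi> x > 0)"

text \<open>Integration of functions against the positive \<open>2\<close>-form \<open>area_form \<eta>\<close> over the surface \<open>M\<close>
  is integration with respect to the unique Borel measure on \<open>M\<close> which in every positively
  oriented local parametrization is given by pulling the form back to the parameter domain.\<close>

definition is_area_measure ::
    "(real^3) set \<Rightarrow> (real^3 \<Rightarrow> real^3) \<Rightarrow> (real^3) measure \<Rightarrow> bool" where
  "is_area_measure M \<eta> \<mu> \<longleftrightarrow>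
     sets \<mu> = sets (restrict_space borel M) \<and>
     (\<forall>U \<phi> A. positive_param M \<eta> U \<phi> \<and> A \<in> sets borel \<and> A \<subseteq> U \<longrightarrow>
        emeasure \<mu> (\<phi> ` A) = (\<integral>\<^sup>+ x\<in>A. ennreal (area_density \<eta> \<phi> x) \<partial>lborel))"

definition area_measure :: "(real^3) set \<Rightarrow> (real^3 \<Rightarrow> real^3) \<Rightarrow> (real^3) measure" where
  "area_measure M \<eta> = (THE \<mu>. is_area_measure M \<eta> \<mu>)"

definition surface_integral ::
    "(real^3) set \<Rightarrow> (real^3 \<Rightarrow> real^3) \<Rightarrow> (real^3 \<Rightarrow> real) \<Rightarrow> real" where
  "surface_integral M \<eta> f = (\<integral>p. f p \<partial>area_measure M \<eta>)"

text \<open>The Birkhoff-Gauss map of the unit sphere is the identity.\<close>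

definition unit_sphere_area :: "(real^3 \<Rightarrow> real) \<Rightarrow> real" where
  "unit_sphere_area N = surface_integral (unit_sphere N) (\<lambda>q. q) (\<lambda>q. 1)"

end

theory Submission
  imports Defs
begin

text \<open>
  Write \<open>G\<close> for the gradient of \<open>N\<close> and \<open>K = det d\<eta>\<close>.  Differentiating \<open>G(\<eta>) \<bullet> X = 0\<close> for tangent
  \<open>X\<close> shows that \<open>d\<eta>\<close> is self-adjoint for the Hessian of \<open>N\<close>, which is positive definite on the tangent planes
  because the curvature of the unit sphere vanishes nowhere.  Hence \<open>H\<^sup>2 \<ge> K\<close>, with equality exactly at umbilic points.
  For each \<open>q\<close> in the unit sphere, \<open>\<eta> = \<plusminus> q\<close> at a point of \<open>M\<close> maximizing \<open>G(q)\<close>, and \<open>K \<ge> 0\<close> there.  Splitting these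
  points by sign, \<open>\<eta>\<close> on one part and \<open>-\<eta>\<close> on the other together cover the unit sphere; since the parts
  are disjoint and \<open>\<eta>\<close>, \<open>-\<eta>\<close> have Jacobian \<open>K\<close>, the integral of the positive part of \<open>K\<close> is at least the area of the sphere.
  This bypasses the global choice of an outer normal.  In the equality case \<open>H\<^sup>2\<close> is the positive part of \<open>K\<close>
  everywhere, so \<open>M\<close> is umbilic where \<open>K > 0\<close>; \<open>H\<close> is locally constant there, which makes that set closed,
  and \<open>\<eta> - c p\<close> is constant.
\<close>

section \<open>Calculus of \<open>C\<^sup>k\<close> maps\<close>

text \<open>\<open>area_measure\<close> is a definite description, so every statement on an integral
  waits for the existence and uniqueness of that measure. Both come from cutting a compact surface
  into finitely many disjoint Borel pieces, each inside one positive chart. Charts can be made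
  positive because \<eta> is nowhere tangent: the density has no zero, and exchanging the two
  parameters flips its sign.

  Change of variables enters only as an inequality: the area of an image is at most the integral of
  the Jacobian. It asks for neither injectivity nor a degree. Used in both directions between
  overlapping charts, it shows that they agree on areas; used for the homothety from the unit sphere
  onto a Minkowski sphere, it bounds the area of the latter from above, and the inequality already
  proved supplies the other half of that equality.

  In the equality case \<eta> is affine in the position, with a factor \<open>c\<close> of unknown
  sign. All of \<open>M\<close> then consists of supporting points of one kind, the other kind is
  excluded, and \<eta> maps \<open>M\<close> onto the unit sphere; hence \<open>M\<close> is a whole
  Minkowski sphere and not a piece of one.\<close>

abbreviation fderiv :: "('a::real_normed_vector \<Rightarrow> 'b::real_normed_vector) \<Rightarrow> 'a \<Rightarrow> 'a \<Rightarrow> 'b" where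
  "fderiv f x \<equiv> frechet_derivative f (at x)"

lemma Ck_on_cong:
  assumes "open S" "\<And>x. x \<in> S \<Longrightarrow> f x = g x" "Ck_on k f S"
  shows "Ck_on k g S"
  using assms(2,3)
proof (induction k arbitrary: f g)
  case 0
  then show ?case by (metis Ck_on.simps(1) continuous_on_cong)
next
  case (Suc k)
  have d: "f differentiable (at x)" if "x \<in> S" for x
    using Suc.prems that by simp
  have fd: "fderiv f x = fderiv g x" if "x \<in> S" for x
    using frechet_derivative_transform_within_open[OF d assms(1)] that Suc.prems by blast
  have "g differentiable (at x)" if "x \<in> S" for x
    using d[OF that] that Suc.prems(1) assms(1)
    by (metis differentiable_def has_derivative_transform_within_open)
  moreover have "Ck_on k (\<lambda>x. fderiv g x v) S" for v
    by (rule Suc.IH[of "\<lambda>x. fderiv f x v"]) (use fd Suc.prems in auto)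
  ultimately show ?case by simp
qed

text \<open>\<open>frechet_derivative\<close> is a choice; this rule lets an explicit derivative
  formula stand in for it, and the closure properties below rest on it.\<close>

lemma Ck_on_SucI:
  assumes "open S" "\<And>x. x \<in> S \<Longrightarrow> (f has_derivative f' x) (at x)"
    "\<And>v. Ck_on k (\<lambda>x. f' x v) S"
  shows "Ck_on (Suc k) f S"
proof -
  have "Ck_on k (\<lambda>x. fderiv f x v) S" for v
    by (rule Ck_on_cong[OF assms(1) _ assms(3)[of v]])
       (use assms(2) frechet_derivative_at in fastforce)
  then show ?thesis using assms(2) by (auto simp: differentiable_def)
qed

lemma Ck_on_SucD:
  assumes "Ck_on (Suc k) f S"
  shows "\<And>x. x \<in> S \<Longrightarrow> (f has_derivative fderiv f x) (at x)"
    and "Ck_on k (\<lambda>x. fderiv f x v) S"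
  using assms by (auto simp: frechet_derivative_works)

lemma Ck_on_Suc_imp: "Ck_on (Suc k) f S \<Longrightarrow> Ck_on k f S"
proof (induction k arbitrary: f)
  case 0
  then show ?case
    by (auto intro!: continuous_at_imp_continuous_on differentiable_imp_continuous_within)
next
  case (Suc k)
  have "\<forall>x\<in>S. f differentiable (at x)" "Ck_on (Suc k) (\<lambda>x. fderiv f x v) S" for v
    using Suc.prems by auto
  then show ?case using Suc.IH by (simp del: Ck_on.simps(2) add: Ck_on.simps(2)[of k])
qed

lemma Ck_on_le: "Ck_on k f S \<Longrightarrow> j \<le> k \<Longrightarrow> Ck_on j f S"
  by (induction k) (auto simp: le_Suc_eq dest: Ck_on_Suc_imp simp del: Ck_on.simps(2))

lemma Ck_on_imp_continuous_on: "Ck_on k f S \<Longrightarrow> continuous_on S f"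
  using Ck_on_le[of k f S 0] by simp

lemma Ck_on_subset: "Ck_on k f S \<Longrightarrow> T \<subseteq> S \<Longrightarrow> Ck_on k f T"
  by (induction k arbitrary: f) (auto intro: continuous_on_subset)

text \<open>Regularity is local; this glues the extensions provided by \<open>smooth_map_on\<close>,
  which share no common domain.\<close>

lemma Ck_on_local:
  assumes "\<And>x. x \<in> S \<Longrightarrow> \<exists>T. open T \<and> x \<in> T \<and> Ck_on k f T"
  shows "Ck_on k f S"
  using assms
proof (induction k arbitrary: f)
  case 0
  then show ?case
    by (metis Ck_on.simps(1) continuous_at_imp_continuous_on continuous_on_eq_continuous_at)
next
  case (Suc k)
  have "f differentiable (at x)" if "x \<in> S" for x using Suc.prems[OF that] by auto
  moreover have "Ck_on k (\<lambda>x. fderiv f x v) S" for v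
    using Suc.prems by (intro Suc.IH) fastforce
  ultimately show ?case by simp
qed

lemma Ck_on_const: "open S \<Longrightarrow> Ck_on k (\<lambda>x. c) S"
proof (induction k arbitrary: c)
  case (Suc k)
  show ?case by (rule Ck_on_SucI[where f' = "\<lambda>_ _. 0"]) (use Suc in auto)
qed auto

lemma Ck_on_bounded_linear:
  assumes "bounded_linear L" "Ck_on k f S" "open S"
  shows "Ck_on k (\<lambda>x. L (f x)) S"
  using assms(2)
proof (induction k arbitrary: f)
  case 0
  then show ?case using bounded_linear.continuous_on[OF assms(1)] by auto
next
  case (Suc k)
  show ?case
    by (rule Ck_on_SucI[OF assms(3), where f' = "\<lambda>x v. L (fderiv f x v)"])
       (use Suc.IH[OF Ck_on_SucD(2)[OF Suc.prems]]
          bounded_linear.has_derivative[OF assms(1) Ck_on_SucD(1)[OF Suc.prems]] in blast)+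
qed

lemma Ck_on_id:
  assumes "open S" shows "Ck_on k (\<lambda>x. x) S"
proof (cases k)
  case (Suc j)
  show ?thesis unfolding Suc
    by (rule Ck_on_SucI[where f' = "\<lambda>x v. v"]) (use assms Ck_on_const in auto)
qed auto

lemma Ck_on_add:
  assumes "open S" "Ck_on k f S" "Ck_on k g S" shows "Ck_on k (\<lambda>x. f x + g x) S"
  using assms(2,3)
proof (induction k arbitrary: f g)
  case 0
  then show ?case by (auto intro: continuous_on_add)
next
  case (Suc k)
  show ?case
    by (rule Ck_on_SucI[OF assms(1), where f' = "\<lambda>x v. fderiv f x v + fderiv g x v"])
       (use Suc Ck_on_SucD[OF Suc.prems(1)] Ck_on_SucD[OF Suc.prems(2)] has_derivative_add in auto)
qed

lemma Ck_on_bilinear: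
  assumes "bounded_bilinear B" "open S" "Ck_on k f S" "Ck_on k g S"
  shows "Ck_on k (\<lambda>x. B (f x) (g x)) S"
  using assms(3,4)
proof (induction k arbitrary: f g)
  case 0
  then show ?case using bounded_bilinear.continuous_on[OF assms(1)] by auto
next
  case (Suc k)
  show ?case
    by (rule Ck_on_SucI[OF assms(2), where f' = "\<lambda>x v. B (f x) (fderiv g x v) + B (fderiv f x v) (g x)"])
       (use bounded_bilinear.FDERIV[OF assms(1) Ck_on_SucD(1)[OF Suc.prems(1)] Ck_on_SucD(1)[OF Suc.prems(2)]]
          Ck_on_add[OF assms(2) Suc.IH[OF Ck_on_Suc_imp[OF Suc.prems(1)] Ck_on_SucD(2)[OF Suc.prems(2)]]
            Suc.IH[OF Ck_on_SucD(2)[OF Suc.prems(1)] Ck_on_Suc_imp[OF Suc.prems(2)]]] in blast)+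
qed

lemma Ck_on_minus: "open S \<Longrightarrow> Ck_on k f S \<Longrightarrow> Ck_on k (\<lambda>x. - f x) S"
  by (rule Ck_on_bounded_linear[OF bounded_linear_minus[OF bounded_linear_ident]])

lemmas Ck_on_scaleR = Ck_on_bilinear[OF bounded_bilinear_scaleR]
lemmas Ck_on_mult = Ck_on_bilinear[OF bounded_bilinear_mult]
lemmas Ck_on_inner = Ck_on_bilinear[OF bounded_bilinear_inner]

lemma Ck_on_sum:
  assumes "open S" "\<And>i. i \<in> I \<Longrightarrow> Ck_on k (f i) S"
  shows "Ck_on k (\<lambda>x. \<Sum>i\<in>I. f i x) S"
  using assms(2) by (induction I rule: infinite_finite_induct)
    (auto intro: Ck_on_const[OF assms(1)] Ck_on_add[OF assms(1)])

text \<open>The derivative of \<open>1 / f\<close> again involves \<open>1 / f\<close>, but one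
  order of regularity lower, so the induction feeds itself.\<close>

lemma Ck_on_inverse:
  fixes f :: "'a::real_normed_vector \<Rightarrow> real"
  assumes "open S" "Ck_on k f S" "\<And>x. x \<in> S \<Longrightarrow> f x \<noteq> 0"
  shows "Ck_on k (\<lambda>x. inverse (f x)) S"
  using assms(2)
proof (induction k)
  case 0
  then show ?case using assms(3) by (auto intro: continuous_on_inverse)
next
  case (Suc k)
  have i: "Ck_on k (\<lambda>x. inverse (f x)) S" using Suc Ck_on_Suc_imp by blast
  show ?case
  proof (rule Ck_on_SucI[OF assms(1)])
    show "((\<lambda>x. inverse (f x)) has_derivative (\<lambda>v. - (inverse (f x) * fderiv f x v * inverse (f x)))) (at x)"
      if "x \<in> S" for x
      using Deriv.has_derivative_inverse[OF _ Ck_on_SucD(1)[OF Suc.prems that]] assms(3) that by auto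
    show "Ck_on k (\<lambda>x. - (inverse (f x) * fderiv f x v * inverse (f x))) S" for v
      using Ck_on_SucD(2)[OF Suc.prems] i assms(1) by (intro Ck_on_minus Ck_on_mult) auto
  qed
qed

text \<open>The direction \<open>fderiv g x v\<close> in the chain rule varies with
  \<open>x\<close>, while \<open>Ck_on\<close> speaks of derivatives in fixed directions. Expanding
  it in the basis of the Euclidean middle space separates the two and lets the induction
  run.\<close>

lemma Ck_on_compose:
  fixes f :: "'b::euclidean_space \<Rightarrow> 'c::real_normed_vector"
    and g :: "'a::real_normed_vector \<Rightarrow> 'b"
  assumes "open S" "open T" "Ck_on k f T" "Ck_on k g S" "g ` S \<subseteq> T"
  shows "Ck_on k (\<lambda>x. f (g x)) S"
  using assms(3,4)
proof (induction k arbitrary: f)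
  case 0
  then show ?case using assms(5) by (auto intro: continuous_on_compose2)
next
  case (Suc k)
  have *: "((\<lambda>x. f (g x)) has_derivative
      (\<lambda>v. \<Sum>b\<in>Basis. (fderiv g x v \<bullet> b) *\<^sub>R fderiv f (g x) b)) (at x)"
    if "x \<in> S" for x
  proof -
    have f: "(f has_derivative fderiv f (g x)) (at (g x))"
      using Ck_on_SucD(1)[OF Suc.prems(1)] that assms(5) by auto
    then have l: "linear (fderiv f (g x))" using has_derivative_linear by blast
    have eq: "fderiv f (g x) w = (\<Sum>b\<in>Basis. (w \<bullet> b) *\<^sub>R fderiv f (g x) b)" for w
    proof -
      have "fderiv f (g x) w = fderiv f (g x) (\<Sum>b\<in>Basis. (w \<bullet> b) *\<^sub>R b)"
        by (simp only: euclidean_representation)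
      then show ?thesis by (simp only: linear_sum[OF l] linear_cmul[OF l])
    qed
    show ?thesis
      unfolding eq[symmetric] by (rule has_derivative_compose[OF Ck_on_SucD(1)[OF Suc.prems(2) that] f])
  qed
  show ?case
  proof (rule Ck_on_SucI[OF assms(1) *])
    fix v
    show "Ck_on k (\<lambda>x. \<Sum>b\<in>Basis. (fderiv g x v \<bullet> b) *\<^sub>R fderiv f (g x) b) S"
      using Ck_on_SucD(2)[OF Suc.prems(1)] Ck_on_SucD(2)[OF Suc.prems(2)] Ck_on_Suc_imp[OF Suc.prems(2)] assms(1)
      by (intro Ck_on_sum Ck_on_scaleR Ck_on_inner Suc.IH Ck_on_const) auto
  qed 
qed

lemma smooth_on_subset: "smooth_on f S \<Longrightarrow> T \<subseteq> S \<Longrightarrow> smooth_on f T"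
  unfolding smooth_on_def using Ck_on_subset by blast

lemma smooth_on_imp_continuous_on: "smooth_on f S \<Longrightarrow> continuous_on S f"
  unfolding smooth_on_def using Ck_on_imp_continuous_on by blast

lemma smooth_on_imp_has_derivative:
  "smooth_on f S \<Longrightarrow> x \<in> S \<Longrightarrow> (f has_derivative fderiv f x) (at x)"
  unfolding smooth_on_def using Ck_on_SucD(1) by blast

lemma smooth_on_frechet_derivative:
  "smooth_on f S \<Longrightarrow> smooth_on (\<lambda>x. fderiv f x v) S"
  unfolding smooth_on_def using Ck_on_SucD(2) by blast

lemma smooth_on_frechet_linear:
  "smooth_on f S \<Longrightarrow> x \<in> S \<Longrightarrow> linear (fderiv f x)"
  using smooth_on_imp_has_derivative has_derivative_linear by blast

lemma smooth_on_compose: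
  fixes f :: "'b::euclidean_space \<Rightarrow> 'c::real_normed_vector"
  assumes "open S" "open T" "smooth_on f T" "smooth_on g S" "g ` S \<subseteq> T"
  shows "smooth_on (\<lambda>x. f (g x)) S"
  using Ck_on_compose assms unfolding smooth_on_def by blast

lemma has_vector_derivative_along_line:
  assumes "(f has_derivative f') (at (x + s *\<^sub>R v))"
  shows "((\<lambda>s. f (x + s *\<^sub>R v)) has_vector_derivative f' v) (at s)"
proof -
  have "((\<lambda>s. f (x + s *\<^sub>R v)) has_derivative (\<lambda>h. f' (h *\<^sub>R v))) (at s)"
    by (rule has_derivative_compose[where f = "\<lambda>s. x + s *\<^sub>R v", OF _ assms])
       (auto intro!: derivative_eq_intros)
  then show ?thesis
    using linear_cmul[OF has_derivative_linear[OF assms]] by (simp add: has_vector_derivative_def)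
qed

lemma has_derivative_locally_constant:
  assumes "(f has_derivative f') (at x)" "open U" "x \<in> U" "\<And>y. y \<in> U \<Longrightarrow> f y = c"
  shows "f' h = 0"
proof -
  have "((\<lambda>_. c) has_derivative f') (at x)"
    by (rule has_derivative_transform_within_open[OF assms(1-3)]) (use assms(4) in simp)
  then have "f' = (\<lambda>_. 0)" by (rule has_derivative_unique[OF _ has_derivative_const])
  then show ?thesis by simp
qed

text \<open>Schwarz: both mixed derivatives are the limit of the second difference quotient
  over the square of side \<open>t\<close>, evaluated by applying the mean value theorem twice.\<close>

lemma second_difference_mean_value:
  fixes f :: "'a::real_normed_vector \<Rightarrow> real"
  assumes "open S" "Ck_on 2 f S" "x \<in> S" "e > 0"
  shows "\<exists>d>0. \<forall>t. 0 < t \<and> t < d \<longrightarrow>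
     \<bar>f (x + t *\<^sub>R v + t *\<^sub>R w) - f (x + t *\<^sub>R v) - f (x + t *\<^sub>R w) + f x
       - t\<^sup>2 * fderiv (\<lambda>y. frechet_derivative f (at y) v) x w\<bar> \<le> e * t\<^sup>2"
proof -
  define f1 where "f1 y = fderiv f y v" for y
  define f2 where "f2 y = fderiv f1 y w" for y
  have C1: "Ck_on (Suc 0) f1 S"
    using assms(2) Ck_on_SucD(2) unfolding numeral_2_eq_2 f1_def by blast
  then have C2: "Ck_on 0 f2 S" using Ck_on_SucD(2) unfolding f2_def by blast
  have df: "(f has_derivative fderiv f y) (at y)" if "y \<in> S" for y
    using assms(2) that Ck_on_SucD(1) numeral_2_eq_2 by metis
  have df1: "(f1 has_derivative fderiv f1 y) (at y)" if "y \<in> S" for y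
    using C1 that Ck_on_SucD(1) by blast
  have "continuous (at x) f2" using C2 assms continuous_on_eq_continuous_at by auto
  then obtain r where r: "r > 0" "\<And>y. dist y x < r \<Longrightarrow> \<bar>f2 y - f2 x\<bar> < e"
    unfolding continuous_at_eps_delta using assms(4) by (metis dist_real_def)
  obtain r' where r': "r' > 0" "ball x r' \<subseteq> S" using assms openE by blast
  \<comment> \<open>For sides shorter than \<open>d\<close> the parallelogram stays in
    \<open>S\<close> and in the ball where \<open>f2\<close> differs from \<open>f2 x\<close> by
    less than \<open>e\<close>.\<close>
  define d where "d = min r r' / (norm v + norm w + 1)"
  have "d > 0" using r r' by (simp add: d_def add_nonneg_pos)
  have near: "dist (x + s *\<^sub>R v + u *\<^sub>R w) x < min r r'" if "0 \<le> s" "s \<le> t" "0 \<le> u" "u \<le> t" "0 < t" "t < d" for s t u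
  proof -
    have "norm (s *\<^sub>R v + u *\<^sub>R w) \<le> s * norm v + u * norm w"
      using norm_triangle_ineq[of "s *\<^sub>R v" "u *\<^sub>R w"] that by simp
    also have "\<dots> \<le> t * norm v + t * norm w" using that by (intro add_mono mult_right_mono) auto
    also have "\<dots> \<le> t * (norm v + norm w + 1)" using that by (simp add: algebra_simps)
    also have "\<dots> < d * (norm v + norm w + 1)" using that by (intro mult_strict_right_mono) (auto simp: add_nonneg_pos)
    also have "\<dots> = min r r'" unfolding d_def
      using add_nonneg_pos[of "norm v + norm w" 1] by simp
    finally show ?thesis by (simp add: dist_norm add.assoc)
  qed
  have "\<bar>f (x + t *\<^sub>R v + t *\<^sub>R w) - f (x + t *\<^sub>R v) - f (x + t *\<^sub>R w) + f x - t\<^sup>2 * f2 x\<bar> \<le> e * t\<^sup>2"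
    if t: "0 < t" "t < d" for t
  proof -
    have inS: "x + s *\<^sub>R v + u *\<^sub>R w \<in> S" if "0 \<le> s" "s \<le> t" "0 \<le> u" "u \<le> t" for s u
      using near[OF that t] r'(2) by (auto simp: dist_commute subset_iff)
    define \<phi> where "\<phi> s = f (x + s *\<^sub>R v + t *\<^sub>R w) - f (x + s *\<^sub>R v)" for s
    have d\<phi>: "(\<phi> has_real_derivative (f1 (x + s *\<^sub>R v + t *\<^sub>R w) - f1 (x + s *\<^sub>R v))) (at s)"
      if "0 \<le> s" "s \<le> t" for s
    proof -
      have "x + t *\<^sub>R w + s *\<^sub>R v \<in> S" "x + s *\<^sub>R v \<in> S"
        using inS[of s t] inS[of s 0] that t by (simp_all add: algebra_simps)
      from has_vector_derivative_along_line[OF df[OF this(1)]] has_vector_derivative_along_line[OF df[OF this(2)]]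
      have "((\<lambda>s. f (x + t *\<^sub>R w + s *\<^sub>R v) - f (x + s *\<^sub>R v)) has_real_derivative
          f1 (x + t *\<^sub>R w + s *\<^sub>R v) - f1 (x + s *\<^sub>R v)) (at s)"
        unfolding f1_def has_real_derivative_iff_has_vector_derivative by (rule has_vector_derivative_diff)
      then show ?thesis unfolding \<phi>_def by (simp add: algebra_simps)
    qed
    obtain s where s: "0 < s" "s < t" "\<phi> t - \<phi> 0 = t * (f1 (x + s *\<^sub>R v + t *\<^sub>R w) - f1 (x + s *\<^sub>R v))"
      using MVT2[OF t(1), of \<phi> "\<lambda>s. f1 (x + s *\<^sub>R v + t *\<^sub>R w) - f1 (x + s *\<^sub>R v)"] d\<phi> by auto
    have d\<psi>: "((\<lambda>u. f1 (x + s *\<^sub>R v + u *\<^sub>R w)) has_real_derivative f2 (x + s *\<^sub>R v + u *\<^sub>R w)) (at u)"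
      if "0 \<le> u" "u \<le> t" for u
      using has_vector_derivative_along_line[OF df1[OF inS[of s u]]] that t s
      unfolding f2_def has_real_derivative_iff_has_vector_derivative by auto
    obtain u where u: "0 < u" "u < t" "f1 (x + s *\<^sub>R v + t *\<^sub>R w) - f1 (x + s *\<^sub>R v) = t * f2 (x + s *\<^sub>R v + u *\<^sub>R w)"
      using MVT2[OF t(1), of "\<lambda>u. f1 (x + s *\<^sub>R v + u *\<^sub>R w)" "\<lambda>u. f2 (x + s *\<^sub>R v + u *\<^sub>R w)"] d\<psi> by auto
    have "f (x + t *\<^sub>R v + t *\<^sub>R w) - f (x + t *\<^sub>R v) - f (x + t *\<^sub>R w) + f x - t\<^sup>2 * f2 x
        = t\<^sup>2 * (f2 (x + s *\<^sub>R v + u *\<^sub>R w) - f2 x)"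
      using s u by (simp add: \<phi>_def algebra_simps power2_eq_square)
    moreover have "\<bar>f2 (x + s *\<^sub>R v + u *\<^sub>R w) - f2 x\<bar> \<le> e"
      using r(2) near[of s t u] s u t by (simp add: less_imp_le)
    ultimately show ?thesis
      using mult_left_mono[of "\<bar>f2 (x + s *\<^sub>R v + u *\<^sub>R w) - f2 x\<bar>" e "t\<^sup>2"]
      by (simp add: abs_mult mult.commute)
  qed
  then show ?thesis using \<open>d > 0\<close> unfolding f2_def f1_def by auto
qed

lemma second_derivative_symmetric_real:
  fixes f :: "'a::real_normed_vector \<Rightarrow> real"
  assumes "open S" "Ck_on 2 f S" "x \<in> S"
  shows "fderiv (\<lambda>y. frechet_derivative f (at y) v) x w
       = fderiv (\<lambda>y. frechet_derivative f (at y) w) x v" (is "?a = ?b")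
proof (rule ccontr)
  assume "?a \<noteq> ?b"
  \<comment> \<open>With a third of the gap, two errors of size \<open>e * t\<^sup>2\<close> cannot
    bridge the difference \<open>3 * e * t\<^sup>2\<close>.\<close>
  define e where "e = \<bar>?a - ?b\<bar> / 3"
  have "e > 0" using \<open>?a \<noteq> ?b\<close> by (simp add: e_def)
  obtain d1 d2 where d: "d1 > 0" "d2 > 0"
    "\<And>t. 0 < t \<Longrightarrow> t < d1 \<Longrightarrow> \<bar>f (x + t *\<^sub>R v + t *\<^sub>R w) - f (x + t *\<^sub>R v) - f (x + t *\<^sub>R w) + f x - t\<^sup>2 * ?a\<bar> \<le> e * t\<^sup>2"
    "\<And>t. 0 < t \<Longrightarrow> t < d2 \<Longrightarrow> \<bar>f (x + t *\<^sub>R w + t *\<^sub>R v) - f (x + t *\<^sub>R w) - f (x + t *\<^sub>R v) + f x - t\<^sup>2 * ?b\<bar> \<le> e * t\<^sup>2"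
    using second_difference_mean_value[OF assms \<open>e > 0\<close>, of v w]
      second_difference_mean_value[OF assms \<open>e > 0\<close>, of w v] by auto
  define t where "t = min d1 d2 / 2"
  have t: "0 < t" "t < d1" "t < d2" using d by (auto simp: t_def)
  have eq: "x + t *\<^sub>R w + t *\<^sub>R v = x + t *\<^sub>R v + t *\<^sub>R w" by simp
  have "\<bar>t\<^sup>2 * ?a - t\<^sup>2 * ?b\<bar> \<le> 2 * (e * t\<^sup>2)"
    using d(3)[OF t(1,2)] d(4)[OF t(1,3)] unfolding eq abs_le_iff by argo
  moreover have "\<bar>t\<^sup>2 * ?a - t\<^sup>2 * ?b\<bar> = t\<^sup>2 * (3 * e)"
    by (simp add: e_def abs_mult flip: right_diff_distrib)
  ultimately have "t\<^sup>2 * e \<le> 0" by argo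
  then show False using t \<open>e > 0\<close> by (simp add: mult_le_0_iff)
qed

lemma second_derivative_symmetric:
  fixes f :: "'a::real_normed_vector \<Rightarrow> 'b::euclidean_space"
  assumes "open S" "smooth_on f S" "x \<in> S"
  shows "fderiv (\<lambda>y. frechet_derivative f (at y) v) x w
       = fderiv (\<lambda>y. frechet_derivative f (at y) w) x v"
proof (rule euclidean_eqI)
  fix b :: 'b assume "b \<in> Basis"
  have bl: "bounded_linear (\<lambda>y. y \<bullet> b)" by (rule bounded_linear_inner_left)
  have 1: "fderiv (\<lambda>y. f y \<bullet> b) y = (\<lambda>v. fderiv f y v \<bullet> b)" if "y \<in> S" for y
    using frechet_derivative_at[OF bounded_linear.has_derivative[OF bl smooth_on_imp_has_derivative[OF assms(2) that]]] by simp
  have 2: "fderiv (\<lambda>y. frechet_derivative f (at y) v) x w \<bullet> b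
     = fderiv (\<lambda>y. fderiv (\<lambda>y. f y \<bullet> b) y v) x w" for v w
  proof -
    have "((\<lambda>y. fderiv f y v \<bullet> b) has_derivative
       (\<lambda>w. fderiv (\<lambda>y. frechet_derivative f (at y) v) x w \<bullet> b)) (at x)"
      using bounded_linear.has_derivative[OF bl smooth_on_imp_has_derivative[OF smooth_on_frechet_derivative[OF assms(2)] assms(3)]] .
    then have "((\<lambda>y. fderiv (\<lambda>y. f y \<bullet> b) y v) has_derivative
       (\<lambda>w. fderiv (\<lambda>y. frechet_derivative f (at y) v) x w \<bullet> b)) (at x)"
      by (rule has_derivative_transform_within_open[OF _ assms(1,3)]) (simp add: 1)
    then show ?thesis using frechet_derivative_at by metis
  qed
  have "Ck_on 2 (\<lambda>y. f y \<bullet> b) S"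
    using Ck_on_bounded_linear[OF bl _ assms(1)] assms(2) by (auto simp: smooth_on_def)
  from second_derivative_symmetric_real[OF assms(1) this assms(3)]
  show "fderiv (\<lambda>y. frechet_derivative f (at y) v) x w \<bullet> b
       = fderiv (\<lambda>y. frechet_derivative f (at y) w) x v \<bullet> b"
    by (simp add: 2)
qed

section \<open>Local parametrizations\<close>

definition triple :: "real^3 \<Rightarrow> real^3 \<Rightarrow> real^3 \<Rightarrow> real" where
  "triple a b c = det (vector [a, b, c] :: real^3^3)"

lemma triple_expand:
  "triple a b c = a$1 * (b$2 * c$3 - b$3 * c$2) + a$2 * (b$3 * c$1 - b$1 * c$3) + a$3 * (b$1 * c$2 - b$2 * c$1)"
  by (simp add: triple_def det_3 algebra_simps)

lemma triple_add:
  "triple (a + a') b c = triple a b c + triple a' b c"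
  "triple a (b + b') c = triple a b c + triple a b' c"
  "triple a b (c + c') = triple a b c + triple a b c'"
  by (simp_all add: triple_expand algebra_simps)

lemma triple_scale:
  "triple (r *\<^sub>R a) b c = r * triple a b c"
  "triple a (r *\<^sub>R b) c = r * triple a b c"
  "triple a b (r *\<^sub>R c) = r * triple a b c"
  by (simp_all add: triple_expand algebra_simps)

lemma triple_minus:
  "triple (- a) b c = - triple a b c"
  "triple a (- b) c = - triple a b c"
  "triple a b (- c) = - triple a b c"
  by (simp_all add: triple_expand algebra_simps)

lemma triple_same: "triple a a c = 0" "triple a b a = 0" "triple a b b = 0"
  by (simp_all add: triple_expand algebra_simps)

lemma triple_swap: "triple b a c = - triple a b c"
  by (simp add: triple_expand algebra_simps)

text \<open>Cramer's rule with the denominator cleared: a polynomial identity in the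
  coordinates.\<close>

lemma triple_cramer:
  "triple a b c *\<^sub>R x = triple x b c *\<^sub>R a + triple a x c *\<^sub>R b + triple a b x *\<^sub>R c"
  by (simp add: vec_eq_iff forall_3 triple_expand algebra_simps)

lemma triple_basis_expansion:
  assumes "triple a b c \<noteq> 0"
  shows "x = (triple x b c / triple a b c) *\<^sub>R a + (triple a x c / triple a b c) *\<^sub>R b
     + (triple a b x / triple a b c) *\<^sub>R c"
proof -
  have "x = inverse (triple a b c) *\<^sub>R (triple a b c *\<^sub>R x)" using assms by simp
  also have "\<dots> = inverse (triple a b c) *\<^sub>R (triple x b c *\<^sub>R a + triple a x c *\<^sub>R b + triple a b x *\<^sub>R c)"
    by (rule arg_cong[OF triple_cramer])
  finally show ?thesis by (simp add: scaleR_add_right divide_inverse mult.commute)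
qed

lemma inner_3: "(x::real^3) \<bullet> y = x$1 * y$1 + x$2 * y$2 + x$3 * y$3"
  by (simp add: inner_vec_def sum_3)

text \<open>The product of two determinants is the determinant of the matrix of mutual inner
  products; orthogonality to \<open>c\<close> leaves \<open>n \<bullet> c\<close> times the Gram
  determinant of \<open>x\<close> and \<open>y\<close>.\<close>

lemma triple_gram:
  assumes "x \<bullet> c = 0" "y \<bullet> c = 0"
  shows "triple x y n * triple x y c = (n \<bullet> c) * ((x \<bullet> x) * (y \<bullet> y) - (x \<bullet> y)\<^sup>2)"
proof -
  have "triple x y n * triple x y c = (x \<bullet> x) * ((y \<bullet> y) * (n \<bullet> c) - (y \<bullet> c) * (n \<bullet> y))
     - (x \<bullet> y) * ((y \<bullet> x) * (n \<bullet> c) - (y \<bullet> c) * (n \<bullet> x))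
     + (x \<bullet> c) * ((y \<bullet> x) * (n \<bullet> y) - (y \<bullet> y) * (n \<bullet> x))"
    unfolding inner_3 triple_expand by algebra
  then show ?thesis using assms by (simp add: power2_eq_square inner_commute algebra_simps)
qed

lemma triple_nonzero:
  assumes ind: "\<And>s t. s *\<^sub>R x + t *\<^sub>R y = 0 \<Longrightarrow> s = 0 \<and> t = 0"
    and c: "x \<bullet> c = 0" "y \<bullet> c = 0" "n \<bullet> c \<noteq> 0"
  shows "triple x y n \<noteq> 0"
proof
  assume "triple x y n = 0"
  then have g: "(x \<bullet> x) * (y \<bullet> y) - (x \<bullet> y)\<^sup>2 = 0"
    using triple_gram[OF c(1,2), of n] c(3) by simp
  \<comment> \<open>\<open>w\<close> is \<open>y \<bullet> y\<close> times the component of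
    \<open>x\<close> orthogonal to \<open>y\<close>; its square is a multiple of the Gram
    determinant.\<close>
  define w where "w = (y \<bullet> y) *\<^sub>R x + (- (x \<bullet> y)) *\<^sub>R y"
  have "w \<bullet> w = (y \<bullet> y) * ((x \<bullet> x) * (y \<bullet> y) - (x \<bullet> y)\<^sup>2)"
    unfolding w_def by (simp add: inner_add_left inner_add_right inner_diff_left inner_diff_right inner_commute power2_eq_square algebra_simps)
  then have "w = 0" using g by simp
  then have "y \<bullet> y = 0" using ind unfolding w_def by blast
  then show False using ind[of 0 1] by simp
qed

definition pd :: "2 \<Rightarrow> (real^2 \<Rightarrow> 'a::real_normed_vector) \<Rightarrow> real^2 \<Rightarrow> 'a" where
  "pd i f x = fderiv f x (axis i 1)"

lemma vec2_axis: "(w::real^2) = w$1 *\<^sub>R axis 1 1 + w$2 *\<^sub>R axis 2 1"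
  by (simp add: vec_eq_iff forall_2 axis_def)

lemma frechet_derivative_pd:
  assumes "linear (fderiv f x)"
  shows "fderiv f x w = w$1 *\<^sub>R pd 1 f x + w$2 *\<^sub>R pd 2 f x"
proof -
  have "fderiv f x w = fderiv f x (w$1 *\<^sub>R axis 1 1 + w$2 *\<^sub>R axis 2 1)"
    by (rule arg_cong[OF vec2_axis])
  then show ?thesis by (simp only: pd_def linear_add[OF assms] linear_cmul[OF assms])
qed

lemma pd_eqI: "(f has_derivative f') (at x) \<Longrightarrow> pd i f x = f' (axis i 1)"
  unfolding pd_def using frechet_derivative_at by metis

lemma smooth_on_pd: "smooth_on f S \<Longrightarrow> smooth_on (pd i f) S"
  unfolding pd_def using smooth_on_frechet_derivative by blast

lemma area_density_triple:
  "area_density \<eta> \<phi> x = triple (pd 1 \<phi> x) (pd 2 \<phi> x) (\<eta> (\<phi> x))"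
  by (simp add: area_density_def area_form_def triple_def pd_def)

lemma continuous_on_triple:
  assumes "continuous_on S f" "continuous_on S g" "continuous_on S h"
  shows "continuous_on S (\<lambda>x. triple (f x) (g x) (h x))"
  unfolding triple_expand by (intro continuous_intros assms)

text \<open>Injectivity of \<open>A\<close> gives \<open>c * norm h \<le> norm (A h)\<close>, so
  \<open>g y - u\<close> is controlled by \<open>y - \<phi> u\<close> and the remainder of \<phi>
  becomes a remainder of \<open>g\<close>. The derivative is taken within the image, the only place
  where \<open>g\<close> is meaningful.\<close>

lemma homeomorphism_inverse_has_derivative:
  fixes \<phi> :: "'a::euclidean_space \<Rightarrow> 'b::euclidean_space"
  assumes hom: "homeomorphism U W \<phi> g" and u: "u \<in> U"
    and A: "(\<phi> has_derivative A) (at u within U)"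
    and B: "linear B" "\<And>h. B (A h) = h"
  shows "(g has_derivative B) (at (\<phi> u) within W)"
  unfolding has_derivative_within_alt
proof (intro conjI allI impI)
  show blB: "bounded_linear B" using B linear_conv_bounded_linear by blast
  fix e :: real assume "e > 0"
  have "linear A" using A has_derivative_linear by blast
  moreover have "inj A" using B(2) by (metis injI)
  ultimately obtain c where c: "c > 0" "\<And>h. c * norm h \<le> norm (A h)"
    using linear_inj_bounded_below_pos by metis
  obtain K where K: "K > 0" "\<And>z. norm (B z) \<le> norm z * K"
    using bounded_linear.pos_bounded[OF blB] by blast
  \<comment> \<open>The bound \<open>c / 2\<close> lets the remainder be absorbed into the lower
    bound for \<open>A\<close>; the other one makes the final constant equal to
    \<open>e\<close>.\<close>
  define e1 where "e1 = min (c / 2) (e * c / (2 * K))"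
  have e1: "e1 > 0" "e1 \<le> c / 2" "K * e1 * 2 \<le> e * c"
    using \<open>e > 0\<close> c K by (auto simp: e1_def min_def field_simps)
  obtain d1 where d1: "d1 > 0" "\<And>x. x \<in> U \<Longrightarrow> norm (x - u) < d1 \<Longrightarrow>
      norm (\<phi> x - \<phi> u - A (x - u)) \<le> e1 * norm (x - u)"
    using A e1(1) unfolding has_derivative_within_alt by blast
  have pu: "\<phi> u \<in> W" "g (\<phi> u) = u" using hom u by (auto simp: homeomorphism_def)
  have "continuous (at (\<phi> u) within W) g"
    using hom pu by (auto simp: homeomorphism_def continuous_on_eq_continuous_within)
  then obtain d where d: "d > 0" "\<And>y. y \<in> W \<Longrightarrow> dist y (\<phi> u) < d \<Longrightarrow> dist (g y) u < d1"
    unfolding continuous_within_eps_delta pu(2) using d1(1) by blast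
  have "norm (g y - g (\<phi> u) - B (y - \<phi> u)) \<le> e * norm (y - \<phi> u)"
    if y: "y \<in> W" "norm (y - \<phi> u) < d" for y
  proof -
    define h where "h = g y - u"
    have gy: "g y \<in> U" "\<phi> (g y) = y" using hom y by (auto simp: homeomorphism_def)
    have r: "norm (y - \<phi> u - A h) \<le> e1 * norm h"
      using d1(2)[OF gy(1)] d(2)[OF y(1)] y(2) gy(2) by (simp add: h_def dist_norm)
    have "c * norm h \<le> norm (y - \<phi> u) + e1 * norm h"
      using c(2)[of h] r norm_triangle_ineq4[of "y - \<phi> u" "y - \<phi> u - A h"] by simp
    moreover have "e1 * norm h \<le> c / 2 * norm h" using e1(2) by (intro mult_right_mono) auto
    ultimately have h: "c * norm h \<le> 2 * norm (y - \<phi> u)" by simp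
    have "norm (h - B (y - \<phi> u)) = norm (B (y - \<phi> u - A h))"
      using linear_diff[OF B(1)] B(2) by (simp add: norm_minus_commute)
    also have "\<dots> \<le> e1 * norm h * K" using K r by (meson less_imp_le mult_right_mono order_trans)
    finally have "c * norm (h - B (y - \<phi> u)) \<le> (c * norm h) * (e1 * K)"
      using c(1) by (simp add: mult.assoc mult.left_commute)
    also have "\<dots> \<le> (2 * norm (y - \<phi> u)) * (e1 * K)"
      using h e1 K by (intro mult_right_mono) auto
    also have "\<dots> = (K * e1 * 2) * norm (y - \<phi> u)" by simp
    also have "\<dots> \<le> (e * c) * norm (y - \<phi> u)" using e1(3) by (intro mult_right_mono) auto
    finally have "c * norm (h - B (y - \<phi> u)) \<le> c * (e * norm (y - \<phi> u))" by (simp add: mult.commute mult.left_commute)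
    then show ?thesis using c(1) pu by (simp add: h_def)
  qed
  then show "\<exists>d>0. \<forall>y\<in>W. norm (y - \<phi> u) < d \<longrightarrow>
      norm (g y - g (\<phi> u) - B (y - \<phi> u)) \<le> e * norm (y - \<phi> u)"
    using d(1) by blast
qed

section \<open>Charts: inverse, tangent space, restriction, composition\<close>

context
  fixes M U \<phi>
  assumes lp: "local_param M U \<phi>"
begin

lemma lp_open: "open U" and lp_smooth: "smooth_on \<phi> U"
  and lp_openin: "openin (top_of_set M) (\<phi> ` U)"
  and lp_inj: "u \<in> U \<Longrightarrow> inj (fderiv \<phi> u)"
  using lp unfolding local_param_def by auto

lemma lp_has_derivative: "u \<in> U \<Longrightarrow> (\<phi> has_derivative fderiv \<phi> u) (at u)"
  using lp_smooth smooth_on_imp_has_derivative by blast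

lemma lp_linear: "u \<in> U \<Longrightarrow> linear (fderiv \<phi> u)"
  using lp_has_derivative has_derivative_linear by blast

lemma lp_continuous: "continuous_on U \<phi>"
  using lp_smooth smooth_on_imp_continuous_on by blast

lemma lp_subset: "\<phi> ` U \<subseteq> M"
  using lp_openin openin_imp_subset by blast

text \<open>Fixes \<open>inv_into U \<phi>\<close> as the one chart inverse, in place of the
  anonymous one in \<open>local_param\<close>.\<close>

lemma lp_homeomorphism: "homeomorphism U (\<phi> ` U) \<phi> (inv_into U \<phi>)"
proof -
  obtain g where g: "homeomorphism U (\<phi> ` U) \<phi> g" using lp unfolding local_param_def by blast
  then have inj: "inj_on \<phi> U" using homeomorphism_apply1 inj_on_inverseI by metis
  have "continuous_on (\<phi> ` U) (inv_into U \<phi>)"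
    by (rule continuous_on_eq[OF homeomorphism_cont2[OF g]])
       (use g inj in \<open>auto simp: homeomorphism_apply1\<close>)
  then show ?thesis
    unfolding homeomorphism_def using inj lp_continuous by (simp add: f_inv_into_f)
qed

lemma lp_inj_on: "inj_on \<phi> U"
  using homeomorphism_apply1[OF lp_homeomorphism] by (rule inj_on_inverseI)

lemma lp_inverse_has_derivative:
  assumes "u \<in> U"
  obtains B where "linear B" "\<And>w. B (fderiv \<phi> u w) = w"
    "(inv_into U \<phi> has_derivative B) (at (\<phi> u) within \<phi> ` U)"
proof -
  obtain B where B: "linear B" "B \<circ> fderiv \<phi> u = id"
    using linear_injective_left_inverse[OF lp_linear[OF assms] lp_inj[OF assms]] by blast
  have "(inv_into U \<phi> has_derivative B) (at (\<phi> u) within \<phi> ` U)"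
    by (rule homeomorphism_inverse_has_derivative[OF lp_homeomorphism assms
          has_derivative_at_withinI[OF lp_has_derivative[OF assms]] B(1)])
       (use B(2) in \<open>metis comp_apply id_apply\<close>)
  then show ?thesis using that B by (metis comp_apply id_apply)
qed

lemma lp_derivative_pd:
  "u \<in> U \<Longrightarrow> fderiv \<phi> u w = w$1 *\<^sub>R pd 1 \<phi> u + w$2 *\<^sub>R pd 2 \<phi> u"
  by (rule frechet_derivative_pd[OF lp_linear])

lemma lp_pd_independent:
  assumes "u \<in> U" "s *\<^sub>R pd 1 \<phi> u + t *\<^sub>R pd 2 \<phi> u = 0"
  shows "s = 0 \<and> t = 0"
proof -
  have "fderiv \<phi> u (vector [s, t]) = fderiv \<phi> u 0"
    using assms by (simp add: lp_derivative_pd linear_0[OF lp_linear])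
  then have "(vector [s, t] :: real^2) = 0" using lp_inj[OF assms(1)] by (meson injD)
  then show ?thesis by (metis vector_2 zero_index)
qed

text \<open>Lines in the parameter plane push forward to curves in \<open>M\<close>. Conversely a
  curve in \<open>M\<close> is pulled back to the parameter plane, where it is differentiable by
  \<open>lp_inverse_has_derivative\<close>.\<close>

lemma tangent_space_chart:
  assumes u: "u \<in> U"
  shows "tangent_space M (\<phi> u) = range (fderiv \<phi> u)"
proof (intro equalityI subsetI)
  fix v assume "v \<in> range (fderiv \<phi> u)"
  then obtain w where w: "v = fderiv \<phi> u w" by blast
  obtain r where r: "r > 0" "ball u r \<subseteq> U" using lp_open u openE by blast
  \<comment> \<open>Keeps the segment inside the ball around \<open>u\<close>; the
    \<open>+ 1\<close> covers \<open>w = 0\<close>.\<close>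
  define e where "e = r / (norm w + 1)"
  have e: "e > 0" using r by (simp add: e_def add_nonneg_pos)
  have inU: "u + t *\<^sub>R w \<in> U" if "t \<in> {-e<..<e}" for t
  proof -
    have "norm (t *\<^sub>R w) \<le> \<bar>t\<bar> * (norm w + 1)" by (simp add: mult_left_mono)
    also have "\<dots> < e * (norm w + 1)" using that by (intro mult_strict_right_mono) (auto simp: add_nonneg_pos)
    also have "\<dots> = r" unfolding e_def using add_nonneg_pos[of "norm w" 1] by simp
    finally show ?thesis using r by (auto simp: dist_norm subset_iff)
  qed
  have sm: "smooth_on (\<lambda>t. \<phi> (u + t *\<^sub>R w)) {-e<..<e}"
  proof (rule smooth_on_compose[OF _ lp_open lp_smooth])
    show "smooth_on (\<lambda>t. u + t *\<^sub>R w) {-e<..<e}"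
      unfolding smooth_on_def by (auto intro!: Ck_on_add Ck_on_scaleR Ck_on_const Ck_on_id)
  qed (use inU in auto)
  have "((\<lambda>t. \<phi> (u + t *\<^sub>R w)) has_vector_derivative v) (at 0)"
    unfolding w using has_vector_derivative_along_line[of \<phi> _ u 0 w] lp_has_derivative[OF u] by simp
  then show "v \<in> tangent_space M (\<phi> u)"
    unfolding tangent_space_def using e sm inU lp_subset
    by (auto intro!: exI[of _ "\<lambda>t. \<phi> (u + t *\<^sub>R w)"] exI[of _ e])
next
  fix v assume "v \<in> tangent_space M (\<phi> u)"
  then obtain \<gamma> e where g: "e > 0" "smooth_on \<gamma> {-e<..<e}" "\<gamma> ` {-e<..<e} \<subseteq> M" "\<gamma> 0 = \<phi> u"
    "(\<gamma> has_vector_derivative v) (at (0::real))"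
    unfolding tangent_space_def by blast
  obtain T where T: "open T" "\<phi> ` U = M \<inter> T" using lp_openin by (meson openin_open)
  \<comment> \<open>The times at which the curve is in the image of the chart; only for these can it
    be pulled back.\<close>
  define I where "I = {-e<..<e} \<inter> \<gamma> -` T"
  have oI: "open I"
    unfolding I_def using smooth_on_imp_continuous_on[OF g(2)] T(1) by (intro continuous_open_preimage) auto
  have zI: "0 \<in> I" using g T u by (auto simp: I_def)
  have gI: "\<gamma> ` I \<subseteq> \<phi> ` U" using g(3) T by (auto simp: I_def)
  obtain B where B: "linear B" "\<And>w. B (fderiv \<phi> u w) = w"
    "(inv_into U \<phi> has_derivative B) (at (\<phi> u) within \<phi> ` U)"
    using lp_inverse_has_derivative[OF u] by blast
  have g0: "(\<gamma> has_derivative (\<lambda>h. h *\<^sub>R v)) (at 0)" using g(5) by (simp add: has_vector_derivative_def)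
  have "((\<lambda>t. inv_into U \<phi> (\<gamma> t)) has_derivative (\<lambda>h. B (h *\<^sub>R v))) (at 0 within I)"
    by (rule has_derivative_in_compose[OF has_derivative_at_withinI[OF g0]])
       (use has_derivative_subset[OF B(3) gI] g(4) in simp)
  then have "((\<lambda>t. inv_into U \<phi> (\<gamma> t)) has_derivative (\<lambda>h. B (h *\<^sub>R v))) (at 0)"
    using at_within_open[OF zI oI] by simp
  moreover have iu: "inv_into U \<phi> (\<gamma> 0) = u" using g(4) lp_inj_on u by simp
  ultimately have "((\<lambda>t. \<phi> (inv_into U \<phi> (\<gamma> t))) has_derivative (\<lambda>h. fderiv \<phi> u (B (h *\<^sub>R v)))) (at 0)"
    using has_derivative_compose[of "\<lambda>t. inv_into U \<phi> (\<gamma> t)" "\<lambda>h. B (h *\<^sub>R v)" 0 UNIV \<phi>] lp_has_derivative[OF u] by simp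
  then have "(\<gamma> has_derivative (\<lambda>h. fderiv \<phi> u (B (h *\<^sub>R v)))) (at 0)"
    by (rule has_derivative_transform_within_open[OF _ oI zI]) (use gI in \<open>auto simp: f_inv_into_f subset_iff\<close>)
  then have "(\<lambda>h. h *\<^sub>R v) = (\<lambda>h. fderiv \<phi> u (B (h *\<^sub>R v)))"
    using g0 has_derivative_unique by blast
  then have "1 *\<^sub>R v = fderiv \<phi> u (B (1 *\<^sub>R v))" by meson
  then show "v \<in> range (fderiv \<phi> u)" by simp
qed

lemma local_param_subset:
  assumes "open V" "V \<subseteq> U"
  shows "local_param M V \<phi>"
proof -
  have "openin (top_of_set (\<phi> ` U)) (\<phi> ` V)"
    by (rule homeomorphism_imp_open_map[OF lp_homeomorphism]) (use assms in \<open>auto simp: openin_open\<close>)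
  then have "openin (top_of_set M) (\<phi> ` V)" using lp_openin openin_trans by blast
  moreover have "homeomorphism V (\<phi> ` V) \<phi> (inv_into U \<phi>)"
    by (rule homeomorphism_of_subsets[OF lp_homeomorphism assms(2)]) (use assms in auto)
  ultimately show ?thesis
    unfolding local_param_def using assms smooth_on_subset[OF lp_smooth assms(2)] lp_inj by blast
qed

lemma lp_compose_has_derivative:
  assumes "u \<in> U" "(f has_derivative L) (at (\<phi> u) within M)"
  shows "((\<lambda>x. f (\<phi> x)) has_derivative (\<lambda>w. L (fderiv \<phi> u w))) (at u)"
proof -
  have "((\<lambda>x. f (\<phi> x)) has_derivative (\<lambda>w. L (fderiv \<phi> u w))) (at u within U)"
    by (rule has_derivative_in_compose[OF has_derivative_at_withinI[OF lp_has_derivative[OF assms(1)]]])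
       (rule has_derivative_subset[OF assms(2) lp_subset])
  then show ?thesis using at_within_open[OF assms(1) lp_open] by simp
qed

lemma lp_compose_smooth:
  assumes "smooth_map_on M f"
  shows "smooth_on (\<lambda>x. f (\<phi> x)) U"
  unfolding smooth_on_def
proof (intro allI Ck_on_local)
  fix k u assume u: "u \<in> U"
  then obtain W F where W: "open W" "\<phi> u \<in> W" "smooth_on F W" "\<forall>x\<in>M \<inter> W. F x = f x"
    using assms lp_subset unfolding smooth_map_on_def by blast
  define T where "T = U \<inter> \<phi> -` W"
  have oT: "open T" unfolding T_def using lp_continuous lp_open W(1) by (rule continuous_open_preimage)
  have "smooth_on (\<lambda>x. F (\<phi> x)) T"
    by (rule smooth_on_compose[OF oT W(1) W(3)])
       (use smooth_on_subset[OF lp_smooth] in \<open>auto simp: T_def\<close>)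
  then have "Ck_on k (\<lambda>x. F (\<phi> x)) T" by (simp add: smooth_on_def)
  then have "Ck_on k (\<lambda>x. f (\<phi> x)) T"
    by (rule Ck_on_cong[OF oT, rotated]) (use W(4) lp_subset in \<open>auto simp: T_def\<close>)
  then show "\<exists>T. open T \<and> u \<in> T \<and> Ck_on k (\<lambda>x. f (\<phi> x)) T"
    using oT u W(2) by (auto simp: T_def)
qed

lemma lp_relatively_open: 
  obtains T where "open T" "\<phi> ` U = M \<inter> T"
  using lp_openin by (meson openin_open)

end

text \<open>\<open>surface_diff\<close> chooses some derivative within \<open>M\<close>; a local
  smooth extension shows that there is one to choose.\<close>

lemma smooth_map_on_has_derivative:
  assumes "smooth_map_on M f" "p \<in> M"
  shows "(f has_derivative surface_diff M f p) (at p within M)"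
proof -
  obtain W F where W: "open W" "p \<in> W" "smooth_on F W" "\<forall>x\<in>M \<inter> W. F x = f x"
    using assms unfolding smooth_map_on_def by blast
  obtain r where r: "r > 0" "ball p r \<subseteq> W" using W openE by blast
  have "(F has_derivative fderiv F p) (at p within M)"
    using smooth_on_imp_has_derivative[OF W(3,2)] has_derivative_at_withinI by blast
  then have "(f has_derivative fderiv F p) (at p within M)"
    by (rule has_derivative_transform_within[OF _ r(1) assms(2)])
       (use W r in \<open>auto simp: dist_commute subset_iff\<close>)
  then show ?thesis
    unfolding surface_diff_def by (metis differentiable_def frechet_derivative_works)
qed

lemma smooth_map_on_continuous: "smooth_map_on M f \<Longrightarrow> continuous_on M f"
  using smooth_map_on_has_derivative has_derivative_continuous
  by (metis continuous_on_eq_continuous_within)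

text \<open>The common hypothesis of the area theory, which is applied both to \<open>M\<close> with
  \<eta> and to the unit sphere with the identity.\<close>

definition transversal :: "(real^3) set \<Rightarrow> (real^3 \<Rightarrow> real^3) \<Rightarrow> bool" where
  "transversal M \<eta> \<longleftrightarrow> continuous_on M \<eta> \<and>
     (\<forall>U \<phi>. local_param M U \<phi> \<longrightarrow> (\<forall>u\<in>U. area_density \<eta> \<phi> u \<noteq> 0))"

lemma area_density_continuous:
  assumes "continuous_on M \<eta>" "local_param M U \<phi>"
  shows "continuous_on U (area_density \<eta> \<phi>)"
  unfolding area_density_triple
  by (intro continuous_on_triple smooth_on_imp_continuous_on smooth_on_pd lp_smooth[OF assms(2)]
        continuous_on_compose2[OF assms(1) lp_continuous[OF assms(2)] lp_subset[OF assms(2)]])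

section \<open>Reversing the orientation of a chart by exchanging its parameters\<close>

definition swap2 :: "real^2 \<Rightarrow> real^2" where
  "swap2 x = vector [x$2, x$1]"

lemma swap2_linear: "linear swap2"
  by (rule linearI) (simp_all add: swap2_def vec_eq_iff forall_2)

lemma swap2_swap2 [simp]: "swap2 (swap2 x) = x"
  by (simp add: swap2_def vec_eq_iff forall_2)

lemma swap2_axis [simp]: "swap2 (axis 1 1) = axis 2 1" "swap2 (axis 2 1) = axis 1 1"
  by (simp_all add: swap2_def vec_eq_iff forall_2 axis_def)

lemma swap2_bounded_linear: "bounded_linear swap2"
  using swap2_linear linear_conv_bounded_linear by blast

lemma swap2_derivative:
  assumes "local_param M U \<phi>" "swap2 x \<in> U"
  shows "((\<lambda>x. \<phi> (swap2 x)) has_derivative (\<lambda>w. fderiv \<phi> (swap2 x) (swap2 w))) (at x)"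
  by (rule has_derivative_compose[OF bounded_linear_imp_has_derivative[OF swap2_bounded_linear] lp_has_derivative[OF assms]])

lemma local_param_swap2:
  assumes lp: "local_param M U \<phi>"
  shows "local_param M (swap2 ` U) (\<lambda>x. \<phi> (swap2 x))"
proof -
  have im: "(\<lambda>x. \<phi> (swap2 x)) ` swap2 ` U = \<phi> ` U" by (simp add: image_image)
  have eq: "swap2 ` U = swap2 -` U" by (auto intro: image_eqI[where x = "swap2 _"])
  have cont: "continuous_on S swap2" for S
    using swap2_bounded_linear linear_continuous_on by blast
  have o: "open (swap2 ` U)"
    unfolding eq using lp_open[OF lp] cont by (rule open_vimage)
  have sm: "smooth_on (\<lambda>x. \<phi> (swap2 x)) (swap2 ` U)"
    by (rule smooth_on_compose[OF o lp_open[OF lp] lp_smooth[OF lp]])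
       (auto simp: smooth_on_def image_image intro: Ck_on_bounded_linear[OF swap2_bounded_linear Ck_on_id[OF o] o])
  have "homeomorphism (swap2 ` U) U swap2 swap2"
    unfolding homeomorphism_def using cont by (auto simp: image_image)
  then have hom: "homeomorphism (swap2 ` U) (\<phi> ` U) (\<phi> \<circ> swap2) (swap2 \<circ> inv_into U \<phi>)"
    using lp_homeomorphism[OF lp] by (rule homeomorphism_compose)
  have inj: "inj (fderiv (\<lambda>x. \<phi> (swap2 x)) x)" if "x \<in> swap2 ` U" for x
  proof -
    have x: "swap2 x \<in> U" using that by auto
    have "fderiv (\<lambda>x. \<phi> (swap2 x)) x = (\<lambda>w. fderiv \<phi> (swap2 x) (swap2 w))"
      using frechet_derivative_at[OF swap2_derivative[OF lp x]] by simp
    moreover have "inj swap2" by (metis injI swap2_swap2)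
    ultimately show ?thesis
      using inj_compose[OF lp_inj[OF lp x], of swap2] by (simp add: o_def)
  qed
  show ?thesis
    unfolding local_param_def im using o sm lp_openin[OF lp] hom inj by (auto simp: o_def)
qed

lemma area_density_swap2:
  assumes "local_param M U \<phi>" "swap2 x \<in> U"
  shows "area_density \<eta> (\<lambda>x. \<phi> (swap2 x)) x = - area_density \<eta> \<phi> (swap2 x)"
  unfolding area_density_triple pd_eqI[OF swap2_derivative[OF assms]]
  by (simp add: pd_def) (rule triple_swap)

abbreviation chart_area :: "(real^3 \<Rightarrow> real^3) \<Rightarrow> (real^2 \<Rightarrow> real^3) \<Rightarrow> (real^2) set \<Rightarrow> ennreal" where
  "chart_area \<eta> \<phi> A \<equiv> (\<integral>\<^sup>+ x\<in>A. ennreal (area_density \<eta> \<phi> x) \<partial>lborel)"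

text \<open>On a small ball the density stays within \<open>\<bar>d u\<bar>\<close> of its value at
  the centre, so it keeps its sign and is at most \<open>2 * \<bar>d u\<bar>\<close> in size. This
  gives finite area, and a negative sign is repaired by \<open>swap2\<close>.\<close>

lemma positive_param_exists:
  assumes tr: "transversal M \<eta>" and lp: "local_param M U \<phi>" and u: "u \<in> U"
  obtains V \<psi> where "positive_param M \<eta> V \<psi>" "\<phi> u \<in> \<psi> ` V" "\<psi> ` V \<subseteq> \<phi> ` U"
    "chart_area \<eta> \<psi> V < \<infinity>"
proof -
  define d where "d = area_density \<eta> \<phi>"
  have d0: "d u \<noteq> 0" using tr lp u by (auto simp: transversal_def d_def)
  have "continuous_on U d" unfolding d_def
    using area_density_continuous lp tr transversal_def by blast
  then have "continuous (at u) d" using u lp_open[OF lp] continuous_on_eq_continuous_at by blast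
  then obtain r1 where r1: "r1 > 0" "\<And>x. dist x u < r1 \<Longrightarrow> \<bar>d x - d u\<bar> < \<bar>d u\<bar>"
    unfolding continuous_at_eps_delta using d0 by (metis dist_real_def zero_less_abs_iff)
  obtain r2 where r2: "r2 > 0" "ball u r2 \<subseteq> U" using lp_open[OF lp] u openE by blast
  define r where "r = min r1 r2"
  have r: "r > 0" "ball u r \<subseteq> U" using r1 r2 by (auto simp: r_def)
  have near: "\<bar>d x - d u\<bar> < \<bar>d u\<bar>" if "x \<in> ball u r" for x using r1(2) that by (auto simp: r_def dist_commute)
  have lpb: "local_param M (ball u r) \<phi>" using local_param_subset[OF lp _ r(2)] by simp
  have fin: "chart_area \<eta> \<psi> V < \<infinity>"
    if "open V" "bounded V" "\<And>x. x \<in> V \<Longrightarrow> area_density \<eta> \<psi> x \<le> 2 * \<bar>d u\<bar>" for V \<psi>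
  proof -
    have "chart_area \<eta> \<psi> V \<le> (\<integral>\<^sup>+ x\<in>V. ennreal (2 * \<bar>d u\<bar>) \<partial>lborel)"
      using that(3) by (intro nn_integral_mono) (auto simp: indicator_def intro: ennreal_leI)
    also have "\<dots> = ennreal (2 * \<bar>d u\<bar>) * emeasure lborel V"
      using that(1) by (subst nn_integral_cmult_indicator) auto
    also have "\<dots> < \<infinity>" using emeasure_bounded_finite[OF that(2)] by (simp add: ennreal_mult_less_top)
    finally show ?thesis .
  qed
  show ?thesis
  proof (cases "d u > 0")
    case True
    show ?thesis
    proof (rule that)
      show "positive_param M \<eta> (ball u r) \<phi>"
        unfolding positive_param_def using lpb near True by (force simp: d_def)
      show "chart_area \<eta> \<phi> (ball u r) < \<infinity>"
        by (rule fin) (use near in \<open>force simp: d_def\<close>)+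
    qed (use r in auto)
  next
    case False
    have b: "swap2 x \<in> ball u r" if "x \<in> swap2 ` ball u r" for x using that by auto
    have dens: "area_density \<eta> (\<lambda>x. \<phi> (swap2 x)) x = - d (swap2 x)" if "x \<in> swap2 ` ball u r" for x
      unfolding d_def by (rule area_density_swap2[OF lpb b[OF that]])
    have lps: "local_param M (swap2 ` ball u r) (\<lambda>x. \<phi> (swap2 x))" by (rule local_param_swap2[OF lpb])
    show ?thesis
    proof (rule that)
      show "positive_param M \<eta> (swap2 ` ball u r) (\<lambda>x. \<phi> (swap2 x))"
        unfolding positive_param_def using lps False near[OF b] dens by force
      show "(\<integral>\<^sup>+ x\<in>swap2 ` ball u r. ennreal (area_density \<eta> (\<lambda>x. \<phi> (swap2 x)) x) \<partial>lborel) < \<infinity>"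
      proof (rule fin)
        show "open (swap2 ` ball u r)" using lp_open[OF lps] .
        show "bounded (swap2 ` ball u r)" using bounded_linear_image[OF bounded_ball swap2_bounded_linear] .
        show "area_density \<eta> (\<lambda>x. \<phi> (swap2 x)) x \<le> 2 * \<bar>d u\<bar>" if "x \<in> swap2 ` ball u r" for x
          using near[OF b[OF that]] dens[OF that] by linarith
      qed
      show "\<phi> u \<in> (\<lambda>x. \<phi> (swap2 x)) ` swap2 ` ball u r" using r by (auto simp: image_image)
      show "(\<lambda>x. \<phi> (swap2 x)) ` swap2 ` ball u r \<subseteq> \<phi> ` U" using r by (auto simp: image_image)
    qed
  qed
qed

section \<open>The area measure and images under smooth maps\<close>

text \<open>The unsigned area density pulled back along \<open>F\<close>, where \<open>F\<close> may
  be any smooth map into a surface with field \<open>n\<close>, possibly singular and not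
  injective.\<close>

definition jac :: "(real^2 \<Rightarrow> real^3) \<Rightarrow> (real^3 \<Rightarrow> real^3) \<Rightarrow> real^2 \<Rightarrow> real" where
  "jac F n u = \<bar>triple (pd 1 F u) (pd 2 F u) (n (F u))\<bar>"

lemma positive_paramD:
  assumes "positive_param M \<eta> U \<phi>"
  shows "local_param M U \<phi>" "u \<in> U \<Longrightarrow> area_density \<eta> \<phi> u > 0"
  using assms by (auto simp: positive_param_def)

lemma jac_positive_param: "positive_param M \<eta> U \<phi> \<Longrightarrow> u \<in> U \<Longrightarrow> jac \<phi> \<eta> u = area_density \<eta> \<phi> u"
  using positive_paramD(2)[of M \<eta> U \<phi> u] by (simp add: jac_def area_density_triple)

text \<open>\<open>integral_on_image_ubound_nonneg\<close>, a statement on gauge integrals, is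
  carried over to nonnegative Lebesgue integrals. As \<open>g\<close> may be many-to-one, only an
  inequality can hold; measurability over the image is part of the conclusion, since images of Borel
  sets need not be Borel.\<close>

lemma nn_integral_image_ubound:
  fixes f :: "real^2 \<Rightarrow> real" and g :: "real^2 \<Rightarrow> real^2"
  assumes S: "S \<in> sets borel" and nn: "\<And>x. x \<in> S \<Longrightarrow> 0 \<le> f (g x)"
    and der: "\<And>x. x \<in> S \<Longrightarrow> (g has_derivative g' x) (at x within S)"
    and D: "\<And>x. x \<in> S \<Longrightarrow> D x = \<bar>det (matrix (g' x))\<bar> * f (g x)"
    and meas: "(\<lambda>x. indicator S x *\<^sub>R D x) \<in> borel_measurable borel"
    and fin: "(\<integral>\<^sup>+ x\<in>S. ennreal (D x) \<partial>lborel) < \<infinity>"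
  shows "(\<lambda>y. ennreal (f y) * indicator (g ` S) y) \<in> borel_measurable lebesgue \<and>
    (\<integral>\<^sup>+ y\<in>g ` S. ennreal (f y) \<partial>lebesgue) \<le> (\<integral>\<^sup>+ x\<in>S. ennreal (D x) \<partial>lborel)"
proof -
  have eq: "(\<integral>\<^sup>+ x\<in>S. ennreal (D x) \<partial>lborel) = (\<integral>\<^sup>+ x. ennreal (indicator S x *\<^sub>R D x) \<partial>lborel)"
    by (intro nn_integral_cong) (auto simp: indicator_def)
  have Dnn: "0 \<le> indicator S x *\<^sub>R D x" for x using D nn by (auto simp: indicator_def)
  have int: "integrable lborel (\<lambda>x. indicator S x *\<^sub>R D x)"
    by (rule integrableI_nonneg) (use meas Dnn fin eq in auto)
  have ifs: "(\<lambda>x. indicator S x *\<^sub>R D x) = (\<lambda>x. if x \<in> S then D x else 0)" by (auto simp: indicator_def)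
  have I1: "D integrable_on S"
    using integrable_on_lborel[OF int] unfolding ifs by (simp add: integrable_restrict_UNIV)
  have I2: "integral S D = (\<integral>x. indicator S x *\<^sub>R D x \<partial>lborel)"
    using integral_lborel[OF int] unfolding ifs by (simp add: integral_restrict_UNIV)
  have I3: "(\<lambda>x. \<bar>det (matrix (g' x))\<bar> * f (g x)) integrable_on S"
    by (rule integrable_eq[OF I1 D])
  have I4: "integral S (\<lambda>x. \<bar>det (matrix (g' x))\<bar> * f (g x)) = integral S D"
    by (rule integral_cong) (use D in auto)
  have f: "f integrable_on g ` S" "integral (g ` S) f \<le> integral S D"
    using integral_on_image_ubound_nonneg[OF nn der I3] I4 by auto
  have fa: "f absolutely_integrable_on g ` S"
    using f(1) nn by (subst absolutely_integrable_on_iff_nonneg) auto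
  then have fi: "integrable lebesgue (\<lambda>y. indicator (g ` S) y *\<^sub>R f y)"
    by (simp add: set_integrable_def)
  have eqf: "(\<lambda>y. ennreal (f y) * indicator (g ` S) y) = (\<lambda>y. ennreal (indicator (g ` S) y *\<^sub>R f y))"
    by (auto simp: indicator_def)
  have "(\<integral>\<^sup>+ y\<in>g ` S. ennreal (f y) \<partial>lebesgue) = ennreal (\<integral>y. indicator (g ` S) y *\<^sub>R f y \<partial>lebesgue)"
    unfolding eqf by (rule nn_integral_eq_integral[OF fi]) (use nn in \<open>auto simp: indicator_def\<close>)
  also have "\<dots> = ennreal (integral (g ` S) f)"
    using set_lebesgue_integral_eq_integral(2)[OF fa] by (simp add: set_lebesgue_integral_def)
  also have "\<dots> \<le> ennreal (integral S D)" using f(2) by (rule ennreal_leI)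
  also have "\<dots> = (\<integral>\<^sup>+ x\<in>S. ennreal (D x) \<partial>lborel)"
    unfolding I2 eq by (rule nn_integral_eq_integral[symmetric, OF int]) (use Dnn in auto)
  finally have le: "(\<integral>\<^sup>+ y\<in>g ` S. ennreal (f y) \<partial>lebesgue) \<le> (\<integral>\<^sup>+ x\<in>S. ennreal (D x) \<partial>lborel)" .
  have "(\<lambda>y. ennreal (indicator (g ` S) y *\<^sub>R f y)) \<in> borel_measurable lebesgue"
    using borel_measurable_integrable[OF fi] by simp
  then show ?thesis using le eqf by simp
qed

lemma det_matrix_2:
  fixes T :: "real^2 \<Rightarrow> real^2"
  shows "det (matrix T) = T (axis 1 1) $ 1 * T (axis 2 1) $ 2 - T (axis 2 1) $ 1 * T (axis 1 1) $ 2"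
  by (simp add: det_2 matrix_def)

lemma jac_continuous:
  assumes "continuous_on M2 n" "smooth_on F U" "F ` U \<subseteq> M2"
  shows "continuous_on U (jac F n)"
  unfolding jac_def
  by (intro continuous_intros continuous_on_triple smooth_on_imp_continuous_on smooth_on_pd assms
        continuous_on_compose2[OF assms(1) smooth_on_imp_continuous_on[OF assms(2)] assms(3)])

lemma indicator_continuous_measurable:
  fixes f :: "real^2 \<Rightarrow> real"
  assumes "continuous_on U f" "S \<in> sets borel" "S \<subseteq> U"
  shows "(\<lambda>x. indicator S x *\<^sub>R f x) \<in> borel_measurable borel"
  by (rule borel_measurable_continuous_on_indicator[OF assms(2) continuous_on_subset[OF assms(1,3)]])

lemma indicator_continuous_measurable_ennreal:
  fixes f :: "real^2 \<Rightarrow> real"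
  assumes "continuous_on U f" "S \<in> sets borel" "S \<subseteq> U"
  shows "(\<lambda>x. ennreal (f x) * indicator S x) \<in> borel_measurable borel"
proof -
  have "(\<lambda>x. ennreal (f x) * indicator S x) = (\<lambda>x. ennreal (indicator S x *\<^sub>R f x))"
    by (auto simp: indicator_def)
  then show ?thesis using indicator_continuous_measurable[OF assms] by simp
qed

text \<open>Read in the coordinates of \<psi>, the map \<open>F\<close> becomes a map \<tau> between
  parameter planes, and \<open>jac\<close> factors as the determinant of its derivative times the
  density of \<psi>.\<close>

lemma chart_transition_ubound:
  assumes pos: "positive_param M2 n V \<psi>" and n: "continuous_on M2 n"
    and F: "open U" "smooth_on F U" "F ` U \<subseteq> M2"
    and S: "S \<in> sets borel" "S \<subseteq> U" "F ` S \<subseteq> \<psi> ` V"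
    and fin: "(\<integral>\<^sup>+ x\<in>S. ennreal (jac F n x) \<partial>lborel) < \<infinity>"
  defines "T \<equiv> (\<lambda>x. inv_into V \<psi> (F x)) ` S"
  shows "(\<lambda>y. ennreal (area_density n \<psi> y) * indicator T y) \<in> borel_measurable lebesgue \<and>
    (\<integral>\<^sup>+ y\<in>T. ennreal (area_density n \<psi> y) \<partial>lebesgue) \<le> (\<integral>\<^sup>+ x\<in>S. ennreal (jac F n x) \<partial>lborel)"
proof -
  note lp = positive_paramD(1)[OF pos]
  define \<tau> where "\<tau> x = inv_into V \<psi> (F x)" for x
  obtain O' where O': "open O'" "\<psi> ` V = M2 \<inter> O'" using lp_relatively_open[OF lp] .
  \<comment> \<open>An open set on which \<open>F\<close> lands in the chart image, so that \<tau>
    has full derivatives at the points of \<open>S\<close>.\<close>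
  define U' where "U' = U \<inter> F -` O'"
  have oU': "open U'" unfolding U'_def
    using smooth_on_imp_continuous_on[OF F(2)] F(1) O'(1) by (intro continuous_open_preimage) auto
  have FU': "F ` U' \<subseteq> \<psi> ` V" using O' F(3) by (auto simp: U'_def)
  have SU': "S \<subseteq> U'" using S O' by (auto simp: U'_def)
  have tV: "\<tau> x \<in> V" "\<psi> (\<tau> x) = F x" if "x \<in> U'" for x
    using FU' that by (auto simp: \<tau>_def inv_into_into f_inv_into_f subset_iff)
  have ex: "\<exists>T'. (\<tau> has_derivative T') (at x) \<and> jac F n x = \<bar>det (matrix T')\<bar> * area_density n \<psi> (\<tau> x)"
    if x: "x \<in> U'" for x
  proof -
    have xU: "x \<in> U" using x by (simp add: U'_def)
    obtain B where B: "linear B" "(inv_into V \<psi> has_derivative B) (at (\<psi> (\<tau> x)) within \<psi> ` V)"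
      using lp_inverse_has_derivative[OF lp tV(1)[OF x]] by blast
    let ?F' = "fderiv F x" and ?P = "fderiv \<psi> (\<tau> x)"
    have dF: "(F has_derivative ?F') (at x)" using smooth_on_imp_has_derivative[OF F(2) xU] .
    have "(\<tau> has_derivative (\<lambda>h. B (?F' h))) (at x within U')" unfolding \<tau>_def
      by (rule has_derivative_in_compose[OF has_derivative_at_withinI[OF dF]])
         (use has_derivative_subset[OF B(2) FU'] tV(2)[OF x] in simp)
    then have d\<tau>: "(\<tau> has_derivative (\<lambda>h. B (?F' h))) (at x)" using at_within_open[OF x oU'] by simp
    have "((\<lambda>y. \<psi> (\<tau> y)) has_derivative (\<lambda>h. ?P (B (?F' h)))) (at x)"
      by (rule has_derivative_compose[OF d\<tau> lp_has_derivative[OF lp tV(1)[OF x]]])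
    then have "(F has_derivative (\<lambda>h. ?P (B (?F' h)))) (at x)"
      by (rule has_derivative_transform_within_open[OF _ oU' x]) (use tV in auto)
    then have pd: "pd i F x = ?P (B (?F' (axis i 1)))" for i by (rule pd_eqI)
    \<comment> \<open>Bilinearity and antisymmetry in the first two slots extract the determinant of
      the coordinate change.\<close>
    have "triple (pd 1 F x) (pd 2 F x) (n (F x)) = det (matrix (\<lambda>h. B (?F' h))) * area_density n \<psi> (\<tau> x)"
      unfolding pd lp_derivative_pd[OF lp tV(1)[OF x]] area_density_triple det_matrix_2 tV(2)[OF x]
      by (simp add: triple_add triple_scale triple_same triple_swap[of "pd 2 \<psi> (\<tau> x)"] algebra_simps)
    then have "jac F n x = \<bar>det (matrix (\<lambda>h. B (?F' h)))\<bar> * area_density n \<psi> (\<tau> x)"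
      using positive_paramD(2)[OF pos tV(1)[OF x]] by (simp add: jac_def abs_mult)
    then show ?thesis using d\<tau> by blast
  qed
  then obtain T' where T': "\<And>x. x \<in> U' \<Longrightarrow> (\<tau> has_derivative T' x) (at x)"
    "\<And>x. x \<in> U' \<Longrightarrow> jac F n x = \<bar>det (matrix (T' x))\<bar> * area_density n \<psi> (\<tau> x)"
    by metis
  have "T = \<tau> ` S" by (simp add: T_def \<tau>_def)
  moreover have "(\<lambda>x. indicator S x *\<^sub>R jac F n x) \<in> borel_measurable borel"
    by (rule indicator_continuous_measurable[OF jac_continuous[OF n F(2,3)] S(1,2)])
  moreover have "(\<tau> has_derivative T' x) (at x within S)" if "x \<in> S" for x
    using has_derivative_at_withinI[OF T'(1)] SU' that by blast
  moreover have "0 \<le> area_density n \<psi> (\<tau> x)" if "x \<in> S" for x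
    using positive_paramD(2)[OF pos tV(1)] SU' that by (meson less_imp_le subsetD)
  ultimately show ?thesis
    using nn_integral_image_ubound[OF S(1), of "area_density n \<psi>" \<tau> T' "jac F n"] T'(2) SU' fin
    by (simp add: subset_iff)
qed

text \<open>Finite subadditivity on top of \<open>chart_transition_ubound\<close>: the coordinate
  images of the sets \<open>S i\<close> cover \<open>E\<close>. If one of the integrals is infinite
  there is nothing to prove.\<close>

lemma chart_content_le:
  assumes pos: "positive_param M2 n V \<psi>" and n: "continuous_on M2 n" and I: "finite I"
    and F: "\<And>i. i \<in> I \<Longrightarrow> open (U i)" "\<And>i. i \<in> I \<Longrightarrow> smooth_on (F i) (U i)" "\<And>i. i \<in> I \<Longrightarrow> F i ` U i \<subseteq> M2"
    and S: "\<And>i. i \<in> I \<Longrightarrow> S i \<in> sets borel" "\<And>i. i \<in> I \<Longrightarrow> S i \<subseteq> U i" "\<And>i. i \<in> I \<Longrightarrow> F i ` S i \<subseteq> \<psi> ` V"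
    and E: "E \<in> sets borel" "E \<subseteq> V" "\<psi> ` E \<subseteq> (\<Union>i\<in>I. F i ` S i)"
  shows "chart_area n \<psi> E \<le> (\<Sum>i\<in>I. \<integral>\<^sup>+ x\<in>S i. ennreal (jac (F i) n x) \<partial>lborel)"
proof (cases "\<exists>i\<in>I. (\<integral>\<^sup>+ x\<in>S i. ennreal (jac (F i) n x) \<partial>lborel) = \<infinity>")
  case True
  then have "(\<Sum>i\<in>I. \<integral>\<^sup>+ x\<in>S i. ennreal (jac (F i) n x) \<partial>lborel) = \<infinity>"
    using I by auto
  then show ?thesis by simp
next
  case False
  note lp = positive_paramD(1)[OF pos]
  define T where "T i = (\<lambda>x. inv_into V \<psi> (F i x)) ` S i" for i
  have T: "(\<lambda>y. ennreal (area_density n \<psi> y) * indicator (T i) y) \<in> borel_measurable lebesgue \<and>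
    (\<integral>\<^sup>+ y\<in>T i. ennreal (area_density n \<psi> y) \<partial>lebesgue) \<le> (\<integral>\<^sup>+ x\<in>S i. ennreal (jac (F i) n x) \<partial>lborel)"
    if "i \<in> I" for i
    unfolding T_def using False that
    by (intro chart_transition_ubound[OF pos n F(1)[OF that] F(2)[OF that] F(3)[OF that] S(1)[OF that] S(2)[OF that] S(3)[OF that]])
       (auto simp: less_top)
  have ET: "E \<subseteq> (\<Union>i\<in>I. T i)"
  proof
    fix y assume y: "y \<in> E"
    then obtain i x where "i \<in> I" "x \<in> S i" "\<psi> y = F i x" using E(3) by blast
    then show "y \<in> (\<Union>i\<in>I. T i)"
      unfolding T_def using lp_inj_on[OF lp] E(2) y by (auto intro!: bexI[of _ i] image_eqI[of _ _ x])
         (metis inv_into_f_f subsetD)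
  qed
  have "(\<lambda>y. ennreal (area_density n \<psi> y) * indicator E y) \<in> borel_measurable borel"
    using indicator_continuous_measurable_ennreal[OF area_density_continuous[OF n lp] E(1,2)] .
  \<comment> \<open>The integrands over the sets \<open>T i\<close> are only known to be measurable
    for \<open>lebesgue\<close>, so the comparison is made in the completion.\<close>
  then have "chart_area n \<psi> E = (\<integral>\<^sup>+ y\<in>E. ennreal (area_density n \<psi> y) \<partial>lebesgue)"
    by (intro nn_integral_completion[symmetric])
  also have "\<dots> \<le> (\<integral>\<^sup>+ y. (\<Sum>i\<in>I. ennreal (area_density n \<psi> y) * indicator (T i) y) \<partial>lebesgue)"
  proof (rule nn_integral_mono)
    fix y
    show "ennreal (area_density n \<psi> y) * indicator E y \<le> (\<Sum>i\<in>I. ennreal (area_density n \<psi> y) * indicator (T i) y)"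
    proof (cases "y \<in> E")
      case True
      then obtain i where "i \<in> I" "y \<in> T i" using ET by blast
      then have "ennreal (area_density n \<psi> y) * indicator E y \<le> ennreal (area_density n \<psi> y) * indicator (T i) y"
        using True by simp
      also have "\<dots> \<le> (\<Sum>i\<in>I. ennreal (area_density n \<psi> y) * indicator (T i) y)"
        using I \<open>i \<in> I\<close> by (intro member_le_sum) auto
      finally show ?thesis .
    qed simp
  qed
  also have "\<dots> = (\<Sum>i\<in>I. \<integral>\<^sup>+ y\<in>T i. ennreal (area_density n \<psi> y) \<partial>lebesgue)"
    by (intro nn_integral_sum) (use T in blast)
  also have "\<dots> \<le> (\<Sum>i\<in>I. \<integral>\<^sup>+ x\<in>S i. ennreal (jac (F i) n x) \<partial>lborel)"
    using T by (intro sum_mono) blast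
  finally show ?thesis .
qed

section \<open>Areas of Borel sets as seen in a single chart\<close>

definition chart_content :: "(real^3 \<Rightarrow> real^3) \<Rightarrow> (real^2) set \<Rightarrow> (real^2 \<Rightarrow> real^3) \<Rightarrow> (real^3) set \<Rightarrow> ennreal" where
  "chart_content \<eta> U \<phi> A = (\<integral>\<^sup>+ u\<in>{u\<in>U. \<phi> u \<in> A}. ennreal (area_density \<eta> \<phi> u) \<partial>lborel)"

lemma lp_vimage_borel:
  assumes lp: "local_param M U \<phi>" and B: "B \<in> sets borel"
  shows "{u\<in>U. \<phi> u \<in> B} \<in> sets borel"
proof -
  have "\<phi> \<in> borel_measurable (restrict_space borel U)"
    using lp_continuous[OF lp] by (rule borel_measurable_continuous_on_restrict)
  from measurable_sets[OF this B] have "\<phi> -` B \<inter> U \<in> sets (restrict_space borel U)"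
    by (simp add: space_restrict_space)
  then have "\<phi> -` B \<inter> U \<in> sets borel"
    using lp_open[OF lp] by (subst (asm) sets_restrict_space_iff) auto
  moreover have "{u\<in>U. \<phi> u \<in> B} = \<phi> -` B \<inter> U" by auto
  ultimately show ?thesis by simp
qed

text \<open>The image is also a preimage under the continuous chart inverse, whose domain is Borel,
  being an open set intersected with \<open>M\<close>.\<close>

lemma lp_image_borel:
  assumes lp: "local_param M U \<phi>" and M: "M \<in> sets borel" and A: "A \<in> sets borel" "A \<subseteq> U"
  shows "\<phi> ` A \<in> sets borel"
proof -
  obtain T where T: "open T" "\<phi> ` U = M \<inter> T" using lp_relatively_open[OF lp] .
  then have UB: "\<phi> ` U \<in> sets borel" using M by simp
  have "inv_into U \<phi> \<in> borel_measurable (restrict_space borel (\<phi> ` U))"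
    using homeomorphism_cont2[OF lp_homeomorphism[OF lp]] by (rule borel_measurable_continuous_on_restrict)
  from measurable_sets[OF this A(1)] have "inv_into U \<phi> -` A \<inter> \<phi> ` U \<in> sets (restrict_space borel (\<phi> ` U))"
    by (simp add: space_restrict_space)
  then have "inv_into U \<phi> -` A \<inter> \<phi> ` U \<in> sets borel"
    using UB by (subst (asm) sets_restrict_space_iff) auto
  moreover have "\<phi> ` A = inv_into U \<phi> -` A \<inter> \<phi> ` U"
    using lp_inj_on[OF lp] A(2) by (auto simp: inv_into_f_f subset_iff)
  ultimately show ?thesis by simp
qed

text \<open>Turned into a measure on the parameter plane, so that \<open>chart_content\<close>
  inherits additivity from \<open>emeasure\<close>.\<close>

definition chart_measure :: "(real^3 \<Rightarrow> real^3) \<Rightarrow> (real^2) set \<Rightarrow> (real^2 \<Rightarrow> real^3) \<Rightarrow> (real^2) measure" where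
  "chart_measure \<eta> U \<phi> = density lborel (\<lambda>u. ennreal (area_density \<eta> \<phi> u) * indicator U u)"

lemma sets_chart_measure [simp]: "sets (chart_measure \<eta> U \<phi>) = sets borel"
  by (simp add: chart_measure_def)

lemma emeasure_chart_measure:
  assumes n: "continuous_on M \<eta>" and lp: "local_param M U \<phi>" and S: "S \<in> sets borel" "S \<subseteq> U"
  shows "emeasure (chart_measure \<eta> U \<phi>) S = chart_area \<eta> \<phi> S"
proof -
  have "(\<lambda>u. ennreal (area_density \<eta> \<phi> u) * indicator U u) \<in> borel_measurable borel"
    by (rule indicator_continuous_measurable_ennreal[OF area_density_continuous[OF n lp]]) (use lp_open[OF lp] in auto)
  then show ?thesis unfolding chart_measure_def
    by (subst emeasure_density) (use S in \<open>auto intro!: nn_integral_cong simp: indicator_def\<close>)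
qed

lemma chart_content_measure:
  assumes "continuous_on M \<eta>" "local_param M U \<phi>" "A \<in> sets borel"
  shows "chart_content \<eta> U \<phi> A = emeasure (chart_measure \<eta> U \<phi>) {u\<in>U. \<phi> u \<in> A}"
  unfolding chart_content_def
  by (rule emeasure_chart_measure[symmetric, OF assms(1,2) lp_vimage_borel[OF assms(2,3)]]) simp

lemma chart_content_suminf:
  assumes "continuous_on M \<eta>" "local_param M U \<phi>" "range A \<subseteq> sets borel" "disjoint_family A"
  shows "(\<Sum>i. chart_content \<eta> U \<phi> (A i)) = chart_content \<eta> U \<phi> (\<Union>i. A i)"
proof -
  have "(\<Sum>i. emeasure (chart_measure \<eta> U \<phi>) {u\<in>U. \<phi> u \<in> A i}) = emeasure (chart_measure \<eta> U \<phi>) (\<Union>i. {u\<in>U. \<phi> u \<in> A i})"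
    using assms lp_vimage_borel[OF assms(2)] by (intro suminf_emeasure) (auto simp: disjoint_family_on_def)
  moreover have "(\<Union>i. {u\<in>U. \<phi> u \<in> A i}) = {u\<in>U. \<phi> u \<in> (\<Union>i. A i)}" by auto
  moreover have "(\<Union>i. A i) \<in> sets borel" "\<And>i. A i \<in> sets borel" using assms(3) by auto
  ultimately show ?thesis using chart_content_measure[OF assms(1,2)] by simp
qed

lemma chart_content_sum:
  assumes "continuous_on M \<eta>" "local_param M U \<phi>" "A \<in> sets borel"
    "\<And>i. i \<in> I \<Longrightarrow> P i \<in> sets borel" "disjoint_family_on P I" "finite I" "A \<subseteq> (\<Union>i\<in>I. P i)"
  shows "(\<Sum>i\<in>I. chart_content \<eta> U \<phi> (A \<inter> P i)) = chart_content \<eta> U \<phi> A"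
proof -
  have "(\<Sum>i\<in>I. emeasure (chart_measure \<eta> U \<phi>) {u\<in>U. \<phi> u \<in> A \<inter> P i}) = emeasure (chart_measure \<eta> U \<phi>) (\<Union>i\<in>I. {u\<in>U. \<phi> u \<in> A \<inter> P i})"
    using assms lp_vimage_borel[OF assms(2)] by (intro sum_emeasure) (auto simp: disjoint_family_on_def intro!: lp_vimage_borel[OF assms(2), of "A \<inter> P _", simplified])
  moreover have "(\<Union>i\<in>I. {u\<in>U. \<phi> u \<in> A \<inter> P i}) = {u\<in>U. \<phi> u \<in> A}" using assms(7) by auto
  ultimately show ?thesis using chart_content_measure[OF assms(1,2)] assms by simp
qed

text \<open>\<open>chart_content_le\<close> with one chart as the source gives one inequality;
  exchanging the charts gives the other.\<close>

lemma chart_content_transition: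
  assumes p: "positive_param M \<eta> U \<phi>" "positive_param M \<eta> V \<psi>" and n: "continuous_on M \<eta>"
    and A: "A \<in> sets borel" "A \<subseteq> \<phi> ` U" "A \<subseteq> \<psi> ` V"
  shows "chart_content \<eta> V \<psi> A = chart_content \<eta> U \<phi> A"
proof -
  have le: "chart_content \<eta> V \<psi> A \<le> chart_content \<eta> U \<phi> A"
    if p: "positive_param M \<eta> U \<phi>" "positive_param M \<eta> V \<psi>" and A': "A \<subseteq> \<phi> ` U" "A \<subseteq> \<psi> ` V" for U \<phi> V \<psi>
  proof -
    note lp = positive_paramD(1)[OF p(1)] positive_paramD(1)[OF p(2)]
    let ?S = "{u\<in>U. \<phi> u \<in> A}"
    have "chart_content \<eta> V \<psi> A \<le> (\<Sum>i\<in>{()}. \<integral>\<^sup>+ x\<in>?S. ennreal (jac \<phi> \<eta> x) \<partial>lborel)"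
      unfolding chart_content_def
      by (rule chart_content_le[OF p(2) n, where U = "\<lambda>_. U" and F = "\<lambda>_. \<phi>"])
         (use lp_open[OF lp(1)] lp_smooth[OF lp(1)] lp_subset[OF lp(1)] lp_vimage_borel[OF lp(1) A(1)]
           lp_vimage_borel[OF lp(2) A(1)] A' in auto)
    also have "\<dots> = chart_content \<eta> U \<phi> A"
      unfolding chart_content_def using jac_positive_param[OF p(1)]
      by (auto intro!: nn_integral_cong simp: indicator_def)
    finally show ?thesis .
  qed
  show ?thesis using le[OF p A(2,3)] le[OF p(2,1) A(3,2)] by (rule antisym)
qed

section \<open>Existence and uniqueness of the area measure\<close>

text \<open>Overlapping charts would count area repeatedly. Disjoint Borel pieces make the area
  measure a finite sum of chart integrals, and \<open>finite_area\<close> makes the total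
  finite.\<close>

locale param_partition =
  fixes M \<eta> and m :: nat and U \<phi> P
  assumes compact: "compact M" and cont: "continuous_on M \<eta>"
    and pos: "\<And>i. i < m \<Longrightarrow> positive_param M \<eta> (U i) (\<phi> i)"
    and Pb: "\<And>i. i < m \<Longrightarrow> P i \<in> sets borel"
    and Ps: "\<And>i. i < m \<Longrightarrow> P i \<subseteq> \<phi> i ` U i"
    and disj: "disjoint_family_on P {..<m}"
    and cover: "(\<Union>i<m. P i) = M"
    and finite_area: "\<And>i. i < m \<Longrightarrow> chart_area \<eta> (\<phi> i) (U i) < \<infinity>"
begin

lemma M_borel: "M \<in> sets borel"
  using compact by (simp add: borel_compact)

lemma sets_M: "A \<in> sets (restrict_space borel M) \<longleftrightarrow> A \<in> sets borel \<and> A \<subseteq> M"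
  using M_borel by (subst sets_restrict_space_iff) auto

definition content :: "(real^3) set \<Rightarrow> ennreal" where
  "content A = (\<Sum>i<m. chart_content \<eta> (U i) (\<phi> i) (A \<inter> P i))"

text \<open>The uniqueness half: each piece of the partition lies in a positive chart, where the
  measure is prescribed.\<close>

lemma is_area_measure_content:
  assumes "is_area_measure M \<eta> \<mu>" "A \<in> sets borel" "A \<subseteq> M"
  shows "emeasure \<mu> A = content A"
proof -
  have s: "sets \<mu> = sets (restrict_space borel M)" using assms(1) by (simp add: is_area_measure_def)
  have "A = (\<Union>i<m. A \<inter> P i)" using cover assms(3) by auto
  then have "emeasure \<mu> A = emeasure \<mu> (\<Union>i<m. A \<inter> P i)" by simp
  also have "\<dots> = (\<Sum>i<m. emeasure \<mu> (A \<inter> P i))"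
    using disj Pb assms s sets_M by (intro sum_emeasure[symmetric]) (auto simp: disjoint_family_on_def)
  also have "\<dots> = content A" unfolding content_def
  proof (rule sum.cong)
    fix i assume "i \<in> {..<m}"
    then have i: "i < m" by simp
    have "emeasure \<mu> (\<phi> i ` {u \<in> U i. \<phi> i u \<in> A \<inter> P i}) = chart_content \<eta> (U i) (\<phi> i) (A \<inter> P i)"
      using assms(1) pos[OF i] lp_vimage_borel[OF positive_paramD(1)[OF pos[OF i]], of "A \<inter> P i"] Pb[OF i] assms(2)
      unfolding is_area_measure_def chart_content_def by auto
    moreover have "\<phi> i ` {u \<in> U i. \<phi> i u \<in> A \<inter> P i} = A \<inter> P i" using Ps[OF i] by auto
    ultimately show "emeasure \<mu> (A \<inter> P i) = chart_content \<eta> (U i) (\<phi> i) (A \<inter> P i)" by simp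
  qed simp
  finally show ?thesis .
qed

text \<open>The content can be computed in any positive chart, also one unrelated to the partition.
  \<open>is_area_measure\<close> quantifies over all of them, so existence depends on this.\<close>

lemma content_chart:
  assumes p: "positive_param M \<eta> V \<psi>" and A: "A \<in> sets borel" "A \<subseteq> \<psi> ` V"
  shows "content A = chart_content \<eta> V \<psi> A"
proof -
  note lp = positive_paramD(1)[OF p]
  have "content A = (\<Sum>i<m. chart_content \<eta> V \<psi> (A \<inter> P i))"
    unfolding content_def
    by (intro sum.cong chart_content_transition[OF p pos cont]) (use A Ps Pb in auto)
  also have "\<dots> = chart_content \<eta> V \<psi> A"
    by (rule chart_content_sum[OF cont lp A(1)]) (use Pb disj cover A lp_subset[OF lp] in auto)
  finally show ?thesis .
qed

lemma is_area_measure_exists: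
  "is_area_measure M \<eta> (measure_of M (sets (restrict_space borel M)) content)" (is "is_area_measure M \<eta> ?\<mu>")
proof -
  have sa: "sigma_algebra M (sets (restrict_space borel M))"
    using sets.sigma_algebra_axioms[of "restrict_space borel M"] by (simp add: space_restrict_space)
  then interpret sigma_algebra M "sets (restrict_space borel M)" .
  have sets: "sets ?\<mu> = sets (restrict_space borel M)"
    using space_closed sigma_sets_eq by (simp add: sets_measure_of)
  have ca: "countably_additive (sets (restrict_space borel M)) content"
  proof (rule countably_additiveI)
    fix A :: "nat \<Rightarrow> (real^3) set"
    assume A: "range A \<subseteq> sets (restrict_space borel M)" "disjoint_family A"
    have Ab: "A i \<in> sets borel" for i using A(1) sets_M by blast
    have "(\<Sum>j. content (A j)) = (\<Sum>i<m. \<Sum>j. chart_content \<eta> (U i) (\<phi> i) (A j \<inter> P i))"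
      unfolding content_def by (rule suminf_sum) auto
    also have "\<dots> = (\<Sum>i<m. chart_content \<eta> (U i) (\<phi> i) (\<Union>j. A j \<inter> P i))"
    proof (rule sum.cong)
      fix i assume i: "i \<in> {..<m}"
      have "disjoint_family (\<lambda>j. A j \<inter> P i)" using A(2) unfolding disjoint_family_on_def by blast
      then show "(\<Sum>j. chart_content \<eta> (U i) (\<phi> i) (A j \<inter> P i)) = chart_content \<eta> (U i) (\<phi> i) (\<Union>j. A j \<inter> P i)"
        using Ab Pb i by (intro chart_content_suminf[OF cont positive_paramD(1)[OF pos]]) auto
    qed simp
    also have "\<dots> = content (\<Union>j. A j)" unfolding content_def by (simp add: Int_UN_distrib2)
    finally show "(\<Sum>j. content (A j)) = content (\<Union>j. A j)" .
  qed
  have po: "positive (sets (restrict_space borel M)) content"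
    by (simp add: positive_def content_def chart_content_def)
  have em: "emeasure ?\<mu> A = content A" if "A \<in> sets borel" "A \<subseteq> M" for A
    by (rule emeasure_measure_of_sigma[OF sa po ca]) (use that sets_M in auto)
  show ?thesis
    unfolding is_area_measure_def
  proof (intro conjI allI impI sets)
    fix V \<psi> A assume *: "positive_param M \<eta> V \<psi> \<and> A \<in> sets borel \<and> A \<subseteq> V"
    note lp = positive_paramD(1)[of M \<eta> V \<psi>]
    have b: "\<psi> ` A \<in> sets borel" using lp_image_borel[OF lp M_borel] * by blast
    have "emeasure ?\<mu> (\<psi> ` A) = content (\<psi> ` A)" by (rule em[OF b]) (use * lp_subset[OF lp] in blast)
    also have "\<dots> = chart_content \<eta> V \<psi> (\<psi> ` A)" by (rule content_chart[OF _ b]) (use * in auto)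
    also have "{u\<in>V. \<psi> u \<in> \<psi> ` A} = A" using * lp_inj_on[OF lp] by (auto dest: inj_onD)
    then have "chart_content \<eta> V \<psi> (\<psi> ` A) = chart_area \<eta> \<psi> A"
      by (simp add: chart_content_def)
    finally show "emeasure ?\<mu> (\<psi> ` A) = chart_area \<eta> \<psi> A" .
  qed
qed

text \<open>Existence and uniqueness together make the \<open>THE\<close> in
  \<open>area_measure\<close> meaningful.\<close>

lemma is_area_measure_area_measure: "is_area_measure M \<eta> (area_measure M \<eta>)"
  unfolding area_measure_def
proof (rule theI[where P = "is_area_measure M \<eta>", OF is_area_measure_exists])
  fix \<mu> assume \<mu>: "is_area_measure M \<eta> \<mu>"
  show "\<mu> = measure_of M (sets (restrict_space borel M)) content" (is "_ = ?\<mu>")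
  proof (rule measure_eqI)
    show "sets \<mu> = sets ?\<mu>" using \<mu> is_area_measure_exists by (simp add: is_area_measure_def)
    fix A assume "A \<in> sets \<mu>"
    then have "A \<in> sets borel" "A \<subseteq> M" using \<mu> sets_M by (auto simp: is_area_measure_def)
    then show "emeasure \<mu> A = emeasure ?\<mu> A"
      using is_area_measure_content[OF \<mu>] is_area_measure_content[OF is_area_measure_exists] by simp
  qed
qed

abbreviation "\<mu> \<equiv> area_measure M \<eta>"

lemma sets_area: "sets \<mu> = sets (restrict_space borel M)"
  using is_area_measure_area_measure by (simp add: is_area_measure_def)

lemma sets_area_iff: "A \<in> sets \<mu> \<longleftrightarrow> A \<in> sets borel \<and> A \<subseteq> M"
  by (simp add: sets_area sets_M)

lemma space_area: "space \<mu> = M"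
  using sets_eq_imp_space_eq[OF sets_area] by (simp add: space_restrict_space)

lemma emeasure_area:
  "positive_param M \<eta> V \<psi> \<Longrightarrow> A \<in> sets borel \<Longrightarrow> A \<subseteq> \<psi> ` V \<Longrightarrow> emeasure \<mu> A = chart_content \<eta> V \<psi> A"
  using is_area_measure_content[OF is_area_measure_area_measure] content_chart lp_subset positive_paramD(1)
  by (metis order_trans)

lemma emeasure_area_finite: "emeasure \<mu> M < \<infinity>"
proof -
  have "chart_content \<eta> (U i) (\<phi> i) (M \<inter> P i) < \<infinity>" if "i < m" for i
  proof -
    have "chart_content \<eta> (U i) (\<phi> i) (M \<inter> P i) \<le> chart_area \<eta> (\<phi> i) (U i)"
      unfolding chart_content_def by (intro nn_integral_mono) (auto simp: indicator_def)
    then show ?thesis using finite_area[OF that] by (rule order.strict_trans1)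
  qed
  then have "content M < \<infinity>" unfolding content_def by (auto simp: less_top)
  then show ?thesis using is_area_measure_content[OF is_area_measure_area_measure M_borel] by simp
qed

lemma finite_measure_area: "finite_measure \<mu>"
  by (rule finite_measureI) (use emeasure_area_finite space_area in auto)

lemma borel_measurable_area_continuous:
  fixes k :: "real^3 \<Rightarrow> real"
  assumes "continuous_on M k" shows "k \<in> borel_measurable \<mu>"
  using borel_measurable_continuous_on_restrict[OF assms] by (simp add: measurable_cong_sets[OF sets_area refl])

lemma integrable_area_continuous:
  fixes k :: "real^3 \<Rightarrow> real"
  assumes "continuous_on M k" shows "integrable \<mu> k"
proof -
  obtain B where "\<And>x. x \<in> M \<Longrightarrow> norm (k x) \<le> B"
    using compact_imp_bounded[OF compact_continuous_image[OF assms compact]] by (auto simp: bounded_iff)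
  then show ?thesis
    using finite_measure.integrable_const_bound[OF finite_measure_area, of k B] borel_measurable_area_continuous[OF assms]
      AE_I2[of \<mu> "\<lambda>x. norm (k x) \<le> B"] by (simp add: space_area)
qed

text \<open>The area measure restricted to \<open>A\<close> is the push-forward under the chart of
  Lebesgue measure with the area density; both sides are the integral of \<open>k\<close> against
  it.\<close>

lemma nn_integral_area_chart:
  assumes p: "positive_param M \<eta> V \<psi>" and A: "A \<in> sets borel" "A \<subseteq> \<psi> ` V" and k: "k \<in> borel_measurable \<mu>"
  shows "(\<integral>\<^sup>+ q\<in>A. k q \<partial>\<mu>) = (\<integral>\<^sup>+ u\<in>{u\<in>V. \<psi> u \<in> A}. k (\<psi> u) * ennreal (area_density \<eta> \<psi> u) \<partial>lborel)"
proof (cases "A = {}")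
  case True then show ?thesis by simp
next
  case False
  then obtain q0 where q0: "q0 \<in> A" by blast
  note lp = positive_paramD(1)[OF p]
  have AM: "A \<subseteq> M" using A lp_subset[OF lp] by blast
  define S where "S = {u\<in>V. \<psi> u \<in> A}"
  have S: "S \<in> sets borel" "S \<subseteq> V" unfolding S_def using lp_vimage_borel[OF lp A(1)] by auto
  \<comment> \<open>\<open>q0\<close> is a dummy value that keeps \<open>\<psi>'\<close> inside the
    space of the measure; the density \<open>d\<close> vanishes where it is used.\<close>
  define \<psi>' where "\<psi>' u = (if u \<in> S then \<psi> u else q0)" for u
  define d where "d u = ennreal (area_density \<eta> \<psi> u) * indicator S u" for u
  have d: "d \<in> borel_measurable borel" unfolding d_def
    by (rule indicator_continuous_measurable_ennreal[OF area_density_continuous[OF cont lp] S])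
  have pre: "\<psi>' -` B = {u\<in>V. \<psi> u \<in> A \<inter> B} \<union> (if q0 \<in> B then - S else {})" for B
    by (auto simp: \<psi>'_def S_def split: if_splits)
  have \<psi>': "\<psi>' \<in> measurable (density lborel d) \<mu>"
  proof (rule measurableI)
    show "\<psi>' u \<in> space \<mu>" for u using q0 AM by (auto simp: \<psi>'_def space_area S_def)
    fix B assume "B \<in> sets \<mu>"
    then have "{u\<in>V. \<psi> u \<in> A \<inter> B} \<in> sets borel" using lp_vimage_borel[OF lp, of "A \<inter> B"] A sets_area_iff by auto
    then show "\<psi>' -` B \<inter> space (density lborel d) \<in> sets (density lborel d)"
      using S by (simp add: pre)
  qed
  have A\<mu>: "A \<in> sets \<mu>" using A AM sets_area_iff by blast
  have eq: "density \<mu> (indicator A) = distr (density lborel d) \<mu> \<psi>'"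
  proof (rule measure_eqI)
    fix B assume B: "B \<in> sets (density \<mu> (indicator A))"
    then have B\<mu>: "B \<in> sets \<mu>" by simp
    have "emeasure (density \<mu> (indicator A)) B = emeasure \<mu> (A \<inter> B)"
      using A\<mu> B\<mu> by (subst emeasure_density) (auto simp: indicator_inter_arith[symmetric] Int_commute)
    also have "\<dots> = chart_content \<eta> V \<psi> (A \<inter> B)"
      using B\<mu> A sets_area_iff by (intro emeasure_area[OF p]) auto
    also have "\<dots> = (\<integral>\<^sup>+ u. d u * indicator (\<psi>' -` B) u \<partial>lborel)"
      unfolding chart_content_def
      by (intro nn_integral_cong) (auto simp: d_def \<psi>'_def S_def indicator_def)
    also have "\<dots> = emeasure (density lborel d) (\<psi>' -` B \<inter> space (density lborel d))"
      using measurable_sets[OF \<psi>' B\<mu>] d by (subst emeasure_density) auto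
    also have "\<dots> = emeasure (distr (density lborel d) \<mu> \<psi>') B"
      by (rule emeasure_distr[symmetric, OF \<psi>' B\<mu>])
    finally show "emeasure (density \<mu> (indicator A)) B = emeasure (distr (density lborel d) \<mu> \<psi>') B" .
  qed simp
  have "(\<integral>\<^sup>+ q\<in>A. k q \<partial>\<mu>) = (\<integral>\<^sup>+ q. k q \<partial>density \<mu> (indicator A))"
    using A\<mu> k by (subst nn_integral_density) (auto simp: mult.commute)
  also have "\<dots> = (\<integral>\<^sup>+ u. k (\<psi>' u) \<partial>density lborel d)"
    unfolding eq by (rule nn_integral_distr[OF \<psi>']) (use k in simp)
  also have "\<dots> = (\<integral>\<^sup>+ u. d u * k (\<psi>' u) \<partial>lborel)"
  proof (rule nn_integral_density)
    have "(\<lambda>u. k (\<psi>' u)) \<in> borel_measurable (density lborel d)" using \<psi>' k by (rule measurable_compose)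
    then show "(\<lambda>u. k (\<psi>' u)) \<in> borel_measurable lborel" by simp
  qed (use d in simp)
  also have "\<dots> = (\<integral>\<^sup>+ u\<in>S. k (\<psi> u) * ennreal (area_density \<eta> \<psi> u) \<partial>lborel)"
    by (intro nn_integral_cong) (auto simp: d_def \<psi>'_def indicator_def mult.commute)
  finally show ?thesis by (simp add: S_def)
qed

end

lemma param_partition_exists:
  assumes M: "smooth_surface M" "compact M" and tr: "transversal M \<eta>"
  obtains m U \<phi> P where "param_partition M \<eta> m U \<phi> P"
proof -
  define Q where "Q p x \<longleftrightarrow> (case x of (V, \<psi>, T) \<Rightarrow> positive_param M \<eta> V \<psi> \<and>
      chart_area \<eta> \<psi> V < \<infinity> \<and> open T \<and> \<psi> ` V = M \<inter> T \<and> p \<in> T)" for p x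
  have "\<exists>x. Q p x" if "p \<in> M" for p
  proof -
    obtain V0 \<psi>0 u where 0: "local_param M V0 \<psi>0" "u \<in> V0" "\<psi>0 u = p" using M(1) \<open>p \<in> M\<close>
      unfolding smooth_surface_def by (metis imageE)
    obtain V \<psi> where V: "positive_param M \<eta> V \<psi>" "\<psi>0 u \<in> \<psi> ` V"
      "chart_area \<eta> \<psi> V < \<infinity>"
      using positive_param_exists[OF tr 0(1,2)] by metis
    obtain T where "open T" "\<psi> ` V = M \<inter> T" using lp_relatively_open[OF positive_paramD(1)[OF V(1)]] .
    then have "Q p (V, \<psi>, T)" using V 0 by (auto simp: Q_def)
    then show ?thesis by blast
  qed
  then obtain c where c: "\<And>p. p \<in> M \<Longrightarrow> Q p (c p)" by metis
  define V \<psi> T where "V p = fst (c p)" and "\<psi> p = fst (snd (c p))" and "T p = snd (snd (c p))" for p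
  have V: "positive_param M \<eta> (V p) (\<psi> p)"
    "chart_area \<eta> (\<psi> p) (V p) < \<infinity>"
    "open (T p)" "\<psi> p ` V p = M \<inter> T p" "p \<in> T p" if "p \<in> M" for p
    using c[OF that] by (auto simp: Q_def V_def \<psi>_def T_def split: prod.splits)
  obtain C where C: "C \<subseteq> M" "finite C" "M \<subseteq> (\<Union>p\<in>C. T p)"
    using compactE_image[OF M(2), of M T] V(3,5) by (metis UN_I subsetI)
  obtain h where h: "bij_betw h {..<card C} C"
    using ex_bij_betw_nat_finite[OF C(2)] by (metis atLeast0LessThan)
  then have hC: "h i \<in> C" "h i \<in> M" if "i < card C" for i
    using that C(1) bij_betwE by blast+
  \<comment> \<open>\<open>disjointed\<close> works on infinite sequences, so indices from
    \<open>card C\<close> on receive the empty set.\<close>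
  define P where "P = disjointed (\<lambda>i. if i < card C then M \<inter> T (h i) else {})"
  have Mb: "M \<in> sets borel" using M(2) by (simp add: borel_compact)
  have "(\<Union>i<card C. P i) = (\<Union>i<card C. M \<inter> T (h i))"
    unfolding P_def using finite_UN_disjointed_eq[of "\<lambda>i. if i < card C then M \<inter> T (h i) else {}" "card C"]
    by (simp add: atLeast0LessThan)
  also have "\<dots> = M"
  proof -
    have "(\<Union>i<card C. T (h i)) = (\<Union>p\<in>h ` {..<card C}. T p)" by auto
    also have "h ` {..<card C} = C" using h by (rule bij_betw_imp_surj_on)
    finally have "M \<subseteq> (\<Union>i<card C. T (h i))" using C(3) by simp
    then show ?thesis by blast
  qed
  finally have cov: "(\<Union>i<card C. P i) = M" .
  have "param_partition M \<eta> (card C) (\<lambda>i. V (h i)) (\<lambda>i. \<psi> (h i)) P"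
  proof
    show "compact M" "continuous_on M \<eta>" using M tr by (auto simp: transversal_def)
    show "disjoint_family_on P {..<card C}"
      unfolding P_def by (rule disjoint_family_on_mono[OF subset_UNIV disjoint_family_disjointed])
    show "(\<Union>i<card C. P i) = M" by (rule cov)
    fix i assume i: "i < card C"
    show "positive_param M \<eta> (V (h i)) (\<psi> (h i))"
      "(\<integral>\<^sup>+ x\<in>V (h i). ennreal (area_density \<eta> (\<psi> (h i)) x) \<partial>lborel) < \<infinity>"
      using V hC[OF i] by auto
    show "P i \<subseteq> \<psi> (h i) ` V (h i)"
      using disjointed_subset[of "\<lambda>i. if i < card C then M \<inter> T (h i) else {}" i] i V(4)[OF hC(2)[OF i]]
      by (auto simp: P_def)
    have "(if j < card C then M \<inter> T (h j) else {}) \<in> sets borel" for j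
      using Mb V(3)[OF hC(2)] by auto
    then have "range (\<lambda>i. if i < card C then M \<inter> T (h i) else {}) \<subseteq> sets borel" by blast
    then show "P i \<in> sets borel" unfolding P_def using sets.range_disjointed_sets by blast
  qed
  then show ?thesis using that by blast
qed

text \<open>\<open>A\<close> is cut along the partitions of both surfaces, each piece is handled by
  \<open>chart_content_le\<close>, and the disjoint pieces are summed. Since \<open>f\<close> may be
  many-to-one, the result is an upper bound for the area of \<open>E\<close>.\<close>

lemma area_measure_image_le:
  assumes M1: "smooth_surface M1" "compact M1" "transversal M1 \<eta>1"
    and M2: "smooth_surface M2" "compact M2" "transversal M2 \<eta>2"
    and f: "smooth_map_on M1 f" "f ` M1 \<subseteq> M2"
    and A: "A \<in> sets borel" "A \<subseteq> M1" and E: "E \<in> sets borel" "E \<subseteq> f ` A"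
    and k: "k \<in> borel_measurable (restrict_space borel M1)"
    and bound: "\<And>U \<phi> u. positive_param M1 \<eta>1 U \<phi> \<Longrightarrow> u \<in> U \<Longrightarrow> \<phi> u \<in> A \<Longrightarrow>
       ennreal (jac (\<lambda>x. f (\<phi> x)) \<eta>2 u) \<le> k (\<phi> u) * ennreal (area_density \<eta>1 \<phi> u)"
  shows "emeasure (area_measure M2 \<eta>2) E \<le> (\<integral>\<^sup>+ p\<in>A. k p \<partial>area_measure M1 \<eta>1)"
proof -
  obtain m U \<phi> P where "param_partition M1 \<eta>1 m U \<phi> P" using param_partition_exists[OF M1] .
  then interpret p1: param_partition M1 \<eta>1 m U \<phi> P .
  obtain l V \<psi> Q where "param_partition M2 \<eta>2 l V \<psi> Q" using param_partition_exists[OF M2] .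
  then interpret p2: param_partition M2 \<eta>2 l V \<psi> Q .
  have k': "k \<in> borel_measurable p1.\<mu>" using k by (simp add: measurable_cong_sets[OF p1.sets_area refl])
  define X where "X i j = A \<inter> P i \<inter> f -` (E \<inter> Q j)" for i j
  have fm: "f \<in> borel_measurable (restrict_space borel M1)"
    using borel_measurable_continuous_on_restrict[OF smooth_map_on_continuous[OF f(1)]] .
  have X: "X i j \<in> sets borel" if "i < m" "j < l" for i j
  proof -
    have "f -` (E \<inter> Q j) \<inter> M1 \<in> sets (restrict_space borel M1)"
      using measurable_sets[OF fm, of "E \<inter> Q j"] E p2.Pb[OF that(2)] by (auto simp: space_restrict_space)
    then have "f -` (E \<inter> Q j) \<inter> M1 \<in> sets borel" using p1.sets_M by blast
    moreover have "X i j = A \<inter> P i \<inter> (f -` (E \<inter> Q j) \<inter> M1)" using A by (auto simp: X_def)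
    ultimately show ?thesis using A p1.Pb[OF that(1)] by simp
  qed
  have EM2: "E \<subseteq> M2" using E A f by blast
  have chart: "chart_content \<eta>2 (V j) (\<psi> j) (E \<inter> Q j) \<le> (\<Sum>i<m. \<integral>\<^sup>+ p\<in>X i j. k p \<partial>p1.\<mu>)" if j: "j < l" for j
  proof -
    note lpj = positive_paramD(1)[OF p2.pos[OF j]]
    define S where "S i = {u\<in>U i. \<phi> i u \<in> X i j}" for i
    have "chart_content \<eta>2 (V j) (\<psi> j) (E \<inter> Q j) \<le> (\<Sum>i<m. \<integral>\<^sup>+ x\<in>S i. ennreal (jac (\<lambda>x. f (\<phi> i x)) \<eta>2 x) \<partial>lborel)"
      unfolding chart_content_def
    proof (rule chart_content_le[OF p2.pos[OF j] p2.cont, where U = U])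
      fix i assume "i \<in> {..<m}"
      then have i: "i < m" by simp
      note lpi = positive_paramD(1)[OF p1.pos[OF i]]
      show "open (U i)" by (rule lp_open[OF lpi])
      show "smooth_on (\<lambda>x. f (\<phi> i x)) (U i)" by (rule lp_compose_smooth[OF lpi f(1)])
      show "(\<lambda>x. f (\<phi> i x)) ` U i \<subseteq> M2" using f(2) lp_subset[OF lpi] by blast
      show "S i \<in> sets borel" unfolding S_def by (rule lp_vimage_borel[OF lpi X[OF i j]])
      show "S i \<subseteq> U i" by (auto simp: S_def)
      show "(\<lambda>x. f (\<phi> i x)) ` S i \<subseteq> \<psi> j ` V j" using p2.Ps[OF j] by (auto simp: S_def X_def)
    next
      show "{u \<in> V j. \<psi> j u \<in> E \<inter> Q j} \<in> sets borel"
        by (rule lp_vimage_borel[OF lpj]) (use E p2.Pb[OF j] in auto)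
      show "\<psi> j ` {u \<in> V j. \<psi> j u \<in> E \<inter> Q j} \<subseteq> (\<Union>i<m. (\<lambda>x. f (\<phi> i x)) ` S i)"
      proof clarify
        fix v assume v: "v \<in> V j" "\<psi> j v \<in> E" "\<psi> j v \<in> Q j"
        then obtain a where a: "a \<in> A" "f a = \<psi> j v" using E(2) by force
        then obtain i where i: "i < m" "a \<in> P i" using A p1.cover by blast
        then obtain u where u: "u \<in> U i" "\<phi> i u = a" using p1.Ps by blast
        have "u \<in> S i" using a i u v by (simp add: S_def X_def)
        then show "\<psi> j v \<in> (\<Union>i<m. (\<lambda>x. f (\<phi> i x)) ` S i)"
          using i u a by (auto intro!: bexI[of _ i] image_eqI[of _ _ u])
      qed
    qed auto
    also have "\<dots> \<le> (\<Sum>i<m. \<integral>\<^sup>+ x\<in>S i. k (\<phi> i x) * ennreal (area_density \<eta>1 (\<phi> i) x) \<partial>lborel)"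
      by (intro sum_mono nn_integral_mono) (use bound[OF p1.pos] in \<open>auto simp: S_def X_def indicator_def\<close>)
    also have "\<dots> = (\<Sum>i<m. \<integral>\<^sup>+ p\<in>X i j. k p \<partial>p1.\<mu>)"
    proof (rule sum.cong)
      fix i assume "i \<in> {..<m}"
      then have i: "i < m" by simp
      show "(\<integral>\<^sup>+ x\<in>S i. k (\<phi> i x) * ennreal (area_density \<eta>1 (\<phi> i) x) \<partial>lborel) = (\<integral>\<^sup>+ p\<in>X i j. k p \<partial>p1.\<mu>)"
        unfolding S_def
        by (rule p1.nn_integral_area_chart[symmetric, OF p1.pos[OF i] X[OF i j] _ k'])
           (use p1.Ps[OF i] in \<open>auto simp: X_def\<close>)
    qed simp
    finally show ?thesis .
  qed
  have "emeasure p2.\<mu> E = (\<Sum>j<l. chart_content \<eta>2 (V j) (\<psi> j) (E \<inter> Q j))"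
    using p2.is_area_measure_content[OF p2.is_area_measure_area_measure E(1) EM2] by (simp add: p2.content_def)
  also have "\<dots> \<le> (\<Sum>j<l. \<Sum>i<m. \<integral>\<^sup>+ p\<in>X i j. k p \<partial>p1.\<mu>)"
    using chart by (intro sum_mono) auto
  also have "\<dots> = (\<integral>\<^sup>+ p. (\<Sum>j<l. \<Sum>i<m. k p * indicator (X i j) p) \<partial>p1.\<mu>)"
  proof -
    have "X i j \<in> sets p1.\<mu>" if "i < m" "j < l" for i j
      using X[OF that] A p1.sets_area_iff by (auto simp: X_def)
    then have meas: "(\<lambda>p. k p * indicator (X i j) p) \<in> borel_measurable p1.\<mu>" if "i < m" "j < l" for i j
      using k' that by measurable
    have "(\<integral>\<^sup>+ p. (\<Sum>j<l. \<Sum>i<m. k p * indicator (X i j) p) \<partial>p1.\<mu>) = (\<Sum>j<l. \<integral>\<^sup>+ p. (\<Sum>i<m. k p * indicator (X i j) p) \<partial>p1.\<mu>)"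
      by (intro nn_integral_sum borel_measurable_sum meas) auto
    also have "\<dots> = (\<Sum>j<l. \<Sum>i<m. \<integral>\<^sup>+ p\<in>X i j. k p \<partial>p1.\<mu>)"
      by (intro sum.cong nn_integral_sum meas) auto
    finally show ?thesis by simp
  qed
  \<comment> \<open>At each point at most one pair of indices contributes, because the pieces are
    disjoint on both surfaces.\<close>
  also have "\<dots> \<le> (\<integral>\<^sup>+ p\<in>A. k p \<partial>p1.\<mu>)"
  proof (rule nn_integral_mono)
    fix p assume "p \<in> space p1.\<mu>"
    have 1: "(\<Sum>i<m. k p * indicator (X i j) p) \<le> k p * indicator (A \<inter> f -` Q j) p" for j
    proof -
      have "(\<Sum>i<m. k p * indicator (X i j) p) \<le> (\<Sum>i<m. k p * (indicator (A \<inter> f -` Q j) p * indicator (P i) p))"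
        by (intro sum_mono mult_left_mono) (auto simp: indicator_def X_def)
      also have "\<dots> = k p * indicator (A \<inter> f -` Q j) p * indicator (\<Union>i<m. P i) p"
        using p1.disj by (simp add: indicator_UN_disjoint sum_distrib_left mult.assoc)
      also have "\<dots> \<le> k p * indicator (A \<inter> f -` Q j) p" by (auto simp: indicator_def)
      finally show ?thesis .
    qed
    have "(\<Sum>j<l. \<Sum>i<m. k p * indicator (X i j) p) \<le> (\<Sum>j<l. k p * indicator (A \<inter> f -` Q j) p)"
      by (intro sum_mono 1)
    also have "\<dots> = (\<Sum>j<l. k p * (indicator A p * indicator (Q j) (f p)))"
      by (intro sum.cong) (auto simp: indicator_def)
    also have "\<dots> = k p * indicator A p * indicator (\<Union>j<l. Q j) (f p)"
      using p2.disj by (simp add: indicator_UN_disjoint sum_distrib_left mult.assoc)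
    also have "\<dots> \<le> k p * indicator A p" by (auto simp: indicator_def)
    finally show "(\<Sum>j<l. \<Sum>i<m. k p * indicator (X i j) p) \<le> k p * indicator A p" .
  qed
  finally show ?thesis .
qed

section \<open>The unit sphere of a smooth strictly convex norm\<close>

text \<open>Phrased through coefficients, since the set \<open>{x, y}\<close> would hide the case
  \<open>x = y\<close>.\<close>

definition indep2 :: "real^3 \<Rightarrow> real^3 \<Rightarrow> bool" where
  "indep2 x y \<longleftrightarrow> (\<forall>s t. s *\<^sub>R x + t *\<^sub>R y = 0 \<longrightarrow> s = 0 \<and> t = 0)"

lemma indep2_eqD:
  assumes "indep2 x y" "s *\<^sub>R x + t *\<^sub>R y = s' *\<^sub>R x + t' *\<^sub>R y"
  shows "s = s' \<and> t = t'"
proof -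
  have "(s - s') *\<^sub>R x + (t - t') *\<^sub>R y = 0" using assms(2) by (simp add: algebra_simps)
  then show ?thesis using assms(1) unfolding indep2_def by fastforce
qed

lemma span_pair: "span {x, y} = range (\<lambda>(s, t). s *\<^sub>R x + t *\<^sub>R (y :: real^3))"
proof (intro set_eqI iffI)
  fix z assume "z \<in> span {x, y}"
  then obtain k where "z - k *\<^sub>R x \<in> span {y}" by (auto simp: span_breakdown_eq)
  then obtain j where "z - k *\<^sub>R x = j *\<^sub>R y" by (auto simp: span_singleton)
  then have "z = k *\<^sub>R x + j *\<^sub>R y" by (metis add.commute diff_add_cancel)
  then show "z \<in> range (\<lambda>(s, t). s *\<^sub>R x + t *\<^sub>R y)" by (intro image_eqI[of _ _ "(k, j)"]) auto
next
  fix z assume "z \<in> range (\<lambda>(s, t). s *\<^sub>R x + t *\<^sub>R y)"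
  then show "z \<in> span {x, y}" by (auto intro!: span_add span_scale intro: span_base)
qed

lemma plane_basisE:
  assumes "plane_basis P b"
  shows "indep2 (b 1) (b 2)" "P = range (\<lambda>(s, t). s *\<^sub>R b 1 + t *\<^sub>R b 2)"
    "representation (range b) (s *\<^sub>R b 1 + t *\<^sub>R b 2) (b 1) = s"
    "representation (range b) (s *\<^sub>R b 1 + t *\<^sub>R b 2) (b 2) = t"
proof -
  have ra: "range b = {b 1, b 2}" unfolding UNIV_2 by simp
  have i: "independent (range b)" "span (range b) = P" "b 1 \<noteq> b 2"
    using assms by (auto simp: plane_basis_def dest: injD)
  have sp: "b 1 \<in> span (range b)" "b 2 \<in> span (range b)" by (auto intro: span_base)
  have r: "representation (range b) (s *\<^sub>R b 1 + t *\<^sub>R b 2)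
      = (\<lambda>v. s * representation (range b) (b 1) v + t * representation (range b) (b 2) v)" for s t
    using i(1) sp by (simp add: representation_add representation_scale span_scale)
  have r1: "representation (range b) (s *\<^sub>R b 1 + t *\<^sub>R b 2) (b 1) = s" for s t
    unfolding r using i by (simp add: representation_basis)
  have r2: "representation (range b) (s *\<^sub>R b 1 + t *\<^sub>R b 2) (b 2) = t" for s t
    unfolding r using i by (simp add: representation_basis)
  show "representation (range b) (s *\<^sub>R b 1 + t *\<^sub>R b 2) (b 1) = s" by (rule r1)
  show "representation (range b) (s *\<^sub>R b 1 + t *\<^sub>R b 2) (b 2) = t" by (rule r2)
  show "indep2 (b 1) (b 2)" unfolding indep2_def
    using r1 r2 by (metis representation_zero)
  show "P = range (\<lambda>(s, t). s *\<^sub>R b 1 + t *\<^sub>R b 2)"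
    unfolding i(2)[symmetric] ra by (rule span_pair)
qed

lemma plane_basis_SOME:
  assumes "indep2 x y" "P = range (\<lambda>(s, t). s *\<^sub>R x + t *\<^sub>R y)"
  shows "plane_basis P (SOME b. plane_basis P b)"
proof -
  define b :: "2 \<Rightarrow> real^3" where "b i = (if i = 1 then x else y)" for i
  have b: "b 1 = x" "b 2 = y" by (auto simp: b_def)
  have ra: "range b = {x, y}" unfolding UNIV_2 using b by simp
  have xy: "x \<noteq> y"
  proof
    assume "x = y"
    then show False using indep2_eqD[OF assms(1), of 1 "-1" 0 0] by simp
  qed
  have y0: "y \<noteq> 0" using indep2_eqD[OF assms(1), of 0 1 0 0] by auto
  have xs: "x \<notin> span {y}"
  proof
    assume "x \<in> span {y}"
    then obtain k where "x = k *\<^sub>R y" by (auto simp: span_singleton)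
    then show False using indep2_eqD[OF assms(1), of 1 "-k" 0 0] by auto
  qed
  have "plane_basis P b"
    unfolding plane_basis_def ra
  proof (intro conjI)
    show "inj b" using xy b by (intro injI) (metis exhaust_2)
    show "independent {x, y}" using xs y0 xy by (simp add: independent_insert)
    show "span {x, y} = P" unfolding assms(2) by (rule span_pair)
  qed
  then show ?thesis by (rule someI[where P = "plane_basis P"])
qed

text \<open>Invariance under change of basis: it frees \<open>plane_trace\<close> and
  \<open>plane_det\<close> from the basis picked by \<open>SOME\<close>, so that chart bases can be
  used.\<close>

lemma plane_trace_det_eq:
  assumes ind: "indep2 x y" and P: "P = range (\<lambda>(s, t). s *\<^sub>R x + t *\<^sub>R y)"
    and L: "linear L" "L x = p *\<^sub>R x + q *\<^sub>R y" "L y = r *\<^sub>R x + s *\<^sub>R y"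
  shows "plane_trace P L = p + s" "plane_det P L = p * s - q * r"
proof -
  define b where "b = (SOME b. plane_basis P b)"
  have pb: "plane_basis P b" unfolding b_def by (rule plane_basis_SOME[OF ind P])
  note pbE = plane_basisE[OF pb]
  have "b 1 \<in> P" "b 2 \<in> P" using pb by (auto simp: plane_basis_def intro: span_base)
  then obtain \<alpha> \<beta> \<gamma> \<delta> where b: "b 1 = \<alpha> *\<^sub>R x + \<beta> *\<^sub>R y" "b 2 = \<gamma> *\<^sub>R x + \<delta> *\<^sub>R y" using P by auto
  have Lc: "L (u *\<^sub>R x + v *\<^sub>R y) = (p * u + r * v) *\<^sub>R x + (q * u + s * v) *\<^sub>R y" for u v
    using L by (simp add: linear_add linear_scale algebra_simps)
  have "L (b 1) \<in> P" "L (b 2) \<in> P" unfolding b Lc P by auto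
  then obtain a11 a21 a12 a22 where a: "L (b 1) = a11 *\<^sub>R b 1 + a21 *\<^sub>R b 2" "L (b 2) = a12 *\<^sub>R b 1 + a22 *\<^sub>R b 2"
    using pbE(2) by auto
  have tr: "plane_trace P L = a11 + a22" and det: "plane_det P L = a11 * a22 - a12 * a21"
    unfolding plane_trace_def plane_det_def b_def[symmetric] basis_matrix_def trace_def sum_2 det_2
    by (simp_all add: a pbE(3,4))
  have e1: "p * \<alpha> + r * \<beta> = a11 * \<alpha> + a21 * \<gamma> \<and> q * \<alpha> + s * \<beta> = a11 * \<beta> + a21 * \<delta>"
    by (rule indep2_eqD[OF ind]) (use a(1) in \<open>unfold b Lc, simp add: algebra_simps\<close>)
  have e2: "p * \<gamma> + r * \<delta> = a12 * \<alpha> + a22 * \<gamma> \<and> q * \<gamma> + s * \<delta> = a12 * \<beta> + a22 * \<delta>"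
    by (rule indep2_eqD[OF ind]) (use a(2) in \<open>unfold b Lc, simp add: algebra_simps\<close>)
  \<comment> \<open>A vanishing base change determinant would force \<open>b 1 = 0\<close>.\<close>
  have D: "\<alpha> * \<delta> - \<beta> * \<gamma> \<noteq> 0"
  proof
    assume D: "\<alpha> * \<delta> - \<beta> * \<gamma> = 0"
    have "\<delta> *\<^sub>R b 1 + (- \<beta>) *\<^sub>R b 2 = (\<alpha> * \<delta> - \<beta> * \<gamma>) *\<^sub>R x" by (simp add: b algebra_simps)
    then have "\<beta> = 0" using indep2_eqD[OF pbE(1), of \<delta> "-\<beta>" 0 0] D by simp
    have "\<gamma> *\<^sub>R b 1 + (- \<alpha>) *\<^sub>R b 2 = (- (\<alpha> * \<delta> - \<beta> * \<gamma>)) *\<^sub>R y" by (simp add: b algebra_simps)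
    then have "\<alpha> = 0" using indep2_eqD[OF pbE(1), of \<gamma> "-\<alpha>" 0 0] D by simp
    have "1 *\<^sub>R b 1 + 0 *\<^sub>R b 2 = 0" using \<open>\<alpha> = 0\<close> \<open>\<beta> = 0\<close> b by simp
    then show False using indep2_eqD[OF pbE(1), of 1 0 0 0] by simp
  qed
  \<comment> \<open>\<open>e1\<close> and \<open>e2\<close> say that the base change intertwines the
    two matrices; multiplying by its determinant replaces inverting it.\<close>
  have "(p + s) * (\<alpha> * \<delta> - \<beta> * \<gamma>) = (a11 + a22) * (\<alpha> * \<delta> - \<beta> * \<gamma>)"
    using e1 e2 by algebra
  then show "plane_trace P L = p + s" using tr D by simp
  have "(p * s - q * r) * (\<alpha> * \<delta> - \<beta> * \<gamma>)
      = (p * \<alpha> + r * \<beta>) * (q * \<gamma> + s * \<delta>) - (q * \<alpha> + s * \<beta>) * (p * \<gamma> + r * \<delta>)" by algebra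
  also have "\<dots> = (a11 * \<alpha> + a21 * \<gamma>) * (a12 * \<beta> + a22 * \<delta>) - (a11 * \<beta> + a21 * \<delta>) * (a12 * \<alpha> + a22 * \<gamma>)"
    using e1 e2 by simp
  also have "\<dots> = (a11 * a22 - a12 * a21) * (\<alpha> * \<delta> - \<beta> * \<gamma>)" by algebra
  finally show "plane_det P L = p * s - q * r" using det D by simp
qed

lemma plane_det_eq_0:
  assumes ind: "indep2 x y" and P: "P = range (\<lambda>(s, t). s *\<^sub>R x + t *\<^sub>R y)"
    and L: "linear L" "\<And>w. w \<in> P \<Longrightarrow> L w \<in> P" and v: "v \<in> P" "v \<noteq> 0" "L v = 0"
  shows "plane_det P L = 0"
proof -
  have "x \<in> P" "y \<in> P" unfolding P by (auto intro: image_eqI[of _ _ "(1, 0)"] image_eqI[of _ _ "(0, 1)"])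
  then obtain p q r s where a: "L x = p *\<^sub>R x + q *\<^sub>R y" "L y = r *\<^sub>R x + s *\<^sub>R y"
    using L(2)[of x] L(2)[of y] unfolding P by auto
  obtain t u where tu: "v = t *\<^sub>R x + u *\<^sub>R y" using v(1) P by auto
  have "(p * t + r * u) *\<^sub>R x + (q * t + s * u) *\<^sub>R y = 0 *\<^sub>R x + 0 *\<^sub>R y"
    using v(3) unfolding tu using L(1) a by (simp add: linear_add linear_scale algebra_simps)
  then have e: "p * t + r * u = 0 \<and> q * t + s * u = 0" by (rule indep2_eqD[OF ind])
  have "t \<noteq> 0 \<or> u \<noteq> 0" using v(2) tu by auto
  moreover have "(p * s - q * r) * t = 0" "(p * s - q * r) * u = 0" using e by algebra+
  ultimately show ?thesis using plane_trace_det_eq(2)[OF ind P L(1) a] by auto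
qed

lemma lp_indep2: "local_param M U \<phi> \<Longrightarrow> u \<in> U \<Longrightarrow> indep2 (pd 1 \<phi> u) (pd 2 \<phi> u)"
  unfolding indep2_def using lp_pd_independent by blast

lemma tangent_space_pd:
  assumes "local_param M U \<phi>" "u \<in> U"
  shows "tangent_space M (\<phi> u) = range (\<lambda>(s, t). s *\<^sub>R pd 1 \<phi> u + t *\<^sub>R pd 2 \<phi> u)"
proof -
  have "(s, t) \<in> range (\<lambda>w::real^2. (w$1, w$2))" for s t
    by (rule image_eqI[of _ _ "vector [s, t]"]) auto
  then have "range (\<lambda>w::real^2. (w$1, w$2)) = UNIV" by auto
  then have "range (\<lambda>(s, t). s *\<^sub>R pd 1 \<phi> u + t *\<^sub>R pd 2 \<phi> u)
      = range (\<lambda>w::real^2. w$1 *\<^sub>R pd 1 \<phi> u + w$2 *\<^sub>R pd 2 \<phi> u)"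
    by (metis (no_types, lifting) image_cong image_image case_prod_conv)
  then show ?thesis
    unfolding tangent_space_chart[OF assms] by (simp add: lp_derivative_pd[OF assms])
qed

lemma transversalI:
  assumes "continuous_on M \<eta>"
    and "\<And>U \<phi> u. local_param M U \<phi> \<Longrightarrow> u \<in> U \<Longrightarrow> \<exists>c. pd 1 \<phi> u \<bullet> c = 0 \<and> pd 2 \<phi> u \<bullet> c = 0 \<and> \<eta> (\<phi> u) \<bullet> c \<noteq> 0"
  shows "transversal M \<eta>"
  unfolding transversal_def area_density_triple
proof (intro conjI assms(1) allI impI ballI)
  fix U \<phi> u assume a: "local_param M U \<phi>" "u \<in> U"
  then obtain c where "pd 1 \<phi> u \<bullet> c = 0" "pd 2 \<phi> u \<bullet> c = 0" "\<eta> (\<phi> u) \<bullet> c \<noteq> 0" using assms(2) by blast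
  then show "triple (pd 1 \<phi> u) (pd 2 \<phi> u) (\<eta> (\<phi> u)) \<noteq> 0"
    using lp_pd_independent[OF a] by (intro triple_nonzero)
qed

text \<open>Pairing the expansion in the basis \<open>x, y, n\<close> with \<open>c\<close> isolates
  the coefficient of \<open>n\<close>, which is therefore zero.\<close>

lemma plane_expansion:
  assumes T: "triple x y n \<noteq> 0" and c: "c \<bullet> x = 0" "c \<bullet> y = 0" "c \<bullet> n \<noteq> 0" and w: "c \<bullet> w = 0"
  shows "w = (triple w y n / triple x y n) *\<^sub>R x + (triple x w n / triple x y n) *\<^sub>R y"
proof -
  obtain k where e: "w = (triple w y n / triple x y n) *\<^sub>R x + (triple x w n / triple x y n) *\<^sub>R y + k *\<^sub>R n"
    using triple_basis_expansion[OF T] by blast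
  have "c \<bullet> w = k * (c \<bullet> n)"
    by (subst e) (simp add: inner_add_right c(1,2))
  then have "k = 0" using c(3) w by simp
  then show ?thesis using e by simp
qed

text \<open>Serves to normalise the gradient of the norm to a smooth Euclidean unit normal.\<close>

lemma Ck_on_sqrt:
  assumes "open S" "Ck_on k f S" "\<And>x. x \<in> S \<Longrightarrow> f x > 0"
  shows "Ck_on k (\<lambda>x. sqrt (f x)) S"
  using assms(2)
proof (induction k)
  case 0
  then show ?case by (auto intro: continuous_intros)
next
  case (Suc k)
  have i: "Ck_on k (\<lambda>x. inverse (sqrt (f x))) S"
    using Suc Ck_on_Suc_imp assms(3) by (intro Ck_on_inverse[OF assms(1)]) force+
  show ?case
  proof (rule Ck_on_SucI[OF assms(1)])
    show "((\<lambda>x. sqrt (f x)) has_derivative (\<lambda>v. fderiv f x v * inverse (sqrt (f x)) * (1/2))) (at x)"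
      if "x \<in> S" for x
      using has_derivative_real_sqrt[OF assms(3)[OF that] Ck_on_SucD(1)[OF Suc.prems that]]
      by (simp add: field_simps)
    show "Ck_on k (\<lambda>x. fderiv f x v * inverse (sqrt (f x)) * (1/2)) S" for v
      using Ck_on_SucD(2)[OF Suc.prems] i assms(1) by (intro Ck_on_mult Ck_on_const)
  qed
qed

section \<open>The norm, its gradient and its Hessian\<close>

locale smooth_convex_norm =
  fixes N :: "real^3 \<Rightarrow> real"
  assumes norm_N: "is_norm N" and smooth_N: "smooth_norm N" and strict_N: "strictly_convex_norm N"
begin

lemma N_nonneg: "N x \<ge> 0" and N_0_iff: "N x = 0 \<longleftrightarrow> x = 0"
  and N_scale: "N (c *\<^sub>R x) = \<bar>c\<bar> * N x" and N_triangle: "N (x + y) \<le> N x + N y"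
  using norm_N unfolding is_norm_def by auto

lemma N_minus: "N (- x) = N x" using N_scale[of "-1" x] by simp

lemma N_pos: "x \<noteq> 0 \<Longrightarrow> N x > 0" using N_nonneg[of x] N_0_iff[of x] by linarith

lemma smooth_on_N: "smooth_on N (- {0})" using smooth_N unfolding smooth_norm_def by blast

abbreviation "S \<equiv> unit_sphere N"

lemma S_nonzero: "q \<in> S \<Longrightarrow> q \<noteq> 0" using N_0_iff[of 0] by (auto simp: unit_sphere_def)

lemma S_N: "q \<in> S \<Longrightarrow> N q = 1" by (simp add: unit_sphere_def)

lemma S_minus: "q \<in> S \<Longrightarrow> - q \<in> S" by (simp add: unit_sphere_def N_minus)

definition G :: "real^3 \<Rightarrow> real^3" where
  "G q = (\<Sum>b\<in>Basis. fderiv N q b *\<^sub>R b)"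

definition dG :: "real^3 \<Rightarrow> real^3 \<Rightarrow> real^3" where
  "dG q = fderiv G q"

lemma G_inner:
  assumes "q \<noteq> 0" shows "G q \<bullet> w = fderiv N q w"
proof -
  have l: "linear (fderiv N q)"
    using smooth_on_frechet_linear[OF smooth_on_N] assms by auto
  have "fderiv N q w = fderiv N q (\<Sum>b\<in>Basis. (w \<bullet> b) *\<^sub>R b)"
    by (simp only: euclidean_representation)
  also have "\<dots> = (\<Sum>b\<in>Basis. (w \<bullet> b) * fderiv N q b)"
    by (simp only: linear_sum[OF l] linear_cmul[OF l] real_scaleR_def)
  also have "\<dots> = G q \<bullet> w" by (simp add: G_def inner_sum_left inner_commute[of w] mult.commute)
  finally show ?thesis by simp
qed

lemma N_derivative: "q \<noteq> 0 \<Longrightarrow> (N has_derivative (\<lambda>w. G q \<bullet> w)) (at q)"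
  using smooth_on_imp_has_derivative[OF smooth_on_N, of q] by (simp add: G_inner)

lemma G_smooth: "smooth_on G (- {0})"
  unfolding smooth_on_def G_def[abs_def]
  using smooth_on_frechet_derivative[OF smooth_on_N]
  by (auto intro!: Ck_on_sum Ck_on_scaleR Ck_on_const simp: smooth_on_def)

lemma G_derivative: "q \<noteq> 0 \<Longrightarrow> (G has_derivative dG q) (at q)"
  unfolding dG_def using smooth_on_imp_has_derivative[OF G_smooth] by auto

lemma dG_linear: "q \<noteq> 0 \<Longrightarrow> linear (dG q)"
  using G_derivative has_derivative_linear by blast

lemma N_along_line: "q \<noteq> 0 \<Longrightarrow> ((\<lambda>t. N (q + t *\<^sub>R w)) has_real_derivative (G q \<bullet> w)) (at 0)"
  using has_vector_derivative_along_line[of N "\<lambda>w. G q \<bullet> w" q 0 w] N_derivative[of q]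
  by (simp add: has_real_derivative_iff_has_vector_derivative)

text \<open>By homogeneity \<open>N\<close> is affine in the parameter along the ray through
  \<open>q\<close>, near \<open>q\<close>.\<close>

lemma euler:
  assumes "q \<noteq> 0" shows "G q \<bullet> q = N q"
proof -
  have "((\<lambda>t. N q + t * N q) has_real_derivative 0 + 1 * N q) (at 0)"
    by (rule DERIV_add[OF DERIV_const DERIV_cmult_right[OF DERIV_ident]])
  then have "((\<lambda>t. N q + t * N q) has_real_derivative N q) (at 0)" by simp
  then have "((\<lambda>t. N (q + t *\<^sub>R q)) has_real_derivative N q) (at 0)"
  proof (rule has_field_derivative_transform_within[where d = 1])
    fix t :: real assume "dist t 0 < 1"
    then have "\<bar>1 + t\<bar> = 1 + t" by auto
    then show "N q + t * N q = N (q + t *\<^sub>R q)"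
      using N_scale[of "1 + t" q] by (simp add: scaleR_add_left ring_distribs)
  qed auto
  then show ?thesis using N_along_line[OF assms] DERIV_unique by blast
qed

lemma S_inner: "q \<in> S \<Longrightarrow> G q \<bullet> q = 1"
  using euler S_nonzero S_N by simp

text \<open>By the triangle inequality the slope of \<open>N\<close> in direction \<open>y\<close>
  cannot exceed \<open>N y\<close>. Together with \<open>euler\<close> this makes \<open>G q\<close>
  the supporting functional of the unit ball at \<open>q\<close>.\<close>

lemma G_le:
  assumes "q \<noteq> 0" shows "G q \<bullet> y \<le> N y"
proof (rule ccontr)
  assume "\<not> G q \<bullet> y \<le> N y"
  then have "((\<lambda>t. N (q + t *\<^sub>R y) - t * N y) has_real_derivative (G q \<bullet> y - N y)) (at 0)" "G q \<bullet> y - N y > 0"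
    using DERIV_diff[OF N_along_line[OF assms, of y] DERIV_cmult_right[OF DERIV_ident, of "N y"]] by simp_all
  from DERIV_pos_inc_right[OF this]
  obtain d where d: "d > 0" "\<And>t. t > 0 \<Longrightarrow> t < d \<Longrightarrow> N q < N (q + t *\<^sub>R y) - t * N y"
    by (simp only: add_0_left scaleR_zero_left mult_zero_left diff_0_right add_0_right) blast
  have "N (q + (d/2) *\<^sub>R y) \<le> N q + (d/2) * N y"
    using N_triangle[of q "(d/2) *\<^sub>R y"] N_scale[of "d/2" y] d(1) by simp
  then show False using d(2)[of "d/2"] d(1) by simp
qed

lemma G_abs_le: "q \<noteq> 0 \<Longrightarrow> \<bar>G q \<bullet> y\<bar> \<le> N y"
  using G_le[of q y] G_le[of q "-y"] by (auto simp: N_minus abs_le_iff)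

text \<open>Strict convexity puts the midpoint of \<open>q\<close> and \<open>y\<close> inside the
  open ball, while \<open>G q\<close> would still have the value 1 there.\<close>

lemma G_eq_1:
  assumes "q \<in> S" "y \<in> S" "G q \<bullet> y = 1" shows "y = q"
proof (rule ccontr)
  assume "y \<noteq> q"
  then have "\<forall>t. 0 < t \<and> t < 1 \<longrightarrow> N ((1 - t) *\<^sub>R q + t *\<^sub>R y) < 1"
    using strict_N S_N[OF assms(1)] S_N[OF assms(2)] unfolding strictly_convex_norm_def by blast
  from this[rule_format, of "1/2"] have "N ((1 - 1/2) *\<^sub>R q + (1/2) *\<^sub>R y) < 1" by simp
  moreover have "G q \<bullet> ((1 - 1/2) *\<^sub>R q + (1/2) *\<^sub>R y) = 1"
    using assms(3) S_inner[OF assms(1)] by (simp add: inner_add_right)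
  ultimately show False using G_le[OF S_nonzero[OF assms(1)], of "(1 - 1/2) *\<^sub>R q + (1/2) *\<^sub>R y"] by linarith
qed

text \<open>The gradients are proportional with factor \<open>s\<close>. Evaluating at
  \<open>q\<close> gives \<open>1 = s * (G y \<bullet> q)\<close> with both factors at most 1 in
  absolute value, so \<open>s\<close> is 1 or -1, and \<open>G_eq_1\<close> identifies
  \<open>q\<close> with \<open>s\<close> times \<open>y\<close>.\<close>

lemma normal_determines:
  assumes q: "q \<in> S" and y: "y \<in> S" and c: "c = (c \<bullet> y) *\<^sub>R G y" "c = G q"
  shows "\<exists>s. (s = 1 \<or> s = -1) \<and> q = s *\<^sub>R y \<and> G q = s *\<^sub>R G y"
proof -
  define s where "s = G q \<bullet> y"
  have Gq: "G q = s *\<^sub>R G y" using c by (simp add: s_def)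
  then have 1: "1 = s * (G y \<bullet> q)" using S_inner[OF q] by (metis inner_scaleR_left)
  have 2: "\<bar>s\<bar> \<le> 1" "\<bar>G y \<bullet> q\<bar> \<le> 1"
    using G_abs_le[OF S_nonzero[OF q], of y] G_abs_le[OF S_nonzero[OF y], of q] S_N q y by (auto simp: s_def)
  have "\<bar>s\<bar> = 1"
  proof (rule antisym[OF 2(1)])
    have "1 = \<bar>s\<bar> * \<bar>G y \<bullet> q\<bar>" using 1 by (metis abs_mult abs_one)
    also have "\<dots> \<le> \<bar>s\<bar> * 1" using 2 by (intro mult_left_mono) auto
    finally show "1 \<le> \<bar>s\<bar>" by simp
  qed
  then have s: "s = 1 \<or> s = -1" by linarith
  have "G q \<bullet> (s *\<^sub>R y) = 1" using s by (auto simp: s_def[symmetric])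
  moreover have "s *\<^sub>R y \<in> S" using s y S_minus by auto
  ultimately have "s *\<^sub>R y = q" using G_eq_1[OF q] by blast
  then show ?thesis using s Gq by blast
qed

text \<open>Smoothness is available away from the origin; a bound by a multiple of the Euclidean
  norm gives continuity everywhere.\<close>

lemma N_continuous: "continuous_on UNIV N"
proof (rule continuous_at_imp_continuous_on, rule ballI)
  fix x :: "real^3"
  define K where "K = (\<Sum>b\<in>(Basis::(real^3) set). N b)"
  have bound: "N y \<le> K * norm y" for y
  proof -
    have 1: "N (\<Sum>b\<in>B. f b) \<le> (\<Sum>b\<in>B. N (f b))" if "finite B" for B :: "(real^3) set" and f
      using that
    proof induction
      case empty show ?case using N_0_iff[of 0] by simp
    next
      case (insert a B)
      then show ?case using N_triangle[of "f a" "sum f B"] by simp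
    qed
    have "N y = N (\<Sum>b\<in>Basis. (y \<bullet> b) *\<^sub>R b)" by (simp only: euclidean_representation)
    also have "\<dots> \<le> (\<Sum>b\<in>Basis. N ((y \<bullet> b) *\<^sub>R b))" by (rule 1) simp
    also have "\<dots> \<le> (\<Sum>b\<in>Basis. norm y * N b)"
      by (intro sum_mono) (auto simp: N_scale Basis_le_norm N_nonneg intro!: mult_right_mono)
    also have "\<dots> = K * norm y" by (simp add: K_def sum_distrib_left mult.commute)
    finally show ?thesis .
  qed
  show "continuous (at x) N"
    unfolding continuous_at_eps_delta
  proof (intro allI impI)
    fix e :: real assume "e > 0"
    have K: "K \<ge> 0" unfolding K_def by (intro sum_nonneg) (auto simp: N_nonneg)
    have "dist (N y) (N x) < e" if "dist y x < e / (K + 1)" for y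
    proof -
      have "\<bar>N y - N x\<bar> \<le> N (y - x)"
        using N_triangle[of x "y - x"] N_triangle[of y "x - y"] N_minus[of "y - x"] by (simp add: abs_le_iff)
      also have "\<dots> \<le> (K + 1) * norm (y - x)" using bound[of "y - x"] by (simp add: algebra_simps add_increasing)
      also have "\<dots> < e" using that K by (simp add: dist_norm field_simps)
      finally show ?thesis by (simp add: dist_real_def)
    qed
    then show "\<exists>d>0. \<forall>y. dist y x < d \<longrightarrow> dist (N y) (N x) < e"
      using \<open>e > 0\<close> K by (intro exI[of _ "e / (K + 1)"]) auto
  qed
qed

lemma S_compact: "compact S"
proof -
  have cl: "closed S" unfolding unit_sphere_def
    using continuous_closed_vimage[of "{1}" N] N_continuous
    by (simp add: vimage_def continuous_on_eq_continuous_at)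
  \<comment> \<open>The minimum of \<open>N\<close> on the Euclidean unit sphere is positive, and
    its inverse bounds the Euclidean size of \<open>S\<close>.\<close>
  have "compact (sphere (0::real^3) 1)" "sphere (0::real^3) 1 \<noteq> {}" by auto
  then obtain x where x: "norm x = 1" "\<And>y. norm y = 1 \<Longrightarrow> N x \<le> N y"
    using continuous_attains_inf[of "sphere 0 1" N] N_continuous continuous_on_subset by (metis mem_sphere_0 subset_UNIV)
  have Nx: "N x > 0" using x(1) by (intro N_pos) auto
  have "norm q \<le> 1 / N x" if "q \<in> S" for q
  proof -
    have q0: "norm q > 0" using S_nonzero[OF that] by simp
    have "N x \<le> N ((1 / norm q) *\<^sub>R q)" using q0 by (intro x(2)) auto
    also have "\<dots> = 1 / norm q" using q0 S_N[OF that] by (simp add: N_scale)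
    finally show ?thesis using q0 Nx by (simp add: field_simps)
  qed
  then have "bounded S" by (auto simp: bounded_iff)
  then show ?thesis using cl compact_eq_bounded_closed by blast
qed

lemma S_nonempty: "S \<noteq> {}"
proof -
  obtain x :: "real^3" where x: "x \<noteq> 0" using axis_eq_0_iff[of "1::3" "1::real"] by blast
  have "(1 / N x) *\<^sub>R x \<in> S" using N_pos[OF x] by (simp add: unit_sphere_def N_scale)
  then show ?thesis by blast
qed

lemma dG_symmetric:
  assumes "q \<noteq> 0" shows "dG q v \<bullet> w = dG q w \<bullet> v"
proof -
  have o: "open (- {0::real^3})" by auto
  have q: "q \<in> - {0}" using assms by auto
  have "fderiv (\<lambda>y. frechet_derivative N (at y) w) q v = dG q v \<bullet> w" for v w
  proof -
    have "((\<lambda>y. G y \<bullet> w) has_derivative (\<lambda>v. dG q v \<bullet> w)) (at q)"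
      using G_derivative[OF assms] by (auto intro!: derivative_eq_intros)
    then have "((\<lambda>y. fderiv N y w) has_derivative (\<lambda>v. dG q v \<bullet> w)) (at q)"
      by (rule has_derivative_transform_within_open[OF _ o q]) (simp add: G_inner)
    then show ?thesis using frechet_derivative_at by metis
  qed
  then show ?thesis using second_derivative_symmetric[OF o smooth_on_N q, of w v] by simp
qed

text \<open>Two instances of \<open>G_le\<close> added, with \<open>euler\<close> for the diagonal
  terms.\<close>

lemma G_monotone:
  assumes "x \<noteq> 0" "y \<noteq> 0" shows "(G y - G x) \<bullet> (y - x) \<ge> 0"
proof -
  have "(G y - G x) \<bullet> (y - x) = (N y - G x \<bullet> y) + (N x - G y \<bullet> x)"
    unfolding inner_diff_left inner_diff_right euler[OF assms(1)] euler[OF assms(2)] by simp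
  then show ?thesis using G_le[OF assms(1), of y] G_le[OF assms(2), of x] by linarith
qed

text \<open>A negative value would make the component of \<open>G\<close> along \<open>v\<close>
  decrease in direction \<open>v\<close>, against \<open>G_monotone\<close>.\<close>

lemma dG_nonneg:
  assumes "q \<noteq> 0" shows "dG q v \<bullet> v \<ge> 0"
proof (rule ccontr)
  assume neg: "\<not> dG q v \<bullet> v \<ge> 0"
  have "((\<lambda>t. G (q + t *\<^sub>R v)) has_vector_derivative dG q v) (at 0)"
    using has_vector_derivative_along_line[of G _ q 0 v] G_derivative[OF assms] by simp
  then have "((\<lambda>t. G (q + t *\<^sub>R v) \<bullet> v) has_vector_derivative (dG q v \<bullet> v)) (at 0)"
    by (rule bounded_linear.has_vector_derivative[OF bounded_linear_inner_left])
  then have "((\<lambda>t. G (q + t *\<^sub>R v) \<bullet> v) has_real_derivative (dG q v \<bullet> v)) (at 0)"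
    by (simp add: has_real_derivative_iff_has_vector_derivative)
  moreover have "dG q v \<bullet> v < 0" using neg by simp
  ultimately have "\<exists>d>0. \<forall>t>0. t < d \<longrightarrow> G (q + (0 + t) *\<^sub>R v) \<bullet> v < G (q + 0 *\<^sub>R v) \<bullet> v"
    by (rule DERIV_neg_dec_right)
  then obtain d where d: "d > 0" "\<And>t. t > 0 \<Longrightarrow> t < d \<Longrightarrow> G (q + t *\<^sub>R v) \<bullet> v < G q \<bullet> v"
    by (simp only: add_0_left scaleR_zero_left add_0_right) blast
  have v0: "v \<noteq> 0" using neg by auto
  \<comment> \<open>The second bound keeps \<open>norm (t *\<^sub>R v)\<close> below
    \<open>norm q\<close>, so the moved point is not the origin.\<close>
  define t where "t = min (d / 2) (norm q / (2 * norm v))"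
  have t: "t > 0" "t < d" using d assms v0 by (auto simp: t_def)
  have "norm (t *\<^sub>R v) < norm q"
  proof -
    have "t * norm v \<le> norm q / (2 * norm v) * norm v" by (intro mult_right_mono) (auto simp: t_def)
    also have "\<dots> < norm q" using v0 assms by simp
    finally show ?thesis using t by simp
  qed
  then have nz: "q + t *\<^sub>R v \<noteq> 0"
    by (metis add_eq_0_iff less_irrefl norm_minus_cancel)
  have "t * ((G (q + t *\<^sub>R v) - G q) \<bullet> v) \<ge> 0"
    using G_monotone[OF assms nz] by simp
  then show False using d(2)[OF t] t(1) by (simp add: inner_diff_left zero_le_mult_iff)
qed

text \<open>A null vector of a semidefinite form lies in its kernel: otherwise the form would be
  negative at a small perturbation of \<open>v\<close>.\<close>

lemma dG_degenerate:
  assumes "q \<noteq> 0" "dG q v \<bullet> v = 0" shows "dG q v = 0"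
proof -
  have "dG q v \<bullet> w = 0" for w
  proof -
    define a where "a = dG q v \<bullet> w"
    define b where "b = dG q w \<bullet> w"
    have b: "b \<ge> 0" unfolding b_def by (rule dG_nonneg[OF assms(1)])
    have l: "linear (dG q)" by (rule dG_linear[OF assms(1)])
    define c where "c = b + 1"
    have c: "c > 0" "b = c - 1" using b by (auto simp: c_def)
    \<comment> \<open>The minimiser would be \<open>- a / b\<close>, but \<open>b\<close> may
      vanish; dividing by \<open>b + 1\<close> still gives a negative value unless
      \<open>a = 0\<close>.\<close>
    define t where "t = - a / c"
    have "dG q (v + t *\<^sub>R w) \<bullet> (v + t *\<^sub>R w) = 2 * t * a + t\<^sup>2 * b"
      using assms(2) dG_symmetric[OF assms(1), of w v]
      by (simp add: linear_add[OF l] linear_cmul[OF l] inner_add_left inner_add_right a_def b_def power2_eq_square algebra_simps)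
    also have "\<dots> = - (a\<^sup>2 * (b + 2)) / c\<^sup>2"
      using c(1) unfolding c(2) by (simp add: t_def field_simps power2_eq_square)
    finally have "a\<^sup>2 * (b + 2) / c\<^sup>2 \<le> 0"
      using dG_nonneg[OF assms(1), of "v + t *\<^sub>R w"] by simp
    moreover have "c\<^sup>2 > 0" using c by simp
    ultimately have "a\<^sup>2 * (b + 2) \<le> 0" by (simp add: divide_le_0_iff)
    then show ?thesis using b unfolding a_def by (simp add: mult_le_0_iff)
  qed
  then show ?thesis by (metis inner_eq_zero_iff)
qed

section \<open>The unit sphere as a surface\<close>

text \<open>The chart is the central projection onto the sphere of the affine plane where coordinate
  \<open>k\<close> equals \<sigma>; it covers the half of the sphere on the side of
  \<open>p\<close>. Its left inverse \<open>g\<close> is differentiable on the image, hence the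
  derivative of the chart is injective.\<close>

lemma smooth_surface_S: "smooth_surface S"
  unfolding smooth_surface_def
proof
  fix p assume p: "p \<in> S"
  then obtain k where k: "p $ k \<noteq> 0" using S_nonzero by (metis vec_eq_iff zero_index)
  have "\<exists>i j. i \<noteq> j \<and> i \<noteq> k \<and> j \<noteq> k \<and> (\<forall>l. l = i \<or> l = j \<or> l = k)"
    using exhaust_3[of k]
  proof (elim disjE)
    assume "k = 1" then show ?thesis by (intro exI[of _ 2] exI[of _ 3]) (simp add: forall_3)
  next
    assume "k = 2" then show ?thesis by (intro exI[of _ 1] exI[of _ 3]) (simp add: forall_3)
  next
    assume "k = 3" then show ?thesis by (intro exI[of _ 1] exI[of _ 2]) (simp add: forall_3)
  qed
  then obtain i j where ij: "i \<noteq> j" "i \<noteq> k" "j \<noteq> k" "\<And>l. l = i \<or> l = j \<or> l = k" by blast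
  define \<sigma> where "\<sigma> = sgn (p $ k)"
  have \<sigma>: "\<sigma> * \<sigma> = 1" "\<sigma> * p $ k > 0" "\<sigma> \<noteq> 0" using k by (auto simp: \<sigma>_def sgn_if)
  define s :: "real^2 \<Rightarrow> real^3" where "s u = u$1 *\<^sub>R axis i 1 + u$2 *\<^sub>R axis j 1 + \<sigma> *\<^sub>R axis k 1" for u
  have s: "s u $ i = u $ 1" "s u $ j = u $ 2" "s u $ k = \<sigma>" for u
    using ij by (auto simp: s_def axis_def)
  have s0: "s u \<noteq> 0" for u using s(3) \<sigma>(3) by (metis zero_index)
  define g :: "real^3 \<Rightarrow> real^2" where "g x = (\<sigma> * x$i / x$k) *\<^sub>R axis 1 1 + (\<sigma> * x$j / x$k) *\<^sub>R axis 2 1" for x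
  have g: "g x $ 1 = \<sigma> * x$i / x$k" "g x $ 2 = \<sigma> * x$j / x$k" for x
    by (auto simp: g_def axis_def)
  define \<phi> where "\<phi> u = inverse (N (s u)) *\<^sub>R s u" for u
  have Ns: "N (s u) > 0" for u using N_pos s0 by blast
  have \<phi>k: "\<phi> u $ k = \<sigma> / N (s u)" for u by (simp add: \<phi>_def s divide_inverse mult.commute)
  have g\<phi>: "g (\<phi> u) = u" for u
    using Ns[of u] \<sigma> by (simp add: vec_eq_iff forall_2 g \<phi>_def s field_simps)
  have \<phi>S: "\<phi> u \<in> S \<inter> {x. \<sigma> * x $ k > 0}" for u
    using Ns[of u] \<sigma> by (simp add: unit_sphere_def \<phi>k) (simp add: \<phi>_def N_scale)
  have \<phi>g: "\<phi> (g x) = x" if "x \<in> S \<inter> {x. \<sigma> * x $ k > 0}" for x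
  proof -
    have xk: "x $ k \<noteq> 0" "\<sigma> * x $ k > 0" "N x = 1" using that by (auto simp: unit_sphere_def)
    have pos: "\<sigma> / x $ k > 0" using xk by (simp add: zero_less_mult_iff zero_less_divide_iff)
    have "s (g x) $ l = ((\<sigma> / x $ k) *\<^sub>R x) $ l" for l
      using ij(4)[of l] xk by (auto simp: s g)
    then have sg: "s (g x) = (\<sigma> / x $ k) *\<^sub>R x" by (simp add: vec_eq_iff)
    have "N (s (g x)) = \<sigma> / x $ k" unfolding sg N_scale abs_of_pos[OF pos] using xk by simp
    then show ?thesis unfolding \<phi>_def sg using xk \<sigma> by simp
  qed
  have im: "range \<phi> = S \<inter> {x. \<sigma> * x $ k > 0}"
  proof (intro equalityI subsetI)
    fix x assume "x \<in> S \<inter> {x. \<sigma> * x $ k > 0}"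
    then show "x \<in> range \<phi>" using \<phi>g rangeI[of \<phi> "g x"] by metis
  qed (use \<phi>S in blast)
  have o: "open {x. \<sigma> * x $ k > 0}" by (intro open_Collect_less continuous_intros)
  have Cs: "Ck_on m s UNIV" for m
    unfolding s_def by (intro Ck_on_add Ck_on_scaleR Ck_on_const Ck_on_bounded_linear[OF bounded_linear_vec_nth] Ck_on_id open_UNIV)
  have C\<phi>: "smooth_on \<phi> UNIV"
    unfolding smooth_on_def \<phi>_def
  proof (intro allI Ck_on_scaleR Ck_on_inverse Cs open_UNIV)
    fix m show "Ck_on m (\<lambda>x. N (s x)) UNIV"
      by (rule Ck_on_compose[where T = "- {0}"]) (use smooth_on_N Cs s0 in \<open>auto simp: smooth_on_def\<close>)
  qed (metis Ns less_irrefl)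
  have gd: "g differentiable (at x)" if "x $ k \<noteq> 0" for x
  proof -
    have c: "(\<lambda>x. x $ l) differentiable (at x)" for l
      by (rule bounded_linear_imp_differentiable[OF bounded_linear_vec_nth])
    show ?thesis unfolding g_def
      using that by (intro differentiable_add differentiable_scaleR differentiable_divide differentiable_mult
          differentiable_const c)
  qed
  have inj: "inj (fderiv \<phi> u)" for u
  proof -
    have "\<phi> u $ k \<noteq> 0" using \<phi>S[of u] by auto
    then obtain D where D: "(g has_derivative D) (at (\<phi> u))" using gd by (auto simp: differentiable_def)
    have "(\<phi> has_derivative fderiv \<phi> u) (at u)"
      by (rule smooth_on_imp_has_derivative[OF C\<phi>]) simp
    then have "((\<lambda>x. g (\<phi> x)) has_derivative (\<lambda>w. D (fderiv \<phi> u w))) (at u)"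
      using D by (rule has_derivative_compose)
    then have "(\<lambda>w. D (fderiv \<phi> u w)) = (\<lambda>w. w)"
      unfolding g\<phi> by (rule has_derivative_unique[OF _ has_derivative_ident])
    then show ?thesis by (metis injI)
  qed
  have "continuous_on (S \<inter> {x. \<sigma> * x $ k > 0}) g"
    by (intro continuous_at_imp_continuous_on ballI differentiable_imp_continuous_within gd) auto
  then have "continuous_on (range \<phi>) g" unfolding im .
  then have "homeomorphism UNIV (range \<phi>) \<phi> g"
    unfolding homeomorphism_def using smooth_on_imp_continuous_on[OF C\<phi>] by (simp add: image_image g\<phi>)
  then have "local_param S UNIV \<phi>"
    unfolding local_param_def using C\<phi> o inj by (auto simp: im openin_open)
  moreover have "p \<in> range \<phi>" using p \<sigma> by (simp add: im)
  ultimately show "\<exists>U \<phi>. local_param S U \<phi> \<and> p \<in> \<phi> ` U" by blast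
qed

text \<open>\<open>N\<close> is constant along \<open>f\<close>; this is the chain rule for that
  constant.\<close>

lemma unit_field_derivative:
  assumes "(f has_derivative f') (at u)" "open U" "u \<in> U" "\<And>x. x \<in> U \<Longrightarrow> f x \<in> S"
  shows "G (f u) \<bullet> f' h = 0"
  by (rule has_derivative_locally_constant[OF has_derivative_compose[OF assms(1) N_derivative] assms(2,3)])
     (use assms(3,4) S_nonzero S_N in blast)+

lemma S_chart_normal:
  assumes "local_param S U \<phi>" "u \<in> U"
  shows "G (\<phi> u) \<bullet> fderiv \<phi> u w = 0"
  by (rule unit_field_derivative[OF lp_has_derivative[OF assms] lp_open[OF assms(1)] assms(2)])
     (use lp_subset[OF assms(1)] in blast)

lemma tangent_space_S:
  assumes q: "q \<in> S" shows "tangent_space S q = {w. G q \<bullet> w = 0}"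
proof -
  obtain U \<phi> u where lp: "local_param S U \<phi>" and u: "u \<in> U" "\<phi> u = q"
    using smooth_surface_S q unfolding smooth_surface_def by (metis imageE)
  let ?x = "pd 1 \<phi> u" and ?y = "pd 2 \<phi> u"
  have xy: "G q \<bullet> ?x = 0" "G q \<bullet> ?y = 0" using S_chart_normal[OF lp u(1)] u(2) by (auto simp: pd_def)
  have T: "triple ?x ?y q \<noteq> 0"
    by (rule triple_nonzero[where c = "G q"])
       (use lp_pd_independent[OF lp u(1)] xy S_inner[OF q] in \<open>auto simp: inner_commute\<close>)
  have "w \<in> tangent_space S q" if "G q \<bullet> w = 0" for w
    using plane_expansion[OF T xy _ that] S_inner[OF q] tangent_space_pd[OF lp u(1)] u(2) by (auto simp: image_iff)
  moreover have "G q \<bullet> w = 0" if "w \<in> tangent_space S q" for w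
    using that xy tangent_space_pd[OF lp u(1)] u(2) by (auto simp: inner_add_right)
  ultimately show ?thesis by blast
qed

lemma transversal_S: "transversal S (\<lambda>q. q)"
proof (rule transversalI)
  fix U \<phi> u assume a: "local_param S U \<phi>" "u \<in> U"
  then have "\<phi> u \<in> S" using lp_subset by blast
  then show "\<exists>c. pd 1 \<phi> u \<bullet> c = 0 \<and> pd 2 \<phi> u \<bullet> c = 0 \<and> \<phi> u \<bullet> c \<noteq> 0"
    using S_chart_normal[OF a] S_inner[of "\<phi> u"]
    by (intro exI[of _ "G (\<phi> u)"]) (auto simp: pd_def inner_commute)
qed auto

lemmas S_surface = smooth_surface_S S_compact transversal_S

text \<open>\<open>gaussian_curvature\<close> picks some Gauss map; the normalised gradient shows
  that there is one to pick.\<close>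

lemma euclidean_gauss_map_exists: "\<exists>n. euclidean_gauss_map S n"
proof
  define F where "F q = inverse (sqrt (G q \<bullet> G q)) *\<^sub>R G q" for q
  have G0: "G q \<noteq> 0" if "q \<noteq> 0" for q using euler[OF that] N_pos[OF that] by auto
  have "smooth_on F (- {0})"
    unfolding smooth_on_def F_def
    by (intro allI Ck_on_scaleR Ck_on_inverse Ck_on_sqrt Ck_on_inner)
       (use G_smooth G0 in \<open>auto simp: smooth_on_def\<close>)
  then have "smooth_map_on S F" unfolding smooth_map_on_def
    using S_nonzero by (intro ballI exI[of _ "- {0}"] exI[of _ F]) auto
  moreover have "norm (F q) = 1" if "q \<in> S" for q
    using G0[OF S_nonzero[OF that]] by (simp add: F_def norm_eq_sqrt_inner[symmetric])
  moreover have "F q \<bullet> v = 0" if "q \<in> S" "v \<in> tangent_space S q" for q v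
    using that by (simp add: F_def tangent_space_S)
  ultimately show "euclidean_gauss_map S F" by (simp add: euclidean_gauss_map_def)
qed

end

locale minkowski_space = smooth_convex_norm +
  assumes curvature: "\<forall>q\<in>unit_sphere N. gaussian_curvature (unit_sphere N) q \<noteq> 0"
begin

text \<open>A null vector \<open>v\<close> of the Hessian lies in its kernel, so the normal
  direction is stationary along \<open>v\<close>. The differential of the Euclidean Gauss map then
  kills \<open>v\<close>, and its determinant, the Gaussian curvature, vanishes.\<close>

lemma dG_definite:
  assumes q: "q \<in> S" and v: "G q \<bullet> v = 0" "v \<noteq> 0"
  shows "dG q v \<bullet> v > 0"
proof (rule ccontr)
  assume "\<not> dG q v \<bullet> v > 0"
  then have dv: "dG q v = 0"
    using dG_nonneg[OF S_nonzero[OF q], of v] dG_degenerate[OF S_nonzero[OF q], of v] by linarith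
  define n where "n = (SOME n. euclidean_gauss_map S n)"
  have gm: "euclidean_gauss_map S n" unfolding n_def by (rule someI_ex[OF euclidean_gauss_map_exists])
  then have nsm: "smooth_map_on S n" by (simp add: euclidean_gauss_map_def)
  define L where "L = surface_diff S n q"
  have dL: "(n has_derivative L) (at q within S)" unfolding L_def by (rule smooth_map_on_has_derivative[OF nsm q])
  obtain U \<phi> u where lp: "local_param S U \<phi>" and u: "u \<in> U" "\<phi> u = q"
    using smooth_surface_S q unfolding smooth_surface_def by (metis imageE)
  let ?D = "fderiv \<phi> u"
  have G0: "G x \<noteq> 0" if "x \<in> S" for x using S_inner[OF that] by auto
  \<comment> \<open>The coefficient of the orthogonal projection of \<open>n q\<close> on
    \<open>G q\<close>. The rest \<open>z\<close> is tangent, hence orthogonal to \<open>n q\<close>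
    as well as to \<open>G q\<close>, and so it is zero.\<close>
  define \<kappa> where "\<kappa> = (n q \<bullet> G q) / (G q \<bullet> G q)"
  define z where "z = n q - \<kappa> *\<^sub>R G q"
  have "G q \<bullet> z = 0" using G0[OF q] by (simp add: z_def \<kappa>_def inner_diff_right inner_commute)
  moreover from this have "n q \<bullet> z = 0" using gm q tangent_space_S[OF q] by (simp add: euclidean_gauss_map_def)
  ultimately have "z \<bullet> z = 0" by (simp add: z_def inner_diff_left)
  then have n\<kappa>: "n q = \<kappa> *\<^sub>R G q" by (simp add: z_def)
  have dn: "((\<lambda>x. n (\<phi> x)) has_derivative (\<lambda>w. L (?D w))) (at u)"
    by (rule lp_compose_has_derivative[OF lp u(1)]) (use dL u in simp)
  have dGc: "((\<lambda>x. G (\<phi> x)) has_derivative (\<lambda>w. dG q (?D w))) (at u)"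
    using has_derivative_compose[OF lp_has_derivative[OF lp u(1)]] G_derivative[OF S_nonzero[OF q]] u by simp
  have n1: "n x \<bullet> n x = 1" if "x \<in> S" for x using gm that by (simp add: euclidean_gauss_map_def norm_eq_1)
  have "((\<lambda>x. n (\<phi> x) \<bullet> n (\<phi> x)) has_derivative (\<lambda>w. n q \<bullet> L (?D w) + L (?D w) \<bullet> n q)) (at u)"
    using has_derivative_inner[OF dn dn] u by simp
  then have "n q \<bullet> L (?D w) + L (?D w) \<bullet> n q = 0" for w
    by (rule has_derivative_locally_constant[OF _ lp_open[OF lp] u(1)])
       (use n1 lp_subset[OF lp] in auto)
  then have nL: "n q \<bullet> L (?D w) = 0" for w by (simp add: inner_commute)
  have \<kappa>0: "\<kappa> \<noteq> 0" using n\<kappa> n1[OF q] by auto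
  then have GL: "G q \<bullet> L (?D w) = 0" for w using nL n\<kappa> by simp
  have tan: "tangent_space S q = range ?D" using tangent_space_chart[OF lp u(1)] u(2) by simp
  obtain w0 where w0: "v = ?D w0" using v(1) tangent_space_S[OF q] tan by blast
  \<comment> \<open>Differentiating both \<open>n \<bullet> pd j \<phi> = 0\<close> and
    \<open>G \<bullet> pd j \<phi> = 0\<close> along \<open>w0\<close> avoids differentiating
    \<kappa>: as \<open>dG q v = 0\<close>, the second relation kills the second derivative term,
    and \<open>n q\<close> is a multiple of \<open>G q\<close>.\<close>
  have Lpd: "L v \<bullet> pd j \<phi> u = 0" for j
  proof -
    have dj: "(pd j \<phi> has_derivative fderiv (pd j \<phi>) u) (at u)"
      by (rule smooth_on_imp_has_derivative[OF smooth_on_pd[OF lp_smooth[OF lp]] u(1)])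
    have tj: "pd j \<phi> x \<in> tangent_space S (\<phi> x)" "\<phi> x \<in> S" if "x \<in> U" for x
      using tangent_space_chart[OF lp that] lp_subset[OF lp] that by (auto simp: pd_def)
    have "n (\<phi> u) \<bullet> fderiv (pd j \<phi>) u w0 + L (?D w0) \<bullet> pd j \<phi> u = 0"
      by (rule has_derivative_locally_constant[OF has_derivative_inner[OF dn dj] lp_open[OF lp] u(1)])
         (use tj gm in \<open>auto simp: euclidean_gauss_map_def\<close>)
    moreover have "G (\<phi> u) \<bullet> fderiv (pd j \<phi>) u w0 + dG q (?D w0) \<bullet> pd j \<phi> u = 0"
      by (rule has_derivative_locally_constant[OF has_derivative_inner[OF dGc dj] lp_open[OF lp] u(1)])
         (use tj tangent_space_S in auto)
    ultimately show ?thesis using dv n\<kappa> u(2) by (simp flip: w0)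
  qed
  have "L v \<in> tangent_space S q" using GL[of w0] tangent_space_S[OF q] by (simp flip: w0)
  then obtain c d where "L v = c *\<^sub>R pd 1 \<phi> u + d *\<^sub>R pd 2 \<phi> u"
    using tangent_space_pd[OF lp u(1)] u(2) by auto
  then have "L v \<bullet> L v = 0" using Lpd by (metis add.right_neutral inner_add_right inner_scaleR_right mult_zero_right)
  then have "L v = 0" by simp
  have "gaussian_curvature S q = plane_det (tangent_space S q) L"
    by (simp add: gaussian_curvature_def L_def n_def)
  also have "\<dots> = 0"
  proof (rule plane_det_eq_0[OF lp_indep2[OF lp u(1)]])
    show "tangent_space S q = range (\<lambda>(s, t). s *\<^sub>R pd 1 \<phi> u + t *\<^sub>R pd 2 \<phi> u)"
      using tangent_space_pd[OF lp u(1)] u(2) by simp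
    show "linear L" using dL has_derivative_linear by blast
    show "L w \<in> tangent_space S q" if "w \<in> tangent_space S q" for w
    proof -
      from that tan obtain w' where "w = ?D w'" by auto
      then show ?thesis using GL tangent_space_S[OF q] by simp
    qed
    show "v \<in> tangent_space S q" using v tangent_space_S[OF q] by simp
  qed (use v \<open>L v = 0\<close> in auto)
  finally show False using curvature q by blast
qed

end

section \<open>Curvatures of the Birkhoff-Gauss map\<close>

lemma semidefinite_det_nonneg:
  fixes a b c :: real
  assumes "\<And>s t. s\<^sup>2 * a + 2 * s * t * b + t\<^sup>2 * c \<ge> 0"
  shows "a * c - b * b \<ge> 0"
proof (cases "a = 0")
  case True
  have "b = 0"
  proof (rule ccontr)
    assume "b \<noteq> 0"
    have c: "c \<ge> 0" using assms[of 0 1] by simp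
    \<comment> \<open>With \<open>a = 0\<close> the form is affine in \<open>s\<close>; this
      \<open>s\<close> gives it the value -1.\<close>
    define s where "s = - (c + 1) / (2 * b)"
    have "s\<^sup>2 * a + 2 * s * 1 * b + 1\<^sup>2 * c = - 1" using True \<open>b \<noteq> 0\<close> by (simp add: s_def field_simps)
    then show False using assms[of s 1] by linarith
  qed
  then show ?thesis using True by simp
next
  case False
  then have "a > 0" using assms[of 1 0] by simp
  have "b\<^sup>2 * a + 2 * b * (- a) * b + (- a)\<^sup>2 * c = a * (a * c - b * b)"
    by (simp add: power2_eq_square algebra_simps)
  \<comment> \<open>The pair \<open>(b, - a)\<close> is orthogonal to \<open>(1, 0)\<close> for the
    form, and the form takes there the value \<open>a\<close> times the determinant.\<close>
  then have "a * (a * c - b * b) \<ge> 0" using assms[of b "- a"] by simp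
  then show ?thesis using \<open>a > 0\<close> by (simp add: zero_le_mult_iff)
qed

text \<open>Written in a basis in which a positive definite form is \<open>h\<close>, the hypothesis \<open>sym\<close> says that
  the matrix \<open>a\<close> is self-adjoint for \<open>h\<close>; its discriminant is then a sum of squares up to a positive factor.\<close>

lemma selfadjoint_trace_det:
  fixes h11 h12 h22 a11 a12 a21 a22 :: real
  assumes h: "h11 > 0" "h11 * h22 - h12 * h12 > 0"
    and sym: "a11 * h12 + a21 * h22 = a12 * h11 + a22 * h12"
  shows "(1/2 * (a11 + a22))\<^sup>2 \<ge> a11 * a22 - a12 * a21"
    and "(1/2 * (a11 + a22))\<^sup>2 = a11 * a22 - a12 * a21 \<Longrightarrow> a12 = 0 \<and> a21 = 0 \<and> a11 = a22"
proof -
  define d where "d = (a11 - a22) / 2"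
  have a11: "a11 = a22 + 2 * d" unfolding d_def by (simp add: field_simps)
  define X where "X = (1/2 * (a11 + a22))\<^sup>2 - (a11 * a22 - a12 * a21)"
  have X: "X = d * d + a12 * a21" unfolding X_def a11 by (simp add: power2_eq_square field_simps)
  have sym': "a12 * h11 = 2 * d * h12 + a21 * h22" using sym unfolding a11 by (simp add: algebra_simps)
  have "h11 * (h11 * X) = (h11 * d) * (h11 * d) + h11 * (a12 * h11) * a21" unfolding X by (simp add: algebra_simps)
  also have "\<dots> = (h11 * d + h12 * a21)\<^sup>2 + (h11 * h22 - h12 * h12) * a21\<^sup>2"
    unfolding sym' by (simp add: power2_eq_square algebra_simps)
  finally have key: "h11 * (h11 * X) = (h11 * d + h12 * a21)\<^sup>2 + (h11 * h22 - h12 * h12) * a21\<^sup>2" .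
  then have "h11 * (h11 * X) \<ge> 0" using h by simp
  then show "(1/2 * (a11 + a22))\<^sup>2 \<ge> a11 * a22 - a12 * a21" using h(1) by (simp add: zero_le_mult_iff X_def)
  assume "(1/2 * (a11 + a22))\<^sup>2 = a11 * a22 - a12 * a21"
  then have "(h11 * d + h12 * a21)\<^sup>2 + (h11 * h22 - h12 * h12) * a21\<^sup>2 = 0" using key by (simp add: X_def)
  moreover have "(h11 * h22 - h12 * h12) * a21\<^sup>2 \<ge> 0" using h by simp
  ultimately have "(h11 * d + h12 * a21)\<^sup>2 = 0" "(h11 * h22 - h12 * h12) * a21\<^sup>2 = 0"
    using zero_le_power2[of "h11 * d + h12 * a21"] by linarith+
  then have a21: "a21 = 0" and "h11 * d + h12 * a21 = 0" using h(2) by auto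
  then have "d = 0" using h(1) by simp
  then have "a12 * h11 = 0" using sym' a21 by simp
  then show "a12 = 0 \<and> a21 = 0 \<and> a11 = a22" using a21 h(1) \<open>d = 0\<close> a11 by simp
qed

lemma pd_symmetric:
  fixes f :: "real^2 \<Rightarrow> 'b::euclidean_space"
  assumes "open U" "smooth_on f U" "u \<in> U"
  shows "pd i (pd j f) u = pd j (pd i f) u"
  unfolding pd_def using second_derivative_symmetric[OF assms] by blast

text \<open>Along the line in direction \<open>(s, t)\<close> the derivative of \<open>f\<close>
  vanishes at the maximum. A positive second derivative would make it positive right after, and
  \<open>f\<close> would grow.\<close>

lemma second_derivative_test_max:
  fixes f :: "real^2 \<Rightarrow> real"
  assumes U: "open U" "u \<in> U" and f: "smooth_on f U" and max: "\<And>x. x \<in> U \<Longrightarrow> f x \<le> f u"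
  shows "s\<^sup>2 * pd 1 (pd 1 f) u + 2 * s * t * pd 1 (pd 2 f) u + t\<^sup>2 * pd 2 (pd 2 f) u \<le> 0"
proof (rule ccontr)
  define w :: "real^2" where "w = vector [s, t]"
  have w: "w $ 1 = s" "w $ 2 = t" by (auto simp: w_def)
  define f1 where "f1 x = fderiv f x w" for x
  have f1: "smooth_on f1 U" unfolding f1_def by (rule smooth_on_frechet_derivative[OF f])
  have f1_pd: "f1 x = s * pd 1 f x + t * pd 2 f x" if "x \<in> U" for x
    unfolding f1_def using frechet_derivative_pd[OF smooth_on_frechet_linear[OF f that], of w] w by simp
  have d: "(pd i f has_derivative fderiv (pd i f) u) (at u)" for i
    using smooth_on_imp_has_derivative[OF smooth_on_pd[OF f] U(2)] .
  have "((\<lambda>x. s * pd 1 f x + t * pd 2 f x) has_derivative (\<lambda>h. s * fderiv (pd 1 f) u h + t * fderiv (pd 2 f) u h)) (at u)"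
    using d by (auto intro!: derivative_eq_intros)
  then have df1: "(f1 has_derivative (\<lambda>h. s * fderiv (pd 1 f) u h + t * fderiv (pd 2 f) u h)) (at u)"
    by (rule has_derivative_transform_within_open[OF _ U]) (simp add: f1_pd)
  define f2 where "f2 = s * fderiv (pd 1 f) u w + t * fderiv (pd 2 f) u w"
  have pdw: "fderiv (pd i f) u w = s * pd 1 (pd i f) u + t * pd 2 (pd i f) u" for i
    using frechet_derivative_pd[OF smooth_on_frechet_linear[OF smooth_on_pd[OF f] U(2)], of i w] w by simp
  assume "\<not> s\<^sup>2 * pd 1 (pd 1 f) u + 2 * s * t * pd 1 (pd 2 f) u + t\<^sup>2 * pd 2 (pd 2 f) u \<le> 0"
  then have f2: "f2 > 0"
    unfolding f2_def pdw using pd_symmetric[OF U(1) f U(2), of 2 1] by (simp add: power2_eq_square algebra_simps)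
  have "f1 u = 0"
  proof -
    have "fderiv f u = (\<lambda>v. 0)"
      using differential_zero_maxmin[OF U(2,1) smooth_on_imp_has_derivative[OF f U(2)]] max by blast
    then show ?thesis by (simp add: f1_def)
  qed
  have "((\<lambda>r. f1 (u + r *\<^sub>R w)) has_real_derivative f2) (at 0)"
    using has_vector_derivative_along_line[of f1 _ u 0 w] df1
    by (simp add: has_real_derivative_iff_has_vector_derivative f2_def)
  from DERIV_pos_inc_right[OF this f2]
  obtain d1 where d1: "d1 > 0" "\<And>r. 0 < r \<Longrightarrow> r < d1 \<Longrightarrow> f1 u < f1 (u + r *\<^sub>R w)"
    by (simp only: add_0_left scaleR_zero_left add_0_right) blast
  obtain d2 where d2: "d2 > 0" "ball u d2 \<subseteq> U" using U openE by blast
  define r where "r = min (d1 / 2) (d2 / (norm w + 1))"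
  have r: "0 < r" "r < d1" "r \<le> d2 / (norm w + 1)" using d1 d2 by (auto simp: r_def add_nonneg_pos)
  have inU: "u + x *\<^sub>R w \<in> U" if "0 \<le> x" "x \<le> r" for x
  proof -
    have "x * norm w \<le> d2 / (norm w + 1) * norm w" using that r by (intro mult_right_mono) auto
    also have "\<dots> < d2 / (norm w + 1) * (norm w + 1)" using d2(1) by (intro mult_strict_left_mono) (auto simp: add_nonneg_pos)
    also have "\<dots> = d2" using add_nonneg_pos[of "norm w" 1] by simp
    finally show ?thesis using that d2(2) by (auto simp: dist_norm subset_iff)
  qed
  have der: "((\<lambda>x. f (u + x *\<^sub>R w)) has_real_derivative f1 (u + x *\<^sub>R w)) (at x)" if "0 \<le> x" "x \<le> r" for x
    using has_vector_derivative_along_line[OF smooth_on_imp_has_derivative[OF f inU[OF that]]]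
    by (simp add: has_real_derivative_iff_has_vector_derivative f1_def)
  obtain z where z: "0 < z" "z < r" "f (u + r *\<^sub>R w) - f (u + 0 *\<^sub>R w) = (r - 0) * f1 (u + z *\<^sub>R w)"
    using MVT2[OF r(1), of "\<lambda>x. f (u + x *\<^sub>R w)" "\<lambda>x. f1 (u + x *\<^sub>R w)"] der by blast
  have "f1 (u + z *\<^sub>R w) > 0" using d1(2)[OF z(1)] z(2) r(2) \<open>f1 u = 0\<close> by simp
  then have "f (u + r *\<^sub>R w) - f u > 0" using z(3) r(1) by simp
  then show False using max[OF inU[of r]] r(1) by simp
qed

text \<open>\<open>mean_curvature\<close> and the determinant of d\<eta> involve a chosen basis and
  a chosen derivative at each point; continuity is visible only in chart formulas, and this
  transfers it to \<open>M\<close>.\<close>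

lemma continuous_on_surface:
  assumes M: "smooth_surface M"
    and c: "\<And>U \<phi>. local_param M U \<phi> \<Longrightarrow> continuous_on U (\<lambda>u. f (\<phi> u))"
  shows "continuous_on M (f :: real^3 \<Rightarrow> 'b::topological_space)"
  unfolding continuous_on_eq_continuous_within
proof
  fix p assume p: "p \<in> M"
  then obtain U \<phi> where lp: "local_param M U \<phi>" and pU: "p \<in> \<phi> ` U"
    using M unfolding smooth_surface_def by blast
  obtain T where T: "open T" "\<phi> ` U = M \<inter> T" using lp_relatively_open[OF lp] .
  have "continuous_on (\<phi> ` U) (\<lambda>x. f (\<phi> (inv_into U \<phi> x)))"
    by (rule continuous_on_compose2[OF c[OF lp] homeomorphism_cont2[OF lp_homeomorphism[OF lp]]])
       (auto simp: inv_into_into)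
  then have "continuous_on (\<phi> ` U) f"
    by (rule continuous_on_eq) (simp add: f_inv_into_f)
  then have "continuous (at p within \<phi> ` U) f" using pU unfolding continuous_on_eq_continuous_within by blast
  moreover have "at p within \<phi> ` U = at p within M"
    unfolding T(2) using pU T by (intro at_within_nhd[of p T]) auto
  ultimately show "continuous (at p within M) f" by simp
qed

section \<open>Closed surfaces with a Birkhoff-Gauss map\<close>

locale birkhoff_surface = minkowski_space +
  fixes M :: "(real^3) set" and \<eta> :: "real^3 \<Rightarrow> real^3"
  assumes M: "connected_closed_surface M" and bgm: "birkhoff_gauss_map N M \<eta>"
begin

lemma M_smooth: "smooth_surface M" and M_compact: "compact M" and M_connected: "connected M"
  and M_nonempty: "M \<noteq> {}"
  using M by (auto simp: connected_closed_surface_def)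

lemma \<eta>_smooth: "smooth_map_on M \<eta>" and \<eta>_S: "p \<in> M \<Longrightarrow> \<eta> p \<in> S"
  and \<eta>_orth: "p \<in> M \<Longrightarrow> birkhoff_orthogonal N (\<eta> p) (tangent_space M p)"
  using bgm by (auto simp: birkhoff_gauss_map_def)

lemma \<eta>_continuous: "continuous_on M \<eta>"
  by (rule smooth_map_on_continuous[OF \<eta>_smooth])

lemma \<eta>_nonzero: "p \<in> M \<Longrightarrow> \<eta> p \<noteq> 0" using \<eta>_S S_nonzero by blast

lemma chartE:
  assumes "p \<in> M"
  obtains U \<phi> u where "local_param M U \<phi>" "u \<in> U" "\<phi> u = p"
  using M_smooth assms unfolding smooth_surface_def by (metis imageE)

text \<open>Birkhoff orthogonality says that \<open>t = 0\<close> minimises \<open>N\<close> on each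
  tangent line through \<open>\<eta> p\<close>, so the derivative vanishes there.\<close>

lemma G_tangent:
  assumes p: "p \<in> M" and w: "w \<in> tangent_space M p"
  shows "G (\<eta> p) \<bullet> w = 0"
proof (rule DERIV_local_min[OF N_along_line[OF \<eta>_nonzero[OF p]]])
  show "\<forall>t. \<bar>0 - t\<bar> < 1 \<longrightarrow> N (\<eta> p + 0 *\<^sub>R w) \<le> N (\<eta> p + t *\<^sub>R w)"
    using \<eta>_orth[OF p] w by (simp add: birkhoff_orthogonal_def)
qed simp

definition K :: "real^3 \<Rightarrow> real" where
  "K p = plane_det (tangent_space M p) (surface_diff M \<eta> p)"

abbreviation H :: "real^3 \<Rightarrow> real" where
  "H \<equiv> mean_curvature M \<eta>"

context
  fixes U \<phi> u
  assumes lp: "local_param M U \<phi>" and u: "u \<in> U"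
begin

lemma chart_M: "\<phi> u \<in> M"
  using lp_subset[OF lp] u by blast

lemma chart_normal: "G (\<eta> (\<phi> u)) \<bullet> pd i \<phi> u = 0"
  using G_tangent[OF chart_M] tangent_space_chart[OF lp u] by (auto simp: pd_def)

lemma chart_triple: "triple (pd 1 \<phi> u) (pd 2 \<phi> u) (\<eta> (\<phi> u)) \<noteq> 0"
proof (rule triple_nonzero[OF lp_pd_independent[OF lp u]])
  show "pd 1 \<phi> u \<bullet> G (\<eta> (\<phi> u)) = 0" "pd 2 \<phi> u \<bullet> G (\<eta> (\<phi> u)) = 0" "\<eta> (\<phi> u) \<bullet> G (\<eta> (\<phi> u)) \<noteq> 0"
    using chart_normal S_inner[OF \<eta>_S[OF chart_M]] by (simp_all add: inner_commute[of _ "G (\<eta> (\<phi> u))"])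
qed

lemma chart_\<eta>_smooth: "smooth_on (\<lambda>x. \<eta> (\<phi> x)) U"
  by (rule lp_compose_smooth[OF lp \<eta>_smooth])

lemma chart_\<eta>_derivative: "((\<lambda>x. \<eta> (\<phi> x)) has_derivative fderiv (\<lambda>x. \<eta> (\<phi> x)) u) (at u)"
  by (rule smooth_on_imp_has_derivative[OF chart_\<eta>_smooth u])

lemma chart_\<eta>_normal: "G (\<eta> (\<phi> u)) \<bullet> pd i (\<lambda>x. \<eta> (\<phi> x)) u = 0"
  unfolding pd_def
  by (rule unit_field_derivative[OF chart_\<eta>_derivative lp_open[OF lp] u]) (use lp_subset[OF lp] \<eta>_S in blast)

lemma chart_expansion:
  assumes "G (\<eta> (\<phi> u)) \<bullet> w = 0"
  defines "T \<equiv> triple (pd 1 \<phi> u) (pd 2 \<phi> u) (\<eta> (\<phi> u))"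
  shows "w = (triple w (pd 2 \<phi> u) (\<eta> (\<phi> u)) / T) *\<^sub>R pd 1 \<phi> u + (triple (pd 1 \<phi> u) w (\<eta> (\<phi> u)) / T) *\<^sub>R pd 2 \<phi> u"
  unfolding T_def
  by (rule plane_expansion[OF chart_triple chart_normal chart_normal _ assms(1)])
     (use S_inner[OF \<eta>_S[OF chart_M]] in simp)

text \<open>Differentiating \<open>G(\<eta>) \<bullet> \<phi>\<^sub>j = 0\<close> shows that \<open>d\<eta>\<close> is self-adjoint with respect to the
  restriction of the Hessian of \<open>N\<close>.\<close>

lemma chart_second_form:
  "dG (\<eta> (\<phi> u)) (pd i (\<lambda>x. \<eta> (\<phi> x)) u) \<bullet> pd j \<phi> u = - (G (\<eta> (\<phi> u)) \<bullet> pd i (pd j \<phi>) u)"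
proof -
  let ?e = "fderiv (\<lambda>x. \<eta> (\<phi> x)) u"
  have dj: "(pd j \<phi> has_derivative fderiv (pd j \<phi>) u) (at u)"
    by (rule smooth_on_imp_has_derivative[OF smooth_on_pd[OF lp_smooth[OF lp]] u])
  have dg: "((\<lambda>x. G (\<eta> (\<phi> x))) has_derivative (\<lambda>w. dG (\<eta> (\<phi> u)) (?e w))) (at u)"
    by (rule has_derivative_compose[OF chart_\<eta>_derivative G_derivative[OF \<eta>_nonzero[OF chart_M]]])
  have "((\<lambda>x. G (\<eta> (\<phi> x)) \<bullet> pd j \<phi> x) has_derivative
      (\<lambda>w. G (\<eta> (\<phi> u)) \<bullet> fderiv (pd j \<phi>) u w + dG (\<eta> (\<phi> u)) (?e w) \<bullet> pd j \<phi> u)) (at u)"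
    by (rule has_derivative_inner[OF dg dj])
  then have "G (\<eta> (\<phi> u)) \<bullet> fderiv (pd j \<phi>) u (axis i 1) + dG (\<eta> (\<phi> u)) (?e (axis i 1)) \<bullet> pd j \<phi> u = 0"
  proof (rule has_derivative_locally_constant[OF _ lp_open[OF lp] u])
    fix x assume "x \<in> U"
    then have "pd j \<phi> x \<in> tangent_space M (\<phi> x)" "\<phi> x \<in> M"
      using tangent_space_chart[OF lp] lp_subset[OF lp] by (auto simp: pd_def)
    then show "G (\<eta> (\<phi> x)) \<bullet> pd j \<phi> x = 0" using G_tangent by blast
  qed
  then show ?thesis unfolding pd_def by linarith
qed

lemma surface_diff_pd: "surface_diff M \<eta> (\<phi> u) (pd i \<phi> u) = pd i (\<lambda>x. \<eta> (\<phi> x)) u"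
  using pd_eqI[OF lp_compose_has_derivative[OF lp u smooth_map_on_has_derivative[OF \<eta>_smooth chart_M]], of i]
  by (simp add: pd_def)

text \<open>With \<open>a\<close> the matrix of d\<eta> in the basis \<open>x, y\<close> and
  \<open>h\<close> that of the Hessian, the first two claims are multilinearity of
  \<open>triple\<close> and the next two are \<open>selfadjoint_trace_det\<close>. In the last, the
  determinant of the given form is \<open>K\<close> times the positive determinant of
  \<open>h\<close>.\<close>

lemma chart_curvatures:
  defines "x \<equiv> pd 1 \<phi> u" and "y \<equiv> pd 2 \<phi> u" and "q \<equiv> \<eta> (\<phi> u)"
    and "ex \<equiv> pd 1 (\<lambda>x. \<eta> (\<phi> x)) u" and "ey \<equiv> pd 2 (\<lambda>x. \<eta> (\<phi> x)) u"
  shows "H (\<phi> u) = 1/2 * ((triple ex y q + triple x ey q) / triple x y q)" (is ?A)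
    and "K (\<phi> u) = triple ex ey q / triple x y q" (is ?B)
    and "(H (\<phi> u))\<^sup>2 \<ge> K (\<phi> u)" (is ?C)
    and "(H (\<phi> u))\<^sup>2 = K (\<phi> u) \<Longrightarrow> ex = H (\<phi> u) *\<^sub>R x \<and> ey = H (\<phi> u) *\<^sub>R y"
    and "(\<forall>s t. s\<^sup>2 * (dG q ex \<bullet> x) + 2 * s * t * (dG q ex \<bullet> y) + t\<^sup>2 * (dG q ey \<bullet> y) \<ge> 0) \<or>
         (\<forall>s t. s\<^sup>2 * (dG q ex \<bullet> x) + 2 * s * t * (dG q ex \<bullet> y) + t\<^sup>2 * (dG q ey \<bullet> y) \<le> 0) \<Longrightarrow> K (\<phi> u) \<ge> 0"
proof -
  have qS: "q \<in> S" unfolding q_def by (rule \<eta>_S[OF chart_M])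
  have q0: "q \<noteq> 0" by (rule S_nonzero[OF qS])
  have T: "triple x y q \<noteq> 0" unfolding x_def y_def q_def by (rule chart_triple)
  have Gxy: "G q \<bullet> x = 0" "G q \<bullet> y = 0" unfolding x_def y_def q_def by (rule chart_normal)+
  have ind: "indep2 x y" unfolding x_def y_def by (rule lp_indep2[OF lp u])
  obtain a11 a21 where ex: "ex = a11 *\<^sub>R x + a21 *\<^sub>R y"
    using chart_expansion[OF chart_\<eta>_normal] unfolding ex_def x_def y_def by blast
  obtain a12 a22 where ey: "ey = a12 *\<^sub>R x + a22 *\<^sub>R y"
    using chart_expansion[OF chart_\<eta>_normal] unfolding ey_def x_def y_def by blast
  define L where "L = surface_diff M \<eta> (\<phi> u)"
  have L: "L x = ex" "L y = ey" unfolding L_def x_def y_def ex_def ey_def by (rule surface_diff_pd)+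
  have Llin: "linear L"
    unfolding L_def using smooth_map_on_has_derivative[OF \<eta>_smooth chart_M] has_derivative_linear by blast
  have tan: "tangent_space M (\<phi> u) = range (\<lambda>(s, t). s *\<^sub>R x + t *\<^sub>R y)"
    unfolding x_def y_def by (rule tangent_space_pd[OF lp u])
  have tr: "H (\<phi> u) = 1/2 * (a11 + a22)" and det: "K (\<phi> u) = a11 * a22 - a12 * a21"
    using plane_trace_det_eq[OF ind tan Llin L(1)[unfolded ex] L(2)[unfolded ey]]
    by (simp_all add: mean_curvature_def K_def L_def)
  have tp: "triple ex y q = a11 * triple x y q" "triple x ey q = a22 * triple x y q"
    "triple ex ey q = (a11 * a22 - a12 * a21) * triple x y q"
    unfolding ex ey by (simp_all add: triple_add triple_scale triple_same triple_swap[of y x] algebra_simps)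
  show ?A using T unfolding tr tp by (simp add: add_divide_distrib)
  show ?B using T unfolding det tp by simp
  have l: "linear (dG q)" by (rule dG_linear[OF q0])
  define h11 h12 h22 where "h11 = dG q x \<bullet> x" and "h12 = dG q x \<bullet> y" and "h22 = dG q y \<bullet> y"
  have h21: "dG q y \<bullet> x = h12" unfolding h12_def by (rule dG_symmetric[OF q0])
  have "x \<noteq> 0" using indep2_eqD[OF ind, of 1 0 0 0] by auto
  then have h11: "h11 > 0" unfolding h11_def by (intro dG_definite[OF qS Gxy(1)])
  \<comment> \<open>This vector is orthogonal to \<open>x\<close> for the Hessian, and its positive
    value is \<open>h11\<close> times the determinant of \<open>h\<close>.\<close>
  have "h12 *\<^sub>R x + (- h11) *\<^sub>R y \<noteq> 0" using indep2_eqD[OF ind, of h12 "- h11" 0 0] h11 by auto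
  then have "dG q (h12 *\<^sub>R x + (- h11) *\<^sub>R y) \<bullet> (h12 *\<^sub>R x + (- h11) *\<^sub>R y) > 0"
    using Gxy by (intro dG_definite[OF qS]) (simp_all add: inner_add_right inner_diff_right)
  also have "dG q (h12 *\<^sub>R x + (- h11) *\<^sub>R y) \<bullet> (h12 *\<^sub>R x + (- h11) *\<^sub>R y)
      = h12 * h12 * h11 - 2 * h12 * h11 * h12 + h11 * h11 * h22"
    unfolding linear_add[OF l] linear_cmul[OF l] inner_add_left inner_add_right inner_scaleR_left inner_scaleR_right
      h11_def[symmetric] h12_def[symmetric] h22_def[symmetric] h21 by algebra
  finally have "h11 * (h11 * h22 - h12 * h12) > 0" by (simp add: algebra_simps)
  then have hdet: "h11 * h22 - h12 * h12 > 0" using h11 by (simp add: zero_less_mult_iff)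
  have B: "dG q ex \<bullet> x = a11 * h11 + a21 * h12" "dG q ex \<bullet> y = a11 * h12 + a21 * h22"
    "dG q ey \<bullet> x = a12 * h11 + a22 * h12" "dG q ey \<bullet> y = a12 * h12 + a22 * h22"
    unfolding ex ey linear_add[OF l] linear_cmul[OF l] inner_add_left inner_scaleR_left
    by (simp_all add: h11_def h12_def h22_def h21[unfolded h12_def])
  \<comment> \<open>Both sides are minus the gradient paired with a mixed second derivative of
    \<phi>, and these commute.\<close>
  have "dG q ex \<bullet> y = dG q ey \<bullet> x"
    unfolding q_def ex_def ey_def x_def y_def chart_second_form
    using pd_symmetric[OF lp_open[OF lp] lp_smooth[OF lp] u] by metis
  then have sym: "a11 * h12 + a21 * h22 = a12 * h11 + a22 * h12" using B by simp
  note sa = selfadjoint_trace_det[OF h11 hdet sym]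
  show ?C using sa(1) unfolding tr det .
  show "ex = H (\<phi> u) *\<^sub>R x \<and> ey = H (\<phi> u) *\<^sub>R y" if "(H (\<phi> u))\<^sup>2 = K (\<phi> u)"
  proof -
    have "a12 = 0 \<and> a21 = 0 \<and> a11 = a22" using sa(2) that unfolding tr det by blast
    then show ?thesis using tr ex ey by simp
  qed
  assume semi: "(\<forall>s t. s\<^sup>2 * (dG q ex \<bullet> x) + 2 * s * t * (dG q ex \<bullet> y) + t\<^sup>2 * (dG q ey \<bullet> y) \<ge> 0) \<or>
         (\<forall>s t. s\<^sup>2 * (dG q ex \<bullet> x) + 2 * s * t * (dG q ex \<bullet> y) + t\<^sup>2 * (dG q ey \<bullet> y) \<le> 0)"
  have "(dG q ex \<bullet> x) * (dG q ey \<bullet> y) - (dG q ex \<bullet> y) * (dG q ex \<bullet> y) \<ge> 0"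
    using semi
  proof
    assume "\<forall>s t. s\<^sup>2 * (dG q ex \<bullet> x) + 2 * s * t * (dG q ex \<bullet> y) + t\<^sup>2 * (dG q ey \<bullet> y) \<ge> 0"
    then show ?thesis by (intro semidefinite_det_nonneg) blast
  next
    assume le: "\<forall>s t. s\<^sup>2 * (dG q ex \<bullet> x) + 2 * s * t * (dG q ex \<bullet> y) + t\<^sup>2 * (dG q ey \<bullet> y) \<le> 0"
    have "(- (dG q ex \<bullet> x)) * (- (dG q ey \<bullet> y)) - (- (dG q ex \<bullet> y)) * (- (dG q ex \<bullet> y)) \<ge> 0"
    proof (rule semidefinite_det_nonneg)
      fix s t :: real
      show "s\<^sup>2 * - (dG q ex \<bullet> x) + 2 * s * t * - (dG q ex \<bullet> y) + t\<^sup>2 * - (dG q ey \<bullet> y) \<ge> 0"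
        using le[rule_format, of s t] by simp
    qed
    then show ?thesis by simp
  qed
  also have "(dG q ex \<bullet> x) * (dG q ey \<bullet> y) - (dG q ex \<bullet> y) * (dG q ex \<bullet> y)
      = (a11 * h11 + a21 * h12) * (a12 * h12 + a22 * h22) - (a11 * h12 + a21 * h22) * (a12 * h11 + a22 * h12)"
    using B sym by simp
  also have "\<dots> = K (\<phi> u) * (h11 * h22 - h12 * h12)" unfolding det by algebra
  finally show "K (\<phi> u) \<ge> 0" using hdet by (simp add: zero_le_mult_iff)
qed

end

lemma H_sq_ge_K: "p \<in> M \<Longrightarrow> K p \<le> (H p)\<^sup>2"
  by (metis chartE chart_curvatures(3))

lemma H_continuous: "continuous_on M H"
proof (rule continuous_on_surface[OF M_smooth])
  fix U \<phi> assume lp: "local_param M U \<phi>"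
  have "continuous_on U (\<lambda>u. 1/2 * ((triple (pd 1 (\<lambda>x. \<eta> (\<phi> x)) u) (pd 2 \<phi> u) (\<eta> (\<phi> u)) + triple (pd 1 \<phi> u) (pd 2 (\<lambda>x. \<eta> (\<phi> x)) u) (\<eta> (\<phi> u)))
      / triple (pd 1 \<phi> u) (pd 2 \<phi> u) (\<eta> (\<phi> u))))"
    using lp_smooth[OF lp] lp_compose_smooth[OF lp \<eta>_smooth] chart_triple[OF lp]
    by (intro continuous_intros continuous_on_triple)
       (auto intro: smooth_on_imp_continuous_on smooth_on_pd)
  then show "continuous_on U (\<lambda>u. H (\<phi> u))"
    by (rule continuous_on_eq) (use chart_curvatures(1)[OF lp] in simp)
qed

lemma K_continuous: "continuous_on M K"
proof (rule continuous_on_surface[OF M_smooth])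
  fix U \<phi> assume lp: "local_param M U \<phi>"
  have "continuous_on U (\<lambda>u. triple (pd 1 (\<lambda>x. \<eta> (\<phi> x)) u) (pd 2 (\<lambda>x. \<eta> (\<phi> x)) u) (\<eta> (\<phi> u))
      / triple (pd 1 \<phi> u) (pd 2 \<phi> u) (\<eta> (\<phi> u)))"
    using lp_smooth[OF lp] lp_compose_smooth[OF lp \<eta>_smooth] chart_triple[OF lp]
    by (intro continuous_intros continuous_on_triple)
       (auto intro: smooth_on_imp_continuous_on smooth_on_pd)
  then show "continuous_on U (\<lambda>u. K (\<phi> u))"
    by (rule continuous_on_eq) (use chart_curvatures(2)[OF lp] in simp)
qed

lemma transversal_M: "transversal M \<eta>"
  unfolding transversal_def area_density_triple using \<eta>_continuous chart_triple by blast

lemmas M_surface = M_smooth M_compact transversal_M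

text \<open>The difference of the two sides is orthogonal to the tangent plane and to
  \<open>\<eta> p\<close>, which together span the space.\<close>

lemma normal_unique:
  assumes p: "p \<in> M" and c: "\<And>w. w \<in> tangent_space M p \<Longrightarrow> c \<bullet> w = 0"
  shows "c = (c \<bullet> \<eta> p) *\<^sub>R G (\<eta> p)"
proof -
  obtain U \<phi> u where lp: "local_param M U \<phi>" and u: "u \<in> U" "\<phi> u = p" using chartE[OF p] .
  define v where "v = c - (c \<bullet> \<eta> p) *\<^sub>R G (\<eta> p)"
  have tan: "pd i \<phi> u \<in> tangent_space M p" for i
    using tangent_space_chart[OF lp u(1)] u(2) by (auto simp: pd_def)
  have vx: "v \<bullet> pd i \<phi> u = 0" for i
    unfolding v_def using c[OF tan] G_tangent[OF p tan] by (simp add: inner_diff_left)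
  have v\<eta>: "v \<bullet> \<eta> p = 0" unfolding v_def using S_inner[OF \<eta>_S[OF p]] by (simp add: inner_diff_left)
  obtain r s t where "v = r *\<^sub>R pd 1 \<phi> u + s *\<^sub>R pd 2 \<phi> u + t *\<^sub>R \<eta> p"
    using triple_basis_expansion[OF chart_triple[OF lp u(1)]] u(2) by blast
  then have "v \<bullet> v = v \<bullet> (r *\<^sub>R pd 1 \<phi> u + s *\<^sub>R pd 2 \<phi> u + t *\<^sub>R \<eta> p)" by simp
  also have "\<dots> = 0" by (simp only: inner_add_right inner_scaleR_right vx v\<eta>)
  finally show ?thesis by (simp add: v_def)
qed

lemma extremal_normal:
  assumes p: "p \<in> M" and ext: "(\<forall>x\<in>M. c \<bullet> x \<le> c \<bullet> p) \<or> (\<forall>x\<in>M. c \<bullet> p \<le> c \<bullet> x)"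
    and w: "w \<in> tangent_space M p"
  shows "c \<bullet> w = 0"
proof -
  obtain U \<phi> u where lp: "local_param M U \<phi>" and u: "u \<in> U" "\<phi> u = p" using chartE[OF p] .
  have d: "((\<lambda>x. c \<bullet> \<phi> x) has_derivative (\<lambda>h. c \<bullet> fderiv \<phi> u h)) (at u)"
    using lp_has_derivative[OF lp u(1)] by (auto intro!: derivative_eq_intros)
  have "(\<lambda>h. c \<bullet> fderiv \<phi> u h) = (\<lambda>h. 0)"
    by (rule differential_zero_maxmin[OF u(1) lp_open[OF lp] d]) (use ext u lp_subset[OF lp] in blast)
  moreover obtain h where "w = fderiv \<phi> u h"
    using w tangent_space_chart[OF lp u(1)] u(2) by blast
  ultimately show ?thesis by meson
qed

text \<open>By \<open>chart_second_form\<close> the second derivatives of the height in direction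
  \<open>G (\<eta> p)\<close> are minus the coefficients of the form in the last claim of
  \<open>chart_curvatures\<close>; an extremum makes that form semidefinite.\<close>

lemma K_nonneg_extremal:
  assumes p: "p \<in> M" and ext: "(\<forall>x\<in>M. G (\<eta> p) \<bullet> x \<le> G (\<eta> p) \<bullet> p) \<or> (\<forall>x\<in>M. G (\<eta> p) \<bullet> p \<le> G (\<eta> p) \<bullet> x)"
  shows "K p \<ge> 0"
proof -
  obtain U \<phi> u where lp: "local_param M U \<phi>" and u: "u \<in> U" "\<phi> u = p" using chartE[OF p] .
  \<comment> \<open>\<epsilon> turns a minimum into a maximum, so one second derivative test serves
    both cases.\<close>
  obtain \<epsilon> :: real where \<epsilon>: "\<epsilon> = 1 \<or> \<epsilon> = -1" and max: "\<And>x. x \<in> M \<Longrightarrow> \<epsilon> * (G (\<eta> p) \<bullet> x) \<le> \<epsilon> * (G (\<eta> p) \<bullet> p)"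
  proof (cases "\<forall>x\<in>M. G (\<eta> p) \<bullet> x \<le> G (\<eta> p) \<bullet> p")
    case True
    then show ?thesis using that[of 1] by simp
  next
    case False
    then have "\<forall>x\<in>M. G (\<eta> p) \<bullet> p \<le> G (\<eta> p) \<bullet> x" using ext by blast
    then show ?thesis using that[of "-1"] by simp
  qed
  define c where "c = \<epsilon> *\<^sub>R G (\<eta> p)"
  define f where "f x = c \<bullet> \<phi> x" for x
  have bl: "bounded_linear (\<lambda>x. c \<bullet> x)" by (rule bounded_linear_inner_right)
  have f: "smooth_on f U"
    unfolding f_def smooth_on_def using lp_smooth[OF lp] Ck_on_bounded_linear[OF bl _ lp_open[OF lp]] by (auto simp: smooth_on_def)
  have pdf: "pd j f x = c \<bullet> pd j \<phi> x" if "x \<in> U" for j x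
    using pd_eqI[OF bounded_linear.has_derivative[OF bl lp_has_derivative[OF lp that]]] by (simp add: f_def[abs_def] pd_def)
  have pdpdf: "pd i (pd j f) u = c \<bullet> pd i (pd j \<phi>) u" for i j
  proof -
    have "((\<lambda>x. c \<bullet> pd j \<phi> x) has_derivative (\<lambda>h. c \<bullet> fderiv (pd j \<phi>) u h)) (at u)"
      by (rule bounded_linear.has_derivative[OF bl smooth_on_imp_has_derivative[OF smooth_on_pd[OF lp_smooth[OF lp]] u(1)]])
    then have "(pd j f has_derivative (\<lambda>h. c \<bullet> fderiv (pd j \<phi>) u h)) (at u)"
      by (rule has_derivative_transform_within_open[OF _ lp_open[OF lp] u(1)]) (simp add: pdf)
    from pd_eqI[OF this, of i] show ?thesis by (simp add: pd_def)
  qed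
  define B where "B i j = dG (\<eta> (\<phi> u)) (pd i (\<lambda>x. \<eta> (\<phi> x)) u) \<bullet> pd j \<phi> u" for i j
  have pdB: "pd i (pd j f) u = - \<epsilon> * B i j" for i j
    unfolding B_def chart_second_form[OF lp u(1)] pdpdf c_def u(2)[symmetric] by simp
  have "\<forall>x\<in>U. f x \<le> f u"
    using max lp_subset[OF lp] u(2) unfolding f_def c_def by auto
  then have le: "s\<^sup>2 * (- \<epsilon> * B 1 1) + 2 * s * t * (- \<epsilon> * B 1 2) + t\<^sup>2 * (- \<epsilon> * B 2 2) \<le> 0" for s t
    unfolding pdB[symmetric] by (intro second_derivative_test_max[OF lp_open[OF lp] u(1) f]) blast
  have ge: "\<epsilon> * (s\<^sup>2 * B 1 1 + 2 * s * t * B 1 2 + t\<^sup>2 * B 2 2) \<ge> 0" for s t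
    using le[of s t] by (simp add: algebra_simps)
  have "(\<forall>s t. s\<^sup>2 * B 1 1 + 2 * s * t * B 1 2 + t\<^sup>2 * B 2 2 \<ge> 0) \<or> (\<forall>s t. s\<^sup>2 * B 1 1 + 2 * s * t * B 1 2 + t\<^sup>2 * B 2 2 \<le> 0)"
    using \<epsilon>
  proof
    assume "\<epsilon> = 1"
    then show ?thesis using ge by (intro disjI1 allI) (simp only: mult_1_left)
  next
    assume "\<epsilon> = -1"
    then show ?thesis using ge by (intro disjI2 allI) (simp only: mult_minus1 neg_0_le_iff_le)
  qed
  from chart_curvatures(5)[OF lp u(1), folded B_def, OF this] show ?thesis using u(2) by simp
qed

text \<open>In a plane orthogonal to \<open>c\<close>, take a tangent vector \<open>w\<close> and a
  point \<open>p'\<close> of \<open>M\<close> maximal in direction \<open>w\<close>. There both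
  \<open>w\<close> and \<open>c\<close> are normal to \<open>M\<close>, hence parallel, although
  they are nonzero and orthogonal.\<close>

lemma M_not_planar:
  assumes p: "p \<in> M" and c: "c \<noteq> 0" shows "\<exists>x\<in>M. c \<bullet> x \<noteq> c \<bullet> p"
proof (rule ccontr)
  assume "\<not> (\<exists>x\<in>M. c \<bullet> x \<noteq> c \<bullet> p)"
  then have pl: "c \<bullet> x = c \<bullet> p" if "x \<in> M" for x using that by blast
  obtain U \<phi> u where lp: "local_param M U \<phi>" and u: "u \<in> U" "\<phi> u = p" using chartE[OF p] .
  define w where "w = pd 1 \<phi> u"
  have w0: "w \<noteq> 0" unfolding w_def using indep2_eqD[OF lp_indep2[OF lp u(1)], of 1 0 0 0] by auto
  have "w \<in> tangent_space M p" unfolding w_def using tangent_space_chart[OF lp u(1)] u(2) by (auto simp: pd_def)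
  then have cw: "c \<bullet> w = 0" using extremal_normal[OF p] pl by (metis order_refl)
  have "continuous_on M (\<lambda>x. w \<bullet> x)" by (intro continuous_intros)
  then obtain p' where p': "p' \<in> M" "\<And>x. x \<in> M \<Longrightarrow> w \<bullet> x \<le> w \<bullet> p'"
    using continuous_attains_sup[OF M_compact M_nonempty] by blast
  define g where "g = G (\<eta> p')"
  obtain k l where "w = k *\<^sub>R g" "c = l *\<^sub>R g"
    unfolding g_def using normal_unique[OF p'(1), of w] normal_unique[OF p'(1), of c]
      extremal_normal[OF p'(1), of w] extremal_normal[OF p'(1), of c] p'(2) pl p' by (metis order_refl)
  then show False using cw w0 c by auto
qed

end

section \<open>The Willmore inequality\<close>

text \<open>Otherwise \<open>k\<close> is nonzero on a nonempty open set of parameters; since the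
  density is positive, that set would be Lebesgue null.\<close>

lemma area_integral_eq_0_imp:
  fixes k :: "real^3 \<Rightarrow> real"
  assumes M: "smooth_surface M" "compact M" "transversal M \<eta>"
    and k: "continuous_on M k" "\<And>p. p \<in> M \<Longrightarrow> k p \<ge> 0" and int: "(\<integral>p. k p \<partial>area_measure M \<eta>) = 0"
    and p: "p \<in> M"
  shows "k p = 0"
proof (rule ccontr)
  assume "k p \<noteq> 0"
  obtain m U \<phi> P where "param_partition M \<eta> m U \<phi> P" using param_partition_exists[OF M] .
  then interpret param_partition M \<eta> m U \<phi> P .
  have "AE q in \<mu>. k q = 0"
    using int k(2) by (subst integral_nonneg_eq_0_iff_AE[symmetric, OF integrable_area_continuous[OF k(1)]])
      (auto intro!: AE_I2 simp: space_area)
  obtain V0 \<psi>0 u0 where "local_param M V0 \<psi>0" "u0 \<in> V0" "\<psi>0 u0 = p"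
    using M(1) p unfolding smooth_surface_def by (metis imageE)
  then obtain V \<psi> where V: "positive_param M \<eta> V \<psi>" "p \<in> \<psi> ` V"
    using positive_param_exists[OF M(3)] by metis
  note lp = positive_paramD(1)[OF V(1)]
  have ck: "continuous_on V (\<lambda>u. k (\<psi> u))"
    by (rule continuous_on_compose2[OF k(1) lp_continuous[OF lp] lp_subset[OF lp]])
  define W where "W = {u\<in>V. k (\<psi> u) \<noteq> 0}"
  have "open (V \<inter> (\<lambda>u. k (\<psi> u)) -` (- {0}))"
    by (rule continuous_open_preimage[OF ck lp_open[OF lp]]) auto
  moreover have "W = V \<inter> (\<lambda>u. k (\<psi> u)) -` (- {0})" by (auto simp: W_def)
  ultimately have oW: "open W" by simp
  have W0: "W \<noteq> {}" using V(2) \<open>k p \<noteq> 0\<close> by (auto simp: W_def)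
  have im: "\<psi> ` W \<in> sets borel" by (rule lp_image_borel[OF lp M_borel]) (use oW in \<open>auto simp: W_def\<close>)
  have WM: "\<psi> ` W \<subseteq> M" using lp_subset[OF lp] by (auto simp: W_def)
  have "AE q in \<mu>. q \<notin> \<psi> ` W"
    using \<open>AE q in \<mu>. k q = 0\<close> by eventually_elim (auto simp: W_def)
  then have "emeasure \<mu> (\<psi> ` W) = 0"
    using im WM sets_area_iff by (subst (asm) AE_iff_null_sets[symmetric]) auto
  moreover have "emeasure \<mu> (\<psi> ` W) = chart_area \<eta> \<psi> W"
  proof -
    have "W \<in> sets borel" "W \<subseteq> V" using oW by (auto simp: W_def)
    then show ?thesis using is_area_measure_area_measure V(1) unfolding is_area_measure_def by blast
  qed
  ultimately have "(\<integral>\<^sup>+ u. ennreal (area_density \<eta> \<psi> u) * indicator W u \<partial>lborel) = 0" by simp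
  moreover have "(\<lambda>u. ennreal (area_density \<eta> \<psi> u) * indicator W u) \<in> borel_measurable borel"
    by (rule indicator_continuous_measurable_ennreal[OF area_density_continuous[OF cont lp]])
       (use oW in \<open>auto simp: W_def\<close>)
  ultimately have "AE u in lborel. ennreal (area_density \<eta> \<psi> u) * indicator W u = 0"
    by (subst (asm) nn_integral_0_iff_AE) auto
  then have "AE u in lborel. u \<notin> W"
  proof eventually_elim
    case (elim u)
    show ?case
    proof
      assume "u \<in> W"
      moreover from this have "area_density \<eta> \<psi> u > 0" using positive_paramD(2)[OF V(1)] by (simp add: W_def)
      ultimately show False using elim by simp
    qed
  qed
  then have "W \<in> null_sets lborel"
    using oW by (subst (asm) AE_iff_null_sets[symmetric]) auto
  then have "negligible W" by (simp add: negligible_iff_null_sets null_sets_completionI)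
  then show False using open_not_negligible[OF oW W0] by blast
qed

text \<open>Comparing the two mixed second derivatives of \<open>e\<close> gives \<open>\<Lambda>\<^sub>1 \<phi>\<^sub>2 = \<Lambda>\<^sub>2 \<phi>\<^sub>1\<close>.\<close>

lemma umbilic_factor_constant:
  fixes \<phi> e :: "real^2 \<Rightarrow> real^3"
  assumes B: "open B" "connected B" and sm: "smooth_on \<phi> B" "smooth_on e B"
    and ind: "\<And>x. x \<in> B \<Longrightarrow> indep2 (pd 1 \<phi> x) (pd 2 \<phi> x)"
    and e: "\<And>x i. x \<in> B \<Longrightarrow> pd i e x = \<Lambda> x *\<^sub>R pd i \<phi> x"
    and xy: "x \<in> B" "y \<in> B"
  shows "\<Lambda> x = \<Lambda> y"
proof (rule has_derivative_zero_unique_connected[OF B _ xy])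
  fix x assume x: "x \<in> B"
  have d\<phi>: "(pd i \<phi> has_derivative fderiv (pd i \<phi>) x) (at x)" for i
    by (rule smooth_on_imp_has_derivative[OF smooth_on_pd[OF sm(1)] x])
  have de: "(pd i e has_derivative fderiv (pd i e) x) (at x)" for i
    by (rule smooth_on_imp_has_derivative[OF smooth_on_pd[OF sm(2)] x])
  have nz: "pd 1 \<phi> y \<bullet> pd 1 \<phi> y \<noteq> 0" if "y \<in> B" for y
    using indep2_eqD[OF ind[OF that], of 1 0 0 0] by auto
  have "(\<lambda>y. (pd 1 e y \<bullet> pd 1 \<phi> y) / (pd 1 \<phi> y \<bullet> pd 1 \<phi> y)) differentiable (at x)"
    using d\<phi> de nz[OF x] by (intro differentiable_divide differentiable_inner) (auto simp: differentiable_def)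
  then obtain D where "((\<lambda>y. (pd 1 e y \<bullet> pd 1 \<phi> y) / (pd 1 \<phi> y \<bullet> pd 1 \<phi> y)) has_derivative D) (at x)"
    by (auto simp: differentiable_def)
  then have D: "(\<Lambda> has_derivative D) (at x)"
    by (rule has_derivative_transform_within_open[OF _ B(1) x]) (use e nz in simp)
  have pp: "pd i (pd j e) x = \<Lambda> x *\<^sub>R pd i (pd j \<phi>) x + D (axis i 1) *\<^sub>R pd j \<phi> x" for i j
  proof -
    have "((\<lambda>y. \<Lambda> y *\<^sub>R pd j \<phi> y) has_derivative (\<lambda>h. \<Lambda> x *\<^sub>R fderiv (pd j \<phi>) x h + D h *\<^sub>R pd j \<phi> x)) (at x)"
      by (rule has_derivative_scaleR[OF D d\<phi>])
    then have "(pd j e has_derivative (\<lambda>h. \<Lambda> x *\<^sub>R fderiv (pd j \<phi>) x h + D h *\<^sub>R pd j \<phi> x)) (at x)"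
      by (rule has_derivative_transform_within_open[OF _ B(1) x]) (use e in simp)
    from pd_eqI[OF this, of i] show ?thesis by (simp add: pd_def)
  qed
  have "D (axis 1 1) *\<^sub>R pd 2 \<phi> x = D (axis 2 1) *\<^sub>R pd 1 \<phi> x"
    using pd_symmetric[OF B(1) sm(2) x, of 1 2] pd_symmetric[OF B(1) sm(1) x, of 1 2] unfolding pp by simp
  then have "D (axis 2 1) *\<^sub>R pd 1 \<phi> x + (- D (axis 1 1)) *\<^sub>R pd 2 \<phi> x = 0 *\<^sub>R pd 1 \<phi> x + 0 *\<^sub>R pd 2 \<phi> x" by simp
  from indep2_eqD[OF ind[OF x] this] have D0: "D (axis 1 1) = 0" "D (axis 2 1) = 0" by auto
  have l: "linear D" using D has_derivative_linear by blast
  have "D h = 0" for h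
  proof -
    have "D h = D (h$1 *\<^sub>R axis 1 1 + h$2 *\<^sub>R axis 2 1)" by (rule arg_cong[OF vec2_axis])
    then show ?thesis by (simp add: linear_add[OF l] linear_cmul[OF l] D0)
  qed
  then have "D = (\<lambda>h. 0)" by blast
  then show "(\<Lambda> has_derivative (\<lambda>h. 0)) (at x)" using D by simp
qed

section \<open>Supporting points and the lower bound\<close>

context birkhoff_surface
begin

definition A_max :: "(real^3) set" where
  "A_max = {p\<in>M. \<forall>x\<in>M. G (\<eta> p) \<bullet> x \<le> G (\<eta> p) \<bullet> p}"

definition A_min :: "(real^3) set" where
  "A_min = {p\<in>M. \<forall>x\<in>M. G (\<eta> p) \<bullet> p \<le> G (\<eta> p) \<bullet> x}"

lemma supporting_point:
  assumes q: "q \<in> S"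
  shows "(\<exists>p\<in>A_max. \<eta> p = q) \<or> (\<exists>p\<in>A_min. - \<eta> p = q)"
proof -
  have "continuous_on M (\<lambda>x. G q \<bullet> x)" by (intro continuous_intros)
  then obtain p where p: "p \<in> M" "\<And>x. x \<in> M \<Longrightarrow> G q \<bullet> x \<le> G q \<bullet> p"
    using continuous_attains_sup[OF M_compact M_nonempty] by blast
  have "G q = (G q \<bullet> \<eta> p) *\<^sub>R G (\<eta> p)"
    by (rule normal_unique[OF p(1)], rule extremal_normal[OF p(1)]) (use p(2) in auto)
  from normal_determines[OF q \<eta>_S[OF p(1)] this refl]
  obtain s where s: "s = 1 \<or> s = -1" "q = s *\<^sub>R \<eta> p" "G q = s *\<^sub>R G (\<eta> p)" by blast
  from s(1) show ?thesis
  proof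
    assume "s = 1"
    then show ?thesis using s p by (intro disjI1 bexI[of _ p]) (auto simp: A_max_def)
  next
    \<comment> \<open>Here \<open>G q = - G (\<eta> p)\<close>, so a maximum for \<open>G q\<close>
      is a minimum for \<open>G (\<eta> p)\<close>.\<close>
    assume "s = -1"
    then show ?thesis using s p by (intro disjI2 bexI[of _ p]) (auto simp: A_min_def)
  qed
qed

lemma G\<eta>_continuous: "continuous_on M (\<lambda>p. G (\<eta> p))"
  by (rule continuous_on_compose2[OF smooth_on_imp_continuous_on[OF G_smooth] \<eta>_continuous])
     (auto simp: \<eta>_nonzero)

lemma A_closed: "closed A_max" "closed A_min"
proof -
  have M_closed: "closed M" using M_compact compact_imp_closed by blast
  have "closed {p\<in>M. G (\<eta> p) \<bullet> x \<le> G (\<eta> p) \<bullet> p}" "closed {p\<in>M. G (\<eta> p) \<bullet> p \<le> G (\<eta> p) \<bullet> x}" for x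
    by (intro continuous_on_closed_Collect_le M_closed continuous_intros G\<eta>_continuous)+
  moreover have "A_max = (\<Inter>x\<in>M. {p\<in>M. G (\<eta> p) \<bullet> x \<le> G (\<eta> p) \<bullet> p})"
    "A_min = (\<Inter>x\<in>M. {p\<in>M. G (\<eta> p) \<bullet> p \<le> G (\<eta> p) \<bullet> x})"
    using M_nonempty by (auto simp: A_max_def A_min_def)
  ultimately show "closed A_max" "closed A_min" by auto
qed

text \<open>A point of both sets would put \<open>M\<close> into a plane.\<close>

lemma A_disjoint: "A_max \<inter> A_min = {}"
proof -
  have False if p: "p \<in> A_max" "p \<in> A_min" for p
  proof -
    have pM: "p \<in> M" using p by (simp add: A_max_def)
    have "G (\<eta> p) \<noteq> 0" using S_inner[OF \<eta>_S[OF pM]] by auto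
    then obtain x where "x \<in> M" "G (\<eta> p) \<bullet> x \<noteq> G (\<eta> p) \<bullet> p" using M_not_planar[OF pM] by blast
    then show False using p by (auto simp: A_max_def A_min_def intro: antisym)
  qed
  then show ?thesis by blast
qed

lemma K_nonneg_A: "p \<in> A_max \<or> p \<in> A_min \<Longrightarrow> K p \<ge> 0"
  using K_nonneg_extremal unfolding A_max_def A_min_def by blast

abbreviation "\<mu> \<equiv> area_measure M \<eta>"
abbreviation "\<nu> \<equiv> area_measure S (\<lambda>q. q)"

lemma smooth_map_on_uminus: "smooth_map_on X f \<Longrightarrow> smooth_map_on X (\<lambda>p. - f p)"
  unfolding smooth_map_on_def smooth_on_def
proof (intro ballI)
  fix p assume "\<forall>p\<in>X. \<exists>W F. open W \<and> p \<in> W \<and> (\<forall>k. Ck_on k F W) \<and> (\<forall>x\<in>X \<inter> W. F x = f x)" "p \<in> X"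
  then obtain W F where "open W" "p \<in> W" "\<forall>k. Ck_on k F W" "\<forall>x\<in>X \<inter> W. F x = f x" by blast
  then show "\<exists>W F. open W \<and> p \<in> W \<and> (\<forall>k. Ck_on k F W) \<and> (\<forall>x\<in>X \<inter> W. F x = - f x)"
    by (intro exI[of _ W] exI[of _ "\<lambda>x. - F x"] conjI allI Ck_on_minus) auto
qed

lemma sphere_area_le_K: "emeasure \<nu> S \<le> (\<integral>\<^sup>+ p. ennreal (max (K p) 0) \<partial>\<mu>)"
proof -
  obtain m U \<phi> P where "param_partition M \<eta> m U \<phi> P"
    using param_partition_exists[OF M_surface] .
  then interpret pm: param_partition M \<eta> m U \<phi> P .
  obtain m' U' \<phi>' P' where "param_partition S (\<lambda>q. q) m' U' \<phi>' P'"
    using param_partition_exists[OF S_surface] .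
  then interpret ps: param_partition S "\<lambda>q. q" m' U' \<phi>' P' .
  define k where "k p = ennreal (max (K p) 0)" for p
  have "continuous_on M (\<lambda>p. max (K p) 0)" by (intro continuous_intros K_continuous)
  then have k: "k \<in> borel_measurable (restrict_space borel M)"
    using borel_measurable_continuous_on_restrict unfolding k_def by measurable
  \<comment> \<open>The Jacobian of \<eta> is \<open>K\<close> times the area density, and
    \<open>K\<close> is nonnegative at supporting points of either kind.\<close>
  have kb: "ennreal \<bar>triple (pd 1 (\<lambda>x. \<eta> (\<phi> x)) u) (pd 2 (\<lambda>x. \<eta> (\<phi> x)) u) (\<eta> (\<phi> u))\<bar> \<le> k (\<phi> u) * ennreal (area_density \<eta> \<phi> u)"
    if "positive_param M \<eta> U \<phi>" "u \<in> U" "\<phi> u \<in> A_max \<or> \<phi> u \<in> A_min" for U \<phi> u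
  proof -
    note lp = positive_paramD(1)[OF that(1)]
    have T: "triple (pd 1 \<phi> u) (pd 2 \<phi> u) (\<eta> (\<phi> u)) > 0"
      using positive_paramD(2)[OF that(1,2)] by (simp add: area_density_triple)
    have "triple (pd 1 (\<lambda>x. \<eta> (\<phi> x)) u) (pd 2 (\<lambda>x. \<eta> (\<phi> x)) u) (\<eta> (\<phi> u)) = K (\<phi> u) * area_density \<eta> \<phi> u"
      using chart_curvatures(2)[OF lp that(2)] T by (simp add: area_density_triple)
    then show ?thesis
      using K_nonneg_A[OF that(3)] T by (simp add: k_def area_density_triple ennreal_mult[symmetric])
  qed
  define E where "E = \<eta> ` A_max"
  have AM: "A_max \<subseteq> M" "A_min \<subseteq> M" by (auto simp: A_max_def A_min_def)
  have Ab: "A_max \<in> sets borel" "A_min \<in> sets borel" using A_closed by auto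
  have "compact A_max" using A_closed(1) M_compact AM(1) by (metis compact_Int_closed inf.absorb2)
  then have "compact E" unfolding E_def
    using compact_continuous_image[OF continuous_on_subset[OF \<eta>_continuous AM(1)]] by blast
  then have Eb: "E \<in> sets borel" by (rule borel_compact)
  have ES: "E \<subseteq> S" unfolding E_def using AM \<eta>_S by auto
  have 1: "emeasure \<nu> E \<le> (\<integral>\<^sup>+ p\<in>A_max. k p \<partial>\<mu>)"
  proof (rule area_measure_image_le[OF M_surface S_surface \<eta>_smooth])
    show "\<eta> ` M \<subseteq> S" using \<eta>_S by blast
    fix U \<phi> u assume a: "positive_param M \<eta> U \<phi>" "u \<in> U" "\<phi> u \<in> A_max"
    then show "ennreal (jac (\<lambda>x. \<eta> (\<phi> x)) (\<lambda>q. q) u) \<le> k (\<phi> u) * ennreal (area_density \<eta> \<phi> u)"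
      unfolding jac_def using kb[OF a(1,2)] by blast
  qed (use Ab AM Eb k in \<open>auto simp: E_def\<close>)
  \<comment> \<open>Aiming at \<open>S - E\<close> instead of the full image under -\<eta> makes the
    two targets disjoint, so their areas add up to that of the sphere.\<close>
  have 2: "emeasure \<nu> (S - E) \<le> (\<integral>\<^sup>+ p\<in>A_min. k p \<partial>\<mu>)"
  proof (rule area_measure_image_le[OF M_surface S_surface smooth_map_on_uminus[OF \<eta>_smooth]])
    show "(\<lambda>p. - \<eta> p) ` M \<subseteq> S" using \<eta>_S S_minus by blast
    show "S - E \<subseteq> (\<lambda>p. - \<eta> p) ` A_min" using supporting_point by (auto simp: E_def)
    fix U \<phi> u assume a: "positive_param M \<eta> U \<phi>" "u \<in> U" "\<phi> u \<in> A_min"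
    note lp = positive_paramD(1)[OF a(1)]
    have "pd i (\<lambda>x. - \<eta> (\<phi> x)) u = - pd i (\<lambda>x. \<eta> (\<phi> x)) u" for i
      using pd_eqI[OF has_derivative_minus[OF chart_\<eta>_derivative[OF lp a(2)]], of i] by (simp add: pd_def)
    then have "jac (\<lambda>x. - \<eta> (\<phi> x)) (\<lambda>q. q) u = \<bar>triple (pd 1 (\<lambda>x. \<eta> (\<phi> x)) u) (pd 2 (\<lambda>x. \<eta> (\<phi> x)) u) (\<eta> (\<phi> u))\<bar>"
      by (simp add: jac_def triple_minus)
    then show "ennreal (jac (\<lambda>x. - \<eta> (\<phi> x)) (\<lambda>q. q) u) \<le> k (\<phi> u) * ennreal (area_density \<eta> \<phi> u)"
      using kb[OF a(1,2)] a(3) by simp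
  qed (use Ab AM Eb k ps.M_borel in auto)
  have k\<mu>: "k \<in> borel_measurable \<mu>" using k by (simp add: measurable_cong_sets[OF pm.sets_area refl])
  have A\<mu>: "A_max \<in> sets \<mu>" "A_min \<in> sets \<mu>" using Ab AM pm.sets_area_iff by auto
  have "emeasure \<nu> S = emeasure \<nu> E + emeasure \<nu> (S - E)"
  proof -
    have "E \<in> sets \<nu>" "S - E \<in> sets \<nu>" using Eb ES ps.M_borel ps.sets_area_iff by auto
    then show ?thesis using plus_emeasure[of E \<nu> "S - E"] ES by (simp add: Un_absorb1)
  qed
  also have "\<dots> \<le> (\<integral>\<^sup>+ p\<in>A_max. k p \<partial>\<mu>) + (\<integral>\<^sup>+ p\<in>A_min. k p \<partial>\<mu>)" by (rule add_mono[OF 1 2])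
  also have "\<dots> = (\<integral>\<^sup>+ p. (k p * indicator A_max p + k p * indicator A_min p) \<partial>\<mu>)"
    using k\<mu> A\<mu> by (intro nn_integral_add[symmetric] borel_measurable_times_ennreal borel_measurable_indicator)
  also have "\<dots> \<le> (\<integral>\<^sup>+ p. k p \<partial>\<mu>)"
    using A_disjoint by (intro nn_integral_mono) (auto simp: indicator_def)
  finally show ?thesis by (simp add: k_def)
qed

lemma unit_sphere_area_eq: "unit_sphere_area N = measure \<nu> S" "emeasure \<nu> S < \<infinity>" "measure \<nu> S > 0"
proof -
  obtain m' U' \<phi>' P' where "param_partition S (\<lambda>q. q) m' U' \<phi>' P'"
    using param_partition_exists[OF S_surface] .
  then interpret ps: param_partition S "\<lambda>q. q" m' U' \<phi>' P' .
  have i: "(\<integral>p. (1::real) \<partial>\<nu>) = measure \<nu> S"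
    by (simp add: ps.space_area)
  then show "unit_sphere_area N = measure \<nu> S"
    by (simp add: unit_sphere_area_def surface_integral_def)
  show "emeasure \<nu> S < \<infinity>" by (rule ps.emeasure_area_finite)
  obtain q where "q \<in> S" using S_nonempty by blast
  then have "(\<integral>p. (1::real) \<partial>\<nu>) \<noteq> 0"
    using area_integral_eq_0_imp[OF S_surface, of "\<lambda>_. 1"] by auto
  then show "measure \<nu> S > 0" using i by (simp add: zero_less_measure_iff)
qed

lemma integrable_M: "continuous_on M (k :: real^3 \<Rightarrow> real) \<Longrightarrow> integrable \<mu> k"
  and space_M: "space \<mu> = M" and emeasure_M_finite: "emeasure \<mu> M < \<infinity>"
proof -
  obtain m U \<phi> P where "param_partition M \<eta> m U \<phi> P"
    using param_partition_exists[OF M_surface] .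
  then interpret pm: param_partition M \<eta> m U \<phi> P .
  show "continuous_on M (k :: real^3 \<Rightarrow> real) \<Longrightarrow> integrable \<mu> k" "space \<mu> = M" "emeasure \<mu> M < \<infinity>"
    using pm.integrable_area_continuous pm.space_area pm.emeasure_area_finite by auto
qed

lemma K_pos_continuous: "continuous_on M (\<lambda>p. max (K p) 0)"
  by (intro continuous_intros K_continuous)

lemma H_sq_continuous: "continuous_on M (\<lambda>p. (H p)\<^sup>2)"
  by (intro continuous_intros H_continuous)

lemma sphere_area_le_K_real: "unit_sphere_area N \<le> (\<integral>p. max (K p) 0 \<partial>\<mu>)"
proof -
  have "(\<integral>\<^sup>+ p. ennreal (max (K p) 0) \<partial>\<mu>) = ennreal (\<integral>p. max (K p) 0 \<partial>\<mu>)"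
    by (rule nn_integral_eq_integral[OF integrable_M[OF K_pos_continuous]]) auto
  then have "ennreal (measure \<nu> S) \<le> ennreal (\<integral>p. max (K p) 0 \<partial>\<mu>)"
    using sphere_area_le_K emeasure_eq_ennreal_measure[of \<nu> S] unit_sphere_area_eq(2) by simp
  moreover have "(\<integral>p. max (K p) 0 \<partial>\<mu>) \<ge> 0" by (rule integral_nonneg_AE) auto
  ultimately show ?thesis unfolding unit_sphere_area_eq(1) by simp
qed

lemma K_pos_le_H_sq: "p \<in> M \<Longrightarrow> max (K p) 0 \<le> (H p)\<^sup>2"
  using H_sq_ge_K by simp

lemma integral_K_le_H: "(\<integral>p. max (K p) 0 \<partial>\<mu>) \<le> (\<integral>p. (H p)\<^sup>2 \<partial>\<mu>)"
  by (rule integral_mono[OF integrable_M[OF K_pos_continuous] integrable_M[OF H_sq_continuous]])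
     (use K_pos_le_H_sq space_M in auto)

theorem willmore_inequality: "unit_sphere_area N \<le> surface_integral M \<eta> (\<lambda>p. (H p)\<^sup>2)"
  unfolding surface_integral_def using sphere_area_le_K_real integral_K_le_H by linarith

text \<open>The sphere has positive area, which bounds the integral of the positive part of
  \<open>K\<close> from below. The point found here starts the connectedness argument.\<close>

lemma K_pos_exists: "\<exists>p\<in>M. K p > 0"
proof (rule ccontr)
  assume "\<not> (\<exists>p\<in>M. K p > 0)"
  then have "(\<integral>p. max (K p) 0 \<partial>\<mu>) = (\<integral>p. 0 \<partial>\<mu>)"
    by (intro Bochner_Integration.integral_cong) (auto simp: space_M max_def not_less intro: antisym)
  then show False using sphere_area_le_K_real unit_sphere_area_eq(1,3) by simp
qed

section \<open>The equality case\<close>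

text \<open>The open-closed argument on the connected surface, with openness to be checked in charts
  only.\<close>

lemma M_locally_constant:
  assumes closed: "closedin (top_of_set M) C" and p0: "p0 \<in> C"
    and loc: "\<And>U \<phi> u. local_param M U \<phi> \<Longrightarrow> u \<in> U \<Longrightarrow> \<phi> u \<in> C \<Longrightarrow> \<exists>V. open V \<and> u \<in> V \<and> V \<subseteq> U \<and> \<phi> ` V \<subseteq> C"
  shows "C = M"
proof -
  have CM: "C \<subseteq> M" using closed closedin_imp_subset by blast
  have "openin (top_of_set M) C"
  proof (subst openin_subopen, intro ballI)
    fix p assume p: "p \<in> C"
    then obtain U \<phi> u where lp: "local_param M U \<phi>" and u: "u \<in> U" "\<phi> u = p" using chartE CM by blast
    then obtain V where V: "open V" "u \<in> V" "V \<subseteq> U" "\<phi> ` V \<subseteq> C" using loc p by metis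
    have "openin (top_of_set M) (\<phi> ` V)" by (rule lp_openin[OF local_param_subset[OF lp V(1,3)]])
    then show "\<exists>T. openin (top_of_set M) T \<and> p \<in> T \<and> T \<subseteq> C" using V u by blast
  qed
  then show ?thesis using M_connected closed p0 unfolding connected_clopen by blast
qed

lemma equality_imp_sphere:
  assumes eq: "surface_integral M \<eta> (\<lambda>p. (H p)\<^sup>2) = unit_sphere_area N"
  shows "minkowski_sphere N M"
proof -
  have HK: "(H p)\<^sup>2 = max (K p) 0" if "p \<in> M" for p
  proof -
    have "(\<integral>p. (H p)\<^sup>2 - max (K p) 0 \<partial>\<mu>) = (\<integral>p. (H p)\<^sup>2 \<partial>\<mu>) - (\<integral>p. max (K p) 0 \<partial>\<mu>)"
      by (rule Bochner_Integration.integral_diff[OF integrable_M[OF H_sq_continuous] integrable_M[OF K_pos_continuous]])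
    also have "\<dots> = 0"
      using eq sphere_area_le_K_real integral_K_le_H unfolding surface_integral_def by linarith
    finally have "(H p)\<^sup>2 - max (K p) 0 = 0"
      by (intro area_integral_eq_0_imp[OF M_surface _ _ _ that, of "\<lambda>p. (H p)\<^sup>2 - max (K p) 0"])
         (use K_pos_le_H_sq in \<open>auto intro!: continuous_on_diff H_sq_continuous K_pos_continuous\<close>)
    then show ?thesis by simp
  qed
  obtain p0 where p0: "p0 \<in> M" "K p0 > 0" using K_pos_exists by blast
  define c where "c = H p0"
  have c: "c\<^sup>2 = K p0" "c \<noteq> 0" unfolding c_def using HK[OF p0(1)] p0(2) by auto
  have c2: "c\<^sup>2 > 0" using c(2) by simp
  \<comment> \<open>Recording \<open>K\<close> next to \<open>H\<close> keeps \<open>K\<close>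
    positive near each point of \<open>C\<close>. All points there are umbilic, and
    \<open>umbilic_factor_constant\<close> makes \<open>H\<close> constant, so \<open>C\<close> is
    open.\<close>
  define C where "C = {p\<in>M. H p = c \<and> K p = c\<^sup>2}"
  have "C = M"
  proof (rule M_locally_constant)
    from continuous_closedin_preimage_constant[OF H_continuous] continuous_closedin_preimage_constant[OF K_continuous]
    have "closedin (top_of_set M) ({p\<in>M. H p = c} \<inter> {p\<in>M. K p = c\<^sup>2})" by (rule closedin_Int)
    moreover have "C = {p\<in>M. H p = c} \<inter> {p\<in>M. K p = c\<^sup>2}" by (auto simp: C_def)
    ultimately show "closedin (top_of_set M) C" by simp
    show "p0 \<in> C" using p0 c by (simp add: C_def c_def)
    fix U \<phi> u assume lp: "local_param M U \<phi>" and u: "u \<in> U" and uC: "\<phi> u \<in> C"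
    have "continuous_on U (\<lambda>x. K (\<phi> x))"
      by (rule continuous_on_compose2[OF K_continuous lp_continuous[OF lp] lp_subset[OF lp]])
    then have "open (U \<inter> (\<lambda>x. K (\<phi> x)) -` {0<..})"
      using lp_open[OF lp] by (rule continuous_open_preimage) auto
    moreover have "u \<in> U \<inter> (\<lambda>x. K (\<phi> x)) -` {0<..}" using u uC c2 by (auto simp: C_def)
    ultimately obtain r where r: "r > 0" "ball u r \<subseteq> U \<inter> (\<lambda>x. K (\<phi> x)) -` {0<..}" using openE by blast
    have rU: "ball u r \<subseteq> U" using r by blast
    have KH: "(H (\<phi> x))\<^sup>2 = K (\<phi> x)" if "x \<in> ball u r" for x
    proof -
      have "x \<in> U" "K (\<phi> x) > 0" using that r(2) by auto
      moreover have "\<phi> x \<in> M" using \<open>x \<in> U\<close> lp_subset[OF lp] by blast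
      ultimately show ?thesis using HK by simp
    qed
    have umb: "pd i (\<lambda>x. \<eta> (\<phi> x)) x = H (\<phi> x) *\<^sub>R pd i \<phi> x" if "x \<in> ball u r" for i x
    proof -
      have xU: "x \<in> U" using that rU by blast
      show ?thesis using chart_curvatures(4)[OF lp xU KH[OF that]] exhaust_2[of i] by auto
    qed
    have Hc: "H (\<phi> x) = H (\<phi> u)" if "x \<in> ball u r" for x
    proof (rule umbilic_factor_constant[of "ball u r" \<phi> "\<lambda>x. \<eta> (\<phi> x)"])
      show "smooth_on \<phi> (ball u r)" by (rule smooth_on_subset[OF lp_smooth[OF lp] rU])
      show "smooth_on (\<lambda>x. \<eta> (\<phi> x)) (ball u r)"
        by (rule smooth_on_subset[OF lp_compose_smooth[OF lp \<eta>_smooth] rU])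
      show "indep2 (pd 1 \<phi> x) (pd 2 \<phi> x)" if "x \<in> ball u r" for x using lp_indep2[OF lp] that rU by blast
    qed (use umb that r in auto)
    have "\<phi> x \<in> C" if "x \<in> ball u r" for x
    proof -
      have "\<phi> x \<in> M" using that rU lp_subset[OF lp] by blast
      then show ?thesis using Hc[OF that] KH[OF that] uC by (simp add: C_def)
    qed
    then have "\<phi> ` ball u r \<subseteq> C" by blast
    then show "\<exists>V. open V \<and> u \<in> V \<and> V \<subseteq> U \<and> \<phi> ` V \<subseteq> C" using r(1) rU by (intro exI[of _ "ball u r"]) auto
  qed
  have all: "H p = c" "(H p)\<^sup>2 = K p" if "p \<in> M" for p
  proof -
    have "p \<in> C" using that \<open>C = M\<close> by simp
    then show "H p = c" "(H p)\<^sup>2 = K p" by (simp_all add: C_def)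
  qed
  define b where "b = \<eta> p0 - c *\<^sub>R p0"
  define D where "D = {p\<in>M. \<eta> p - c *\<^sub>R p = b}"
  have "D = M"
  proof (rule M_locally_constant)
    show "closedin (top_of_set M) D" unfolding D_def
      by (intro continuous_closedin_preimage_constant continuous_intros \<eta>_continuous)
    show "p0 \<in> D" using p0 by (simp add: D_def b_def)
    fix U \<phi> u assume lp: "local_param M U \<phi>" and u: "u \<in> U" and uD: "\<phi> u \<in> D"
    obtain r where r: "r > 0" "ball u r \<subseteq> U" using lp_open[OF lp] u openE by blast
    have const: "\<eta> (\<phi> x) - c *\<^sub>R \<phi> x = \<eta> (\<phi> u) - c *\<^sub>R \<phi> u" if "x \<in> ball u r" for x
    proof (rule has_derivative_zero_unique_connected[of "ball u r" "\<lambda>x. \<eta> (\<phi> x) - c *\<^sub>R \<phi> x"])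
      fix y assume "y \<in> ball u r"
      then have y: "y \<in> U" using r by blast
      have yM: "\<phi> y \<in> M" using y lp_subset[OF lp] by blast
      have pd: "pd i (\<lambda>x. \<eta> (\<phi> x)) y = c *\<^sub>R pd i \<phi> y" for i
        using chart_curvatures(4)[OF lp y all(2)[OF yM]] all(1)[OF yM] exhaust_2[of i] by auto
      have "fderiv (\<lambda>x. \<eta> (\<phi> x)) y h - c *\<^sub>R fderiv \<phi> y h = 0" for h
        unfolding lp_derivative_pd[OF lp y]
          frechet_derivative_pd[OF has_derivative_linear[OF chart_\<eta>_derivative[OF lp y]]] pd
        by (simp add: algebra_simps)
      then show "((\<lambda>x. \<eta> (\<phi> x) - c *\<^sub>R \<phi> x) has_derivative (\<lambda>h. 0)) (at y)"
        using has_derivative_diff[OF chart_\<eta>_derivative[OF lp y] has_derivative_scaleR_right[OF lp_has_derivative[OF lp y], of c]] by simp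
    qed (use that r in auto)
    have "\<phi> x \<in> D" if "x \<in> ball u r" for x
    proof -
      have "\<phi> x \<in> M" using that r(2) lp_subset[OF lp] by blast
      then show ?thesis using const[OF that] uD by (simp add: D_def)
    qed
    then have "\<phi> ` ball u r \<subseteq> D" by blast
    then show "\<exists>V. open V \<and> u \<in> V \<and> V \<subseteq> U \<and> \<phi> ` V \<subseteq> D" using r by (intro exI[of _ "ball u r"]) auto
  qed
  \<comment> \<open>The centre, obtained by writing \<open>c *\<^sub>R p + b\<close> as a multiple
    of \<open>p - a\<close>.\<close>
  define a where "a = - (inverse c *\<^sub>R b)"
  have \<eta>_eq: "\<eta> p = c *\<^sub>R (p - a)" if "p \<in> M" for p
  proof -
    have "p \<in> D" using that \<open>D = M\<close> by simp
    then have "\<eta> p - c *\<^sub>R p = b" by (simp add: D_def)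
    then show ?thesis using c(2) by (simp add: a_def algebra_simps)
  qed
  \<comment> \<open>\<open>G (\<eta> p)\<close> supports the unit ball at \<open>\<eta> p\<close>;
    the affine relation pulls this back to \<open>M\<close>, with the direction of the inequality
    set by the sign of \<open>c\<close>.\<close>
  have sup: "c * (G (\<eta> p) \<bullet> x) \<le> c * (G (\<eta> p) \<bullet> p)" if "p \<in> M" "x \<in> M" for p x
  proof -
    have "G (\<eta> p) \<bullet> \<eta> x \<le> G (\<eta> p) \<bullet> \<eta> p"
      using G_le[OF \<eta>_nonzero[OF that(1)], of "\<eta> x"] S_N[OF \<eta>_S[OF that(2)]] S_inner[OF \<eta>_S[OF that(1)]] by simp
    then have "G (\<eta> p) \<bullet> (c *\<^sub>R (x - a)) \<le> G (\<eta> p) \<bullet> (c *\<^sub>R (p - a))" using \<eta>_eq that by metis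
    then show ?thesis by (simp add: inner_diff_right algebra_simps)
  qed
  \<comment> \<open>By \<open>sup\<close> every point of \<open>M\<close> is in \<open>A_max\<close>
    if \<open>c > 0\<close> and in \<open>A_min\<close> if \<open>c < 0\<close>, so the other set is
    empty. In the second case \<open>supporting_point\<close> is applied to
    \<open>- q\<close>.\<close>
  have onto: "\<exists>p\<in>M. \<eta> p = q" if q: "q \<in> S" for q
  proof (cases "c > 0")
    case True
    have "A_min \<subseteq> A_max" using sup True by (auto simp: A_min_def A_max_def)
    then have "A_min = {}" using A_disjoint by blast
    then show ?thesis using supporting_point[OF q] by (auto simp: A_max_def)
  next
    case False
    then have "c < 0" using c(2) by simp
    then have "A_max \<subseteq> A_min" using sup by (auto simp: A_min_def A_max_def)
    then have "A_max = {}" using A_disjoint by blast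
    then obtain p where "p \<in> A_min" "- \<eta> p = - q" using supporting_point[OF S_minus[OF q]] by auto
    then show ?thesis by (auto simp: A_min_def)
  qed
  have "M = {x. N (x - a) = 1 / \<bar>c\<bar>}"
  proof (intro set_eqI iffI)
    fix x assume x: "x \<in> M"
    have "\<bar>c\<bar> * N (x - a) = 1" using S_N[OF \<eta>_S[OF x]] unfolding \<eta>_eq[OF x] N_scale .
    then show "x \<in> {x. N (x - a) = 1 / \<bar>c\<bar>}" using c(2) by (simp add: field_simps)
  next
    fix x assume "x \<in> {x. N (x - a) = 1 / \<bar>c\<bar>}"
    then have "c *\<^sub>R (x - a) \<in> S" using c(2) by (simp add: unit_sphere_def N_scale)
    \<comment> \<open>The point of \<open>M\<close> with this normal can only be \<open>x\<close>,
      since \<open>\<eta>_eq\<close> recovers a point from its normal.\<close>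
    then obtain p where p: "p \<in> M" "\<eta> p = c *\<^sub>R (x - a)" using onto by blast
    then have "x = p" using \<eta>_eq[OF p(1)] c(2) by simp
    then show "x \<in> M" using p by simp
  qed
  then show ?thesis unfolding minkowski_sphere_def using c(2) by (intro exI[of _ a] exI[of _ "1 / \<bar>c\<bar>"]) simp
qed

text \<open>The unit radial field \<open>(p - a) / r\<close> is normal in the sense of Birkhoff, so
  \<eta> agrees with it up to sign and \<open>(H p)\<^sup>2\<close> is \<open>1 / r\<^sup>2\<close>.
  For the area an upper bound is enough.\<close>

lemma sphere_imp_equality:
  assumes "minkowski_sphere N M"
  shows "surface_integral M \<eta> (\<lambda>p. (H p)\<^sup>2) = unit_sphere_area N"
proof -
  obtain a r where r: "r > 0" and M_eq: "M = {x. N (x - a) = r}" using assms by (auto simp: minkowski_sphere_def)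
  define \<rho> where "\<rho> p = inverse r *\<^sub>R (p - a)" for p
  have \<rho>S: "\<rho> p \<in> S" if "p \<in> M" for p
    using that r by (simp add: \<rho>_def unit_sphere_def N_scale M_eq)
  have tan: "G (\<rho> p) \<bullet> w = 0" if p: "p \<in> M" and w: "w \<in> tangent_space M p" for p w
  proof -
    obtain U \<phi> u where lp: "local_param M U \<phi>" and u: "u \<in> U" "\<phi> u = p" using chartE[OF p] .
    have "((\<lambda>x. \<rho> (\<phi> x)) has_derivative (\<lambda>h. inverse r *\<^sub>R fderiv \<phi> u h)) (at u)"
      unfolding \<rho>_def using lp_has_derivative[OF lp u(1)] by (auto intro!: derivative_eq_intros)
    then have "G (\<rho> (\<phi> u)) \<bullet> (inverse r *\<^sub>R fderiv \<phi> u h) = 0" for h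
      by (rule unit_field_derivative[OF _ lp_open[OF lp] u(1)]) (use \<rho>S lp_subset[OF lp] in blast)
    moreover obtain h where "w = fderiv \<phi> u h"
      using w tangent_space_chart[OF lp u(1)] u(2) by blast
    ultimately show ?thesis using r u(2) by simp
  qed
  define \<sigma> where "\<sigma> p = G (\<rho> p) \<bullet> \<eta> p" for p
  have \<sigma>: "\<eta> p = \<sigma> p *\<^sub>R \<rho> p" "\<sigma> p = 1 \<or> \<sigma> p = -1" if p: "p \<in> M" for p
  proof -
    have "G (\<rho> p) = (G (\<rho> p) \<bullet> \<eta> p) *\<^sub>R G (\<eta> p)" by (rule normal_unique[OF p tan[OF p]])
    from normal_determines[OF \<rho>S[OF p] \<eta>_S[OF p] this refl]
    obtain s where s: "s = 1 \<or> s = -1" "\<rho> p = s *\<^sub>R \<eta> p" by blast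
    then have "\<eta> p = s *\<^sub>R \<rho> p" by auto
    moreover from this have "\<sigma> p = s" using S_inner[OF \<rho>S[OF p]] by (simp add: \<sigma>_def)
    ultimately show "\<eta> p = \<sigma> p *\<^sub>R \<rho> p" "\<sigma> p = 1 \<or> \<sigma> p = -1" using s by auto
  qed
  have \<rho>_cont: "continuous_on M \<rho>" unfolding \<rho>_def by (intro continuous_intros)
  have "continuous_on M (\<lambda>p. G (\<rho> p))"
    by (rule continuous_on_compose2[OF smooth_on_imp_continuous_on[OF G_smooth] \<rho>_cont])
       (auto dest: S_nonzero[OF \<rho>S])
  then have \<sigma>_cont: "continuous_on M \<sigma>" unfolding \<sigma>_def by (intro continuous_intros \<eta>_continuous)
  have H2: "(H p)\<^sup>2 = 1 / r\<^sup>2" if p: "p \<in> M" for p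
  proof -
    obtain U \<phi> u where lp: "local_param M U \<phi>" and u: "u \<in> U" "\<phi> u = p" using chartE[OF p] .
    define s where "s = \<sigma> p"
    have "continuous_on U (\<lambda>x. \<sigma> (\<phi> x))"
      by (rule continuous_on_compose2[OF \<sigma>_cont lp_continuous[OF lp] lp_subset[OF lp]])
    \<comment> \<open>\<sigma> takes only the values 1 and -1, so within distance 1 of
      \<open>s\<close> it equals \<open>s\<close>, and \<eta> is a fixed multiple of \<rho> near
      \<open>u\<close>.\<close>
    then have oV: "open (U \<inter> (\<lambda>x. \<sigma> (\<phi> x)) -` ball s 1)"
      using lp_open[OF lp] by (rule continuous_open_preimage) auto
    have uV: "u \<in> U \<inter> (\<lambda>x. \<sigma> (\<phi> x)) -` ball s 1" using u by (simp add: s_def)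
    have "((\<lambda>x. s *\<^sub>R \<rho> (\<phi> x)) has_derivative (\<lambda>h. (s / r) *\<^sub>R fderiv \<phi> u h)) (at u)"
      unfolding \<rho>_def using lp_has_derivative[OF lp u(1)]
      by (auto intro!: derivative_eq_intros simp: divide_inverse)
    then have "((\<lambda>x. \<eta> (\<phi> x)) has_derivative (\<lambda>h. (s / r) *\<^sub>R fderiv \<phi> u h)) (at u)"
    proof (rule has_derivative_transform_within_open[OF _ oV uV])
      fix x assume x: "x \<in> U \<inter> (\<lambda>x. \<sigma> (\<phi> x)) -` ball s 1"
      then have xM: "\<phi> x \<in> M" using lp_subset[OF lp] by blast
      have "\<sigma> (\<phi> x) = s"
        using \<sigma>(2)[OF xM] \<sigma>(2)[OF p] x by (auto simp: s_def dist_real_def)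
      then show "s *\<^sub>R \<rho> (\<phi> x) = \<eta> (\<phi> x)" using \<sigma>(1)[OF xM] by simp
    qed
    then have pd: "pd i (\<lambda>x. \<eta> (\<phi> x)) u = (s / r) *\<^sub>R pd i \<phi> u" for i
      by (simp add: pd_eqI) (simp add: pd_def)
    have "H (\<phi> u) = s / r"
      unfolding chart_curvatures(1)[OF lp u(1)] pd triple_scale
      using chart_triple[OF lp u(1)] by (simp add: add_divide_distrib)
    then show ?thesis using u(2) \<sigma>(2)[OF p] r by (auto simp: s_def power_divide)
  qed
  \<comment> \<open>The homothety inverse to \<rho>; it scales areas by \<open>r\<^sup>2\<close>,
    which cancels against \<open>(H p)\<^sup>2\<close>.\<close>
  define f where "f q = a + r *\<^sub>R q" for q
  have f_\<rho>: "f (\<rho> p) = p" and \<rho>_f: "\<rho> (f q) = q" for p q using r by (auto simp: f_def \<rho>_def)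
  have fM: "f q \<in> M" if "q \<in> S" for q using that r by (simp add: f_def M_eq N_scale unit_sphere_def)
  have "emeasure \<mu> M \<le> (\<integral>\<^sup>+ q\<in>S. ennreal (r\<^sup>2) \<partial>\<nu>)"
  proof (rule area_measure_image_le[OF S_surface M_surface])
    show "smooth_map_on S f" unfolding smooth_map_on_def smooth_on_def
      by (intro ballI exI[of _ UNIV] exI[of _ f]) (auto simp: f_def[abs_def] intro!: Ck_on_add Ck_on_scaleR Ck_on_const Ck_on_id)
    show "f ` S \<subseteq> M" using fM by blast
    show "S \<in> sets borel" "M \<in> sets borel" using S_compact M_compact by (auto intro: borel_compact)
    show "M \<subseteq> f ` S" using f_\<rho> \<rho>S by (metis image_eqI subsetI)
    fix U \<phi> u assume a: "positive_param S (\<lambda>q. q) U \<phi>" "u \<in> U"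
    note lp = positive_paramD(1)[OF a(1)]
    have q: "\<phi> u \<in> S" using lp_subset[OF lp] a(2) by blast
    have "((\<lambda>x. f (\<phi> x)) has_derivative (\<lambda>h. r *\<^sub>R fderiv \<phi> u h)) (at u)"
      unfolding f_def using lp_has_derivative[OF lp a(2)] by (auto intro!: derivative_eq_intros)
    then have pd: "pd i (\<lambda>x. f (\<phi> x)) u = r *\<^sub>R pd i \<phi> u" for i
      by (simp add: pd_eqI) (simp add: pd_def)
    have "jac (\<lambda>x. f (\<phi> x)) \<eta> u = r\<^sup>2 * \<bar>triple (pd 1 \<phi> u) (pd 2 \<phi> u) (\<phi> u)\<bar>"
      unfolding jac_def pd \<sigma>(1)[OF fM[OF q]] \<rho>_f triple_scale
      using \<sigma>(2)[OF fM[OF q]] r by (auto simp: abs_mult power2_eq_square)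
    also have "\<dots> = r\<^sup>2 * area_density (\<lambda>q. q) \<phi> u"
      using positive_paramD(2)[OF a] by (simp add: area_density_triple)
    finally show "ennreal (jac (\<lambda>x. f (\<phi> x)) \<eta> u) \<le> ennreal (r\<^sup>2) * ennreal (area_density (\<lambda>q. q) \<phi> u)"
      using positive_paramD(2)[OF a] by (simp add: ennreal_mult)
  qed auto
  also have "\<dots> = ennreal (r\<^sup>2) * emeasure \<nu> S"
  proof (rule nn_integral_cmult_indicator)
    obtain m' U' \<phi>' P' where "param_partition S (\<lambda>q. q) m' U' \<phi>' P'"
      using param_partition_exists[OF S_surface] .
    then interpret ps: param_partition S "\<lambda>q. q" m' U' \<phi>' P' .
    show "S \<in> sets \<nu>" using ps.sets_area_iff ps.M_borel by simp
  qed
  finally have "ennreal (measure \<mu> M) \<le> ennreal (r\<^sup>2 * measure \<nu> S)"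
    using emeasure_M_finite unit_sphere_area_eq(2)
    by (simp add: emeasure_eq_ennreal_measure ennreal_mult)
  then have le: "measure \<mu> M \<le> r\<^sup>2 * measure \<nu> S" by (subst (asm) ennreal_le_iff) simp_all
  have "surface_integral M \<eta> (\<lambda>p. (H p)\<^sup>2) = (\<integral>p. 1 / r\<^sup>2 \<partial>\<mu>)"
    unfolding surface_integral_def by (intro Bochner_Integration.integral_cong) (auto simp: space_M H2)
  also have "\<dots> = measure \<mu> M / r\<^sup>2" by (simp add: space_M)
  also have "\<dots> \<le> measure \<nu> S" using le r by (simp add: field_simps)
  finally have "surface_integral M \<eta> (\<lambda>p. (H p)\<^sup>2) \<le> unit_sphere_area N" by (simp add: unit_sphere_area_eq(1))
  \<comment> \<open>The opposite inequality holds for every closed surface.\<close>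
  then show ?thesis using willmore_inequality by simp
qed

end

theorem theorem4p2:
  fixes N :: "real^3 \<Rightarrow> real"
    and M :: "(real^3) set"
    and \<eta> :: "real^3 \<Rightarrow> real^3"
  assumes "is_norm N" and "smooth_norm N" and "strictly_convex_norm N"
    and "\<forall>q\<in>unit_sphere N. gaussian_curvature (unit_sphere N) q \<noteq> 0"
    and "connected_closed_surface M"
    and "birkhoff_gauss_map N M \<eta>"
  shows "surface_integral M \<eta> (\<lambda>p. (mean_curvature M \<eta> p)\<^sup>2) \<ge> unit_sphere_area N \<and>
         (surface_integral M \<eta> (\<lambda>p. (mean_curvature M \<eta> p)\<^sup>2) = unit_sphere_area N
            \<longleftrightarrow> minkowski_sphere N M)"
proof -
  interpret birkhoff_surface N M \<eta> by unfold_locales (use assms in auto)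
  show ?thesis using willmore_inequality equality_imp_sphere sphere_imp_equality by blast
qed

end
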